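(* Let $\Gamma$ be a $*$-semigroup that acts on the nonempty set $X$, let $\mathcal{H}$ be a Hilbert module over a locally $C^*$-algebra $\mathcal{A}$, and let $\mathbf{k}\colon X\times X\to\mathcal{L}^*(\mathcal{H})$ be a kernel. Then the following assertions are equivalent: (1) $\mathbf{k}$ is positive semidefinite and invariant under the action of $\Gamma$ on $X$ (that is, $\mathbf{k}(y,\xi\cdot x)=\mathbf{k}(\xi^*\cdot y,x)$ for all $x,y\in X$, $\xi\in\Gamma$) and, additionally, the following condition holds: (b1) For any $\xi\in\Gamma$ and any $p\in S_*(\mathcal{A})$ there exist $q\in S_*(\mathcal{A})$ and a constant $c_p(\xi)\ge 0$ such that for all $n\in\mathbb{N}$, $h_1,\dots,h_n\in\mathcal{H}$, $x_1,\dots,x_n\in X$, $$p\Bigl(\sum_{i,j=1}^n[\mathbf{k}(\xi\cdot x_i,\xi\cdot x_j)h_j,h_i]_{\mathcal{H}}\Bigr)\le c_p(\xi)\,q\Bigl(\sum_{i,j=1}^n[\mathbf{k}(x_i,x_j)h_j,h_i]_{\mathcal{H}}\Bigr).$$ (2) $\mathbf{k}$ has a $\Gamma$-invariant Hilbert $\mathcal{A}$-module linearisation $(\mathcal{K};\pi;V)$, that is: $(\mathcal{K};V)$ is a Hilbert $\mathcal{A}$-module linearisation of $\mathbf{k}$; $\pi\colon\Gamma\to\mathcal{L}^*(\mathcal{K})$ is a $*$-representation; and $V(\xi\cdot x)=\pi(\xi)V(x)$ for all $\xi\in\Gamma$ and all $x\in X$. (3) $\mathbf{k}$ admits an $\mathcal{H}$-reproducing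 kernel Hilbert $\mathcal{A}$-module $\mathcal{R}$ and there exists a $*$-representation $\rho\colon\Gamma\to\mathcal{L}^*(\mathcal{R})$ such that $\rho(\xi)\mathbf{k}_xh=\mathbf{k}_{\xi\cdot x}h$ for all $\xi\in\Gamma$, $x\in X$, $h\in\mathcal{H}$.
   Context: A locally $C^*$-algebra $\mathcal{A}$ is a complex $*$-algebra with a complete Hausdorff topology induced by a family of $C^*$-seminorms, i.e. seminorms $p$ with $p(a^*a)=p(a)^2$. $S_*(\mathcal{A})$ is the set of all continuous $C^*$-seminorms on $\mathcal{A}$. The positive elements of $\mathcal{A}$ are those of the form $a^*a$, and they define the order $\ge$. A Hilbert module over $\mathcal{A}$ (Hilbert $\mathcal{A}$-module) is a complex vector space and right $\mathcal{A}$-module $\mathcal{H}$ with a gramian $[\cdot,\cdot]\colon\mathcal{H}\times\mathcal{H}\to\mathcal{A}$, linear in the second variable, with $[x,y]=[y,x]^*$, $[x,x]\ge0$, $[x,x]=0$ iff $x=0$, and $[e,fa+gb]=[e,f]a+[e,g]b$ for $e,f,g\in\mathcal{H}$, $a,b\in\mathcal{A}$, which is complete in the topology given by the seminorms $\tilde p(h)=p([h,h])^{1/2}$, $p\in S_*(\mathcal{A})$. $\mathcal{L}^*(\mathcal{H},\mathcal{K})$ is the space of adjointable operators, i.e. linear $T\colon\mathcal{H}\to\mathcal{K}$ for which there is a linear $T^*\colon\mathcal{K}\to\mathcal{H}$ with $[Th,k]_{\mathcal{K}}=[h,T^*k]_{\mathcal{H}}$; $\mathcal{L}^*(\mathcal{H})=\mathcal{L}^*(\mathcal{H},\mathcal{H})$.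 Such operators are automatically continuous module maps. A $*$-semigroup $\Gamma$ is a semigroup with an involution satisfying $(\xi\eta)^*=\eta^*\xi^*$, $(\xi^* )^*=\xi$. It acts on $X$ if $\alpha\cdot(\beta\cdot x)=(\alpha\beta)\cdot x$. A $*$-representation is a multiplicative map $\pi$ with $\pi(\xi^* )=\pi(\xi)^*$. A kernel $\mathbf{k}\colon X\times X\to\mathcal{L}^*(\mathcal{H})$ is Hermitian if $\mathbf{k}(x,y)=\mathbf{k}(y,x)^*$ for all $x,y$, and positive semidefinite if $\sum_{i,j=1}^n[\mathbf{k}(x_i,x_j)h_j,h_i]_{\mathcal{H}}\ge0$ for all $n\in\mathbb{N}$, $x_i\in X$, $h_i\in\mathcal{H}$. A Hilbert $\mathcal{A}$-module linearisation of $\mathbf{k}$ is a pair $(\mathcal{K};V)$ with $\mathcal{K}$ a Hilbert $\mathcal{A}$-module and $V\colon X\to\mathcal{L}^*(\mathcal{H},\mathcal{K})$ such that $\mathbf{k}(x,y)=V(x)^*V(y)$ for all $x,y\in X$. $\mathcal{F}(X;\mathcal{H})$ is the right $\mathcal{A}$-module of all functions $X\to\mathcal{H}$ (pointwise operations) and $\mathbf{k}_xh=\mathbf{k}(\cdot,x)h$. An $\mathcal{H}$-reproducing kernel Hilbert $\mathcal{A}$-module with (Hermitian) kernel $\mathbf{k}$ is a Hilbert $\mathcal{A}$-module $\mathcal{R}$ which is a submodule of $\mathcal{F}(X;\mathcal{H})$ (with its algebraic operations), such that $\mathbf{k}_xh\in\mathcal{R}$ for all $x\in X$, $h\in\mathcal{H}$,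 and $[f(x),h]_{\mathcal{H}}=[f,\mathbf{k}_xh]_{\mathcal{R}}$ for all $f\in\mathcal{R}$, $x\in X$, $h\in\mathcal{H}$. *)

theory Defs
  imports "HOL-Algebra.Algebraic_Closure_Type" "HOL-Library.FuncSet"
begin

section \<open>Star-semigroups and locally \<open>C\<^sup>*\<close>-algebras\<close>

class star_semigroup = semigroup_mult +
  fixes star :: "'a \<Rightarrow> 'a"
  assumes star_mult: "star (x * y) = star y * star x"
    and star_star: "star (star x) = x"

text \<open>Complex \<open>*\<close>-algebras; no unit element is required.\<close>

class complex_star_algebra = ring + star_semigroup +
  fixes scaleC :: "complex \<Rightarrow> 'a \<Rightarrow> 'a" (infixr "*\<^sub>C" 75)
  assumes scaleC_add_right: "c *\<^sub>C (x + y) = c *\<^sub>C x + c *\<^sub>C y"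
    and scaleC_add_left: "(c + d) *\<^sub>C x = c *\<^sub>C x + d *\<^sub>C x"
    and scaleC_scaleC: "c *\<^sub>C (d *\<^sub>C x) = (c * d) *\<^sub>C x"
    and scaleC_one: "1 *\<^sub>C x = x"
    and mult_scaleC_left: "(c *\<^sub>C x) * y = c *\<^sub>C (x * y)"
    and mult_scaleC_right: "x * (c *\<^sub>C y) = c *\<^sub>C (x * y)"
    and star_add: "star (x + y) = star x + star y"
    and star_scaleC: "star (c *\<^sub>C x) = cnj c *\<^sub>C star x"
begin

definition cstar_seminorm :: "('a \<Rightarrow> real) \<Rightarrow> bool" where
  "cstar_seminorm p \<longleftrightarrow>
     (\<forall>x y. p (x + y) \<le> p x + p y) \<and>
     (\<forall>c x. p (c *\<^sub>C x) = cmod c * p x) \<and>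
     (\<forall>x. p (star x * x) = (p x)\<^sup>2)"

definition nonneg :: "'a \<Rightarrow> bool" where
  "nonneg a \<longleftrightarrow> (\<exists>b. a = star b * b)"

end

text \<open>The uniformity (hence, by \<open>open_uniformity\<close>, the topology) is the one induced by
  some family \<open>P\<close> of \<open>C\<^sup>*\<close>-seminorms; completeness is expressed by filters, not sequences.\<close>

class locally_cstar_algebra = complex_star_algebra + uniform_space + t2_space +
  assumes uniformity_cstar_seminorms:
      "\<exists>P. (\<forall>p\<in>P. cstar_seminorm p) \<and>
         uniformity = (INF p\<in>P. INF e\<in>{0<..}. principal {(x, y). p (x - y) < e})"
    and complete_UNIV_uniform: "complete UNIV"

definition cont_cstar_seminorms :: "('a::locally_cstar_algebra \<Rightarrow> real) set" (\<open>S\<^sub>*\<close>) where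
  "S\<^sub>* = {p. cstar_seminorm p \<and> continuous_on UNIV p}"


section \<open>Hilbert modules\<close>

text \<open>Hilbert modules are given by an explicit carrier, since the theorem asserts the existence
  of such modules. The complex vector space structure is that of a \<open>module\<close> over the field of
  complex numbers; the ring fields \<open>mult\<close> and \<open>one\<close> inherited from \<open>ring\<close> are not used.\<close>

record ('h, 'a) hilbert_mod = "(complex, 'h) module" +
  ract :: "['h, 'a] \<Rightarrow> 'h" (infixl \<open>\<cdot>\<index>\<close> 70)
  gram :: "['h, 'h] \<Rightarrow> 'a"

definition gram_seminorm ::
    "('h, 'a::locally_cstar_algebra) hilbert_mod \<Rightarrow> ('a \<Rightarrow> real) \<Rightarrow> 'h \<Rightarrow> real" where
  "gram_seminorm H p h = sqrt (p (gram H h h))"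

definition gram_uniformity ::
    "('h, 'a::locally_cstar_algebra) hilbert_mod \<Rightarrow> ('h \<times> 'h) filter" where
  "gram_uniformity H =
     (INF p\<in>S\<^sub>*. INF e\<in>{0<..}. principal {(x, y). gram_seminorm H p (x \<ominus>\<^bsub>H\<^esub> y) < e})"

definition gram_complete :: "('h, 'a::locally_cstar_algebra) hilbert_mod \<Rightarrow> bool" where
  "gram_complete H \<longleftrightarrow>
     (\<forall>F \<le> principal (carrier H). F \<noteq> bot \<longrightarrow> F \<times>\<^sub>F F \<le> gram_uniformity H \<longrightarrow>
        (\<exists>x\<in>carrier H. \<forall>p\<in>S\<^sub>*. ((\<lambda>y. gram_seminorm H p (y \<ominus>\<^bsub>H\<^esub> x)) \<longlongrightarrow> 0) F))"

locale hilbert_module = Module.module "ring_of_type_algebra :: complex ring" H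
  for H :: "('h, 'a::locally_cstar_algebra) hilbert_mod" (structure) +
  assumes ract_closed: "x \<in> carrier H \<Longrightarrow> x \<cdot> a \<in> carrier H"
    and ract_add_left: "\<lbrakk>x \<in> carrier H; y \<in> carrier H\<rbrakk> \<Longrightarrow> (x \<oplus> y) \<cdot> a = x \<cdot> a \<oplus> y \<cdot> a"
    and ract_add_right: "x \<in> carrier H \<Longrightarrow> x \<cdot> (a + b) = x \<cdot> a \<oplus> x \<cdot> b"
    and ract_mult: "x \<in> carrier H \<Longrightarrow> x \<cdot> (a * b) = (x \<cdot> a) \<cdot> b"
    and ract_smult_left: "x \<in> carrier H \<Longrightarrow> (c \<odot>\<^bsub>H\<^esub> x) \<cdot> a = c \<odot>\<^bsub>H\<^esub> (x \<cdot> a)"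
    and ract_smult_right: "x \<in> carrier H \<Longrightarrow> x \<cdot> (c *\<^sub>C a) = c \<odot>\<^bsub>H\<^esub> (x \<cdot> a)"
    and gram_star: "\<lbrakk>x \<in> carrier H; y \<in> carrier H\<rbrakk> \<Longrightarrow> gram H x y = star (gram H y x)"
    and gram_nonneg: "x \<in> carrier H \<Longrightarrow> nonneg (gram H x x)"
    and gram_eq_zero_iff: "x \<in> carrier H \<Longrightarrow> gram H x x = 0 \<longleftrightarrow> x = \<zero>"
    and gram_add_right: "\<lbrakk>x \<in> carrier H; y \<in> carrier H; z \<in> carrier H\<rbrakk> \<Longrightarrow>
           gram H x (y \<oplus> z) = gram H x y + gram H x z"
    and gram_smult_right: "\<lbrakk>x \<in> carrier H; y \<in> carrier H\<rbrakk> \<Longrightarrow>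
           gram H x (c \<odot>\<^bsub>H\<^esub> y) = c *\<^sub>C gram H x y"
    and gram_ract_right: "\<lbrakk>x \<in> carrier H; y \<in> carrier H; z \<in> carrier H\<rbrakk> \<Longrightarrow>
           gram H x (y \<cdot> a \<oplus> z \<cdot> b) = gram H x y * a + gram H x z * b"
    and complete: "gram_complete H"


section \<open>Adjointable operators\<close>

text \<open>Operators are extensional functions on the carrier, so that equality of operators is
  equality in HOL, and composition is \<open>compose\<close>.\<close>

definition linear_ops ::
    "('h, 'a) hilbert_mod \<Rightarrow> ('k, 'a) hilbert_mod \<Rightarrow> ('h \<Rightarrow> 'k) set" where
  "linear_ops H K = {T \<in> carrier H \<rightarrow>\<^sub>E carrier K.
     (\<forall>x\<in>carrier H. \<forall>y\<in>carrier H. T (x \<oplus>\<^bsub>H\<^esub> y) = T x \<oplus>\<^bsub>K\<^esub> T y) \<and>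
     (\<forall>c. \<forall>x\<in>carrier H. T (c \<odot>\<^bsub>H\<^esub> x) = c \<odot>\<^bsub>K\<^esub> T x)}"

definition is_adjoint ::
    "('h, 'a) hilbert_mod \<Rightarrow> ('k, 'a) hilbert_mod \<Rightarrow> ('h \<Rightarrow> 'k) \<Rightarrow> ('k \<Rightarrow> 'h) \<Rightarrow> bool" where
  "is_adjoint H K T S \<longleftrightarrow> S \<in> linear_ops K H \<and>
     (\<forall>h\<in>carrier H. \<forall>k\<in>carrier K. gram K (T h) k = gram H h (S k))"

definition adjointable_ops ::
    "('h, 'a) hilbert_mod \<Rightarrow> ('k, 'a) hilbert_mod \<Rightarrow> ('h \<Rightarrow> 'k) set" (\<open>\<L>\<^sub>*\<close>) where
  "\<L>\<^sub>* H K = {T \<in> linear_ops H K. \<exists>S. is_adjoint H K T S}"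

definition adjoint ::
    "('h, 'a) hilbert_mod \<Rightarrow> ('k, 'a) hilbert_mod \<Rightarrow> ('h \<Rightarrow> 'k) \<Rightarrow> ('k \<Rightarrow> 'h)" where
  "adjoint H K T = (THE S. is_adjoint H K T S)"

definition semigroup_action :: "('g::star_semigroup \<Rightarrow> 'x \<Rightarrow> 'x) \<Rightarrow> bool" where
  "semigroup_action act \<longleftrightarrow> (\<forall>\<alpha> \<beta> x. act \<alpha> (act \<beta> x) = act (\<alpha> * \<beta>) x)"

definition star_representation ::
    "('k, 'a) hilbert_mod \<Rightarrow> ('g::star_semigroup \<Rightarrow> 'k \<Rightarrow> 'k) \<Rightarrow> bool" where
  "star_representation K \<pi> \<longleftrightarrow>
     (\<forall>\<xi>. \<pi> \<xi> \<in> \<L>\<^sub>* K K) \<and>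
     (\<forall>\<xi> \<eta>. \<pi> (\<xi> * \<eta>) = compose (carrier K) (\<pi> \<xi>) (\<pi> \<eta>)) \<and>
     (\<forall>\<xi>. \<pi> (star \<xi>) = adjoint K K (\<pi> \<xi>))"


section \<open>Kernels\<close>

definition adjointable_kernel ::
    "('h, 'a) hilbert_mod \<Rightarrow> ('x \<Rightarrow> 'x \<Rightarrow> 'h \<Rightarrow> 'h) \<Rightarrow> bool" where
  "adjointable_kernel H k \<longleftrightarrow> (\<forall>x y. k x y \<in> \<L>\<^sub>* H H)"

definition hermitian_kernel ::
    "('h, 'a) hilbert_mod \<Rightarrow> ('x \<Rightarrow> 'x \<Rightarrow> 'h \<Rightarrow> 'h) \<Rightarrow> bool" where
  "hermitian_kernel H k \<longleftrightarrow> (\<forall>x y. k x y = adjoint H H (k y x))"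

definition psd_kernel ::
    "('h, 'a::complex_star_algebra) hilbert_mod \<Rightarrow> ('x \<Rightarrow> 'x \<Rightarrow> 'h \<Rightarrow> 'h) \<Rightarrow> bool" where
  "psd_kernel H k \<longleftrightarrow> (\<forall>(n::nat) x h. (\<forall>i\<in>{1..n}. h i \<in> carrier H) \<longrightarrow>
     nonneg (\<Sum>i=1..n. \<Sum>j=1..n. gram H (k (x i) (x j) (h j)) (h i)))"

definition invariant_kernel ::
    "('g::star_semigroup \<Rightarrow> 'x \<Rightarrow> 'x) \<Rightarrow> ('x \<Rightarrow> 'x \<Rightarrow> 'h \<Rightarrow> 'h) \<Rightarrow> bool" where
  "invariant_kernel act k \<longleftrightarrow> (\<forall>x y \<xi>. k y (act \<xi> x) = k (act (star \<xi>) y) x)"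

definition bounded_translations ::
    "('g \<Rightarrow> 'x \<Rightarrow> 'x) \<Rightarrow> ('h, 'a::locally_cstar_algebra) hilbert_mod \<Rightarrow>
     ('x \<Rightarrow> 'x \<Rightarrow> 'h \<Rightarrow> 'h) \<Rightarrow> bool" where
  "bounded_translations act H k \<longleftrightarrow>
     (\<forall>\<xi>. \<forall>p\<in>S\<^sub>*. \<exists>q\<in>S\<^sub>*. \<exists>c\<ge>0. \<forall>(n::nat) h x. (\<forall>i\<in>{1..n}. h i \<in> carrier H) \<longrightarrow>
        p (\<Sum>i=1..n. \<Sum>j=1..n. gram H (k (act \<xi> (x i)) (act \<xi> (x j)) (h j)) (h i))
        \<le> c * q (\<Sum>i=1..n. \<Sum>j=1..n. gram H (k (x i) (x j) (h j)) (h i)))"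

definition linearisation ::
    "('h, 'a::locally_cstar_algebra) hilbert_mod \<Rightarrow> ('x \<Rightarrow> 'x \<Rightarrow> 'h \<Rightarrow> 'h) \<Rightarrow>
     ('k, 'a) hilbert_mod \<Rightarrow> ('x \<Rightarrow> 'h \<Rightarrow> 'k) \<Rightarrow> bool" where
  "linearisation H k K V \<longleftrightarrow> hilbert_module K \<and> (\<forall>x. V x \<in> \<L>\<^sub>* H K) \<and>
     (\<forall>x y. k x y = compose (carrier H) (adjoint H K (V x)) (V y))"

text \<open>HOL cannot quantify existentially over the type \<open>'k\<close> carrying \<open>K\<close>. Existence of an
  invariant linearisation is therefore to be asserted on the concrete type \<open>'x \<Rightarrow> 'h\<close>, and to be
  assumed for an arbitrary type \<open>'k\<close>.\<close>

definition invariant_linearisation ::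
    "('g::star_semigroup \<Rightarrow> 'x \<Rightarrow> 'x) \<Rightarrow> ('h, 'a::locally_cstar_algebra) hilbert_mod \<Rightarrow>
     ('x \<Rightarrow> 'x \<Rightarrow> 'h \<Rightarrow> 'h) \<Rightarrow>
     ('k, 'a) hilbert_mod \<Rightarrow> ('g \<Rightarrow> 'k \<Rightarrow> 'k) \<Rightarrow> ('x \<Rightarrow> 'h \<Rightarrow> 'k) \<Rightarrow> bool" where
  "invariant_linearisation act H k K \<pi> V \<longleftrightarrow>
     linearisation H k K V \<and> star_representation K \<pi> \<and>
     (\<forall>\<xi> x. V (act \<xi> x) = compose (carrier H) (\<pi> \<xi>) (V x))"

text \<open>\<open>R\<close> is a submodule of the module of all functions into \<open>H\<close> with pointwise operations;
  the zero element and additive inverses are then automatically the pointwise ones.\<close>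

definition function_submodule ::
    "('h, 'a) hilbert_mod \<Rightarrow> ('x \<Rightarrow> 'h, 'a) hilbert_mod \<Rightarrow> bool" where
  "function_submodule H R \<longleftrightarrow>
     carrier R \<subseteq> {f. \<forall>x. f x \<in> carrier H} \<and>
     (\<forall>f\<in>carrier R. \<forall>g\<in>carrier R. f \<oplus>\<^bsub>R\<^esub> g = (\<lambda>x. f x \<oplus>\<^bsub>H\<^esub> g x)) \<and>
     (\<forall>c. \<forall>f\<in>carrier R. c \<odot>\<^bsub>R\<^esub> f = (\<lambda>x. c \<odot>\<^bsub>H\<^esub> f x)) \<and>
     (\<forall>f\<in>carrier R. \<forall>a. f \<cdot>\<^bsub>R\<^esub> a = (\<lambda>x. f x \<cdot>\<^bsub>H\<^esub> a))"

definition kernel_section ::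
    "('x \<Rightarrow> 'x \<Rightarrow> 'h \<Rightarrow> 'h) \<Rightarrow> 'x \<Rightarrow> 'h \<Rightarrow> ('x \<Rightarrow> 'h)" where
  "kernel_section k x h = (\<lambda>y. k y x h)"

definition reproducing_kernel_module ::
    "('h, 'a::locally_cstar_algebra) hilbert_mod \<Rightarrow> ('x \<Rightarrow> 'x \<Rightarrow> 'h \<Rightarrow> 'h) \<Rightarrow>
     ('x \<Rightarrow> 'h, 'a) hilbert_mod \<Rightarrow> bool" where
  "reproducing_kernel_module H k R \<longleftrightarrow>
     hermitian_kernel H k \<and> hilbert_module R \<and> function_submodule H R \<and>
     (\<forall>x. \<forall>h\<in>carrier H. kernel_section k x h \<in> carrier R) \<and>
     (\<forall>f\<in>carrier R. \<forall>x. \<forall>h\<in>carrier H.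
        gram H (f x) h = gram R f (kernel_section k x h))"

end

theory Submission
  imports Defs
begin

text \<open>
  The three assertions are linked in a cycle: an invariant positive semidefinite kernel with
  bounded translations has a reproducing kernel module on which the semigroup acts, such a module is
  an invariant linearisation, and a kernel with an invariant linearisation has these properties.

  From a linearisation, with \<open>u = \<Sum> V(x\<^sub>j) h\<^sub>j\<close>, the double sums of the kernel are the
  gramians \<open>[u, u]\<close>, and the double sums of the translated kernel are \<open>[\<pi>(\<xi>) u, \<pi>(\<xi>) u]\<close>. So
  positivity and invariance are immediate, and the bound on translations says that the adjointable
  operator \<open>\<pi>(\<xi>)\<close> is bounded with respect to each continuous \<open>C\<^sup>*\<close>-seminorm
  (\<open>adjointable_bounded\<close>).

  For the construction of the reproducing kernel module, the finite sums of kernel sections carry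
  a positive gramian, and they have to be completed inside the space of all functions. A function
  is admitted if, for each seminorm, finite sums of sections come arbitrarily close to it, where
  the distance is measured by pairing with finite sums of sections. No abstract completion is
  needed, since evaluation at a point is bounded: \<open>k(x, x)\<close> is adjointable, hence bounded.
  The representation is \<open>\<rho>(\<xi>) f = f \<circ> \<xi>\<^sup>*\<close>; the bound on translations is what makes it
  preserve the space of admitted functions.

  Behind this are facts about a locally \<open>C\<^sup>*\<close>-algebra in which positive means of the form
  \<open>b\<^sup>* b\<close>, a \<open>C\<^sup>*\<close>-seminorm is not assumed to be submultiplicative, and a unit need not exist.
  \<^item> A \<open>C\<^sup>*\<close>-seminorm is submultiplicative (\<open>submultiplicative\<close>), because a self-adjoint element
    of seminorm less than one is the real part of an approximate unitary.
  \<^item> Positivity of \<open>a\<close> is equivalent to the inequalities \<open>p (t z - a z) \<le> t p z\<close> with \<open>t \<ge> p a\<close>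
    (\<open>nonneg_iff_spectrally_nonneg\<close>). These are stable under sums and limits, and they make an
    iteration for the square root converge. Two consequences carry the rest: seminorms are monotone
    on the positive cone (\<open>nonneg_mono\<close>), which gives the Cauchy-Schwarz inequality
    in Hilbert modules, and the cone is closed (\<open>nonneg_limit\<close>), which gives positivity of
    the gramian on the completion.
  \<^item> The element \<open>b\<^sup>2 (1 + b\<^sup>2)\<^sup>-\<^sup>1\<close> exists for self-adjoint \<open>b\<close> (\<open>bounded_transform\<close>). With it a
    vector can be replaced by one that is bounded in all seminorms at once and still close to it in
    one of them (\<open>truncation\<close>), and this is what a gliding hump argument for the boundedness of
    adjointable operators needs: completeness refers to all seminorms simultaneously.
\<close>

section \<open>Complex scalars and commutants\<close>

abbreviation scaleR_C :: "real \<Rightarrow> 'a::complex_star_algebra \<Rightarrow> 'a" (infixr "*\<^sub>r" 75)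
  where "r *\<^sub>r x \<equiv> complex_of_real r *\<^sub>C x"

abbreviation self_adjoint :: "'a::star_semigroup \<Rightarrow> bool"
  where "self_adjoint x \<equiv> star x = x"

interpretation scaleC_module: vector_space "scaleC :: complex \<Rightarrow> 'a::complex_star_algebra \<Rightarrow> 'a"
  by unfold_locales (simp_all add: scaleC_add_right scaleC_add_left scaleC_scaleC scaleC_one)

lemma star_zero [simp]: "star (0::'a::complex_star_algebra) = 0"
  using star_add[of "0::'a" 0] by simp

lemma star_minus: "star (- x) = - star (x::'a::complex_star_algebra)"
  using star_add[of x "- x"] by (simp add: add_eq_0_iff)

lemma star_diff: "star (x - y) = star x - star (y::'a::complex_star_algebra)"
  using star_add[of x "- y"] by (simp add: star_minus)

lemmas scaleC_simps = scaleC_add_right scaleC_scaleC scaleC_module.scale_right_diff_distrib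
  scaleC_module.scale_minus_right scaleC_module.scale_minus_left mult_scaleC_left mult_scaleC_right

lemmas star_simps = star_add star_diff star_minus star_scaleC star_mult star_star

text \<open>The simplifier does not combine multiples of the same element by itself. Used from left to
  right these equations merge scalars, read from right to left the last two unfold a factor two.\<close>

lemma scaleC_collect:
  fixes x y :: "'a::complex_star_algebra"
  shows "a *\<^sub>C x + b *\<^sub>C x = (a + b) *\<^sub>C x" "a *\<^sub>C x + (b *\<^sub>C x + y) = (a + b) *\<^sub>C x + y"
    "a *\<^sub>C x - b *\<^sub>C x = (a - b) *\<^sub>C x"
    "x + b *\<^sub>C x = (1 + b) *\<^sub>C x" "x + (b *\<^sub>C x + y) = (1 + b) *\<^sub>C x + y"
    "a *\<^sub>C x + x = (a + 1) *\<^sub>C x"  "a *\<^sub>C x + (x + y) = (a + 1) *\<^sub>C x + y"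
    "x + x = 2 *\<^sub>C x" "x + (x + y) = 2 *\<^sub>C x + y"
  using scaleC_add_left[of 1 1 x]
  by (simp_all add: scaleC_add_left scaleC_one add.assoc scaleC_module.scale_left_diff_distrib)

text \<open>The replacement for a spectral radius formula: an estimate with a bad constant for all powers of
  exponent \<open>2 ^ n\<close> implies the estimate with constant one. Squares of self-adjoint elements
  are compatible with a \<open>C\<^sup>*\<close>-seminorm, so only such exponents occur.\<close>

lemma le_of_powers_le:
  fixes a b C :: real
  assumes "0 \<le> b" and le: "\<And>n. a ^ (2 ^ n) \<le> C * b ^ (2 ^ n)"
  shows "a \<le> b"
proof (rule ccontr)
  assume "\<not> a \<le> b"
  then have ab: "b < a" by simp
  show False
  proof (cases "b = 0")
    case True
    with ab le[of 0] show False by simp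
  next
    case False
    with \<open>0 \<le> b\<close> have "0 < b" by simp
    with ab have r: "1 < a / b" by simp
    obtain n where n: "C < (a / b) ^ n" using real_arch_pow[OF r] by blast
    have "(a / b) ^ n \<le> (a / b) ^ (2 ^ n)"
      by (rule power_increasing) (use r in \<open>simp_all add: less_imp_le\<close>)
    also have "\<dots> \<le> C"
      using le[of n] \<open>0 < b\<close> by (simp add: power_divide divide_le_eq)
    finally show False using n by simp
  qed
qed

primrec iter_sq :: "'a::times \<Rightarrow> nat \<Rightarrow> 'a" where
  "iter_sq h 0 = h"
| "iter_sq h (Suc n) = iter_sq h n * iter_sq h n"

lemma self_adjoint_iter_sq: "self_adjoint h \<Longrightarrow> self_adjoint (iter_sq h n)"
  for h :: "'a::star_semigroup"
  by (induction n) (simp_all add: star_mult)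

lemma iter_sq_Suc_left: "iter_sq h (Suc n) = iter_sq (h * h) n"
  by (induction n) simp_all

lemma iter_sq_commutes: "h * k = k * h \<Longrightarrow> iter_sq h n * k = k * iter_sq h n"
  for h :: "'a::semigroup_mult"
proof (induction n)
  case (Suc n)
  then show ?case by simp (metis mult.assoc)
qed simp

lemma iter_sq_mult:
  fixes h k :: "'a::semigroup_mult"
  assumes "h * k = k * h"
  shows "iter_sq (h * k) n = iter_sq h n * iter_sq k n"
proof (induction n)
  case (Suc n)
  have "iter_sq h n * iter_sq k n = iter_sq k n * iter_sq h n"
    by (metis assms iter_sq_commutes)
  with Suc show ?case by simp (metis mult.assoc)
qed simp

text \<open>Constructions from \<open>a\<close>, such as square roots, have to commute with everything that commutes
  with \<open>a\<close>. This set, in contrast to the polynomials in \<open>a\<close>, is closed under limits; its elements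
  are required to be self-adjoint, and they commute with each other.\<close>

definition bicommutant :: "'a::star_semigroup \<Rightarrow> 'a set" where
  "bicommutant a = {z. self_adjoint z \<and> (\<forall>w. w * a = a * w \<longrightarrow> w * z = z * w)}"

lemma bicommutant_self: "self_adjoint a \<Longrightarrow> a \<in> bicommutant a"
  by (simp add: bicommutant_def)

lemma bicommutant_self_adjoint: "z \<in> bicommutant a \<Longrightarrow> self_adjoint z"
  by (simp add: bicommutant_def)

lemma bicommutant_commutes: "z \<in> bicommutant a \<Longrightarrow> w * a = a * w \<Longrightarrow> w * z = z * w"
  by (simp add: bicommutant_def)

lemma bicommutant_commute:
  assumes "y \<in> bicommutant a" "z \<in> bicommutant a"
  shows "y * z = z * y"
proof -
  have "y * a = a * y" using assms(1) by (auto simp: bicommutant_def)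
  with assms(2) show ?thesis by (simp add: bicommutant_def)
qed

lemma bicommutant_zero: "0 \<in> bicommutant (a::'a::complex_star_algebra)"
  by (simp add: bicommutant_def)

lemma bicommutant_add:
  "y \<in> bicommutant a \<Longrightarrow> z \<in> bicommutant a \<Longrightarrow> y + z \<in> bicommutant (a::'a::complex_star_algebra)"
  by (auto simp: bicommutant_def star_add algebra_simps)

lemma bicommutant_diff:
  "y \<in> bicommutant a \<Longrightarrow> z \<in> bicommutant a \<Longrightarrow> y - z \<in> bicommutant (a::'a::complex_star_algebra)"
  by (auto simp: bicommutant_def star_diff algebra_simps)

lemma bicommutant_minus:
  "y \<in> bicommutant a \<Longrightarrow> - y \<in> bicommutant (a::'a::complex_star_algebra)"
  by (auto simp: bicommutant_def star_minus)

lemma bicommutant_scale: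
  "y \<in> bicommutant a \<Longrightarrow> r *\<^sub>r y \<in> bicommutant (a::'a::complex_star_algebra)"
  by (auto simp: bicommutant_def star_scaleC mult_scaleC_left mult_scaleC_right)

lemma bicommutant_mult:
  assumes "y \<in> bicommutant a" "z \<in> bicommutant a"
  shows "y * z \<in> bicommutant a"
proof -
  have "star (y * z) = y * z"
    by (simp only: star_mult assms[THEN bicommutant_self_adjoint] bicommutant_commute[OF assms])
  moreover have "w * (y * z) = y * z * w" if "w * a = a * w" for w
  proof -
    have "w * (y * z) = y * (w * z)"
      using bicommutant_commutes[OF assms(1) that] by (simp only: flip: mult.assoc)
    then show ?thesis using bicommutant_commutes[OF assms(2) that] by (simp only: mult.assoc)
  qed
  ultimately show ?thesis by (simp add: bicommutant_def)
qed

lemma bicommutant_trans: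
  assumes "c \<in> bicommutant a" "d \<in> bicommutant c" shows "d \<in> bicommutant a"
  using assms by (auto simp: bicommutant_def)

section \<open>\<open>C\<^sup>*\<close>-seminorms are submultiplicative\<close>

locale cstar_seminormed =
  fixes p :: "'a::complex_star_algebra \<Rightarrow> real"
  assumes cstar_seminorm: "cstar_seminorm p"
begin

lemma triangle: "p (x + y) \<le> p x + p y"
  and scale: "p (c *\<^sub>C x) = cmod c * p x"
  and cstar: "p (star x * x) = (p x)\<^sup>2"
  using cstar_seminorm unfolding cstar_seminorm_def by auto

lemma scale_real: "p (r *\<^sub>r x) = \<bar>r\<bar> * p x"
  by (simp add: scale)

lemma zero [simp]: "p 0 = 0"
  using scale[of 0 0] by simp

lemma minus [simp]: "p (- x) = p x"
  using scale[of "-1" x] by (simp add: scaleC_one)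

lemma nonneg [simp]: "0 \<le> p x"
proof -
  have "p 0 \<le> p x + p (- x)" using triangle[of x "- x"] by simp
  then show ?thesis by simp
qed

lemma triangle_diff: "p (x - y) \<le> p x + p y"
  using triangle[of x "- y"] by simp

lemma diff_commute: "p (x - y) = p (y - x)"
  using minus[of "x - y"] by simp

lemma triangle_minus: "p x \<le> p (x - y) + p y"
  using triangle[of "x - y" y] by simp

lemma self_adjoint_square: "self_adjoint x \<Longrightarrow> p (x * x) = (p x)\<^sup>2"
  using cstar[of x] by simp

lemma self_adjoint_iter_sq_power: "self_adjoint x \<Longrightarrow> p (iter_sq x n) = p x ^ (2 ^ n)"
  by (induction n)
     (simp_all add: self_adjoint_square self_adjoint_iter_sq power2_eq_square power_mult_distrib
        flip: power_mult power_add mult_2)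

lemma polarization:
  "4 *\<^sub>C (star y * x) =
     star (x + y) * (x + y) + \<i> *\<^sub>C (star (x + \<i> *\<^sub>C y) * (x + \<i> *\<^sub>C y))
     - star (x - y) * (x - y) - \<i> *\<^sub>C (star (x - \<i> *\<^sub>C y) * (x - \<i> *\<^sub>C y))"
  for x y :: 'a
proof -
  have 4: "4 *\<^sub>C z = z + z + z + z" for z :: 'a
    using scaleC_add_left[of 2 2 z] scaleC_collect(8)[of z] by (simp add: add.assoc)
  show ?thesis unfolding 4
    by (simp add: star_simps scaleC_simps algebra_simps)
qed

text \<open>Polarisation bounds \<open>p (y\<^sup>* x)\<close> by \<open>(p x + p y)\<^sup>2\<close>; replacing \<open>x, y\<close> by \<open>t x, y / t\<close>, which
  does not change \<open>y\<^sup>* x\<close>, and optimising over \<open>t\<close> turns the sum into a product.\<close>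

lemma weak_mult_bound: "p (star y * x) \<le> 4 * p x * p y"
proof -
  have le: "p (star y * x) \<le> (p x + p y)\<^sup>2" for x y
  proof -
    have b: "p (star w * w) \<le> (p x + p y)\<^sup>2"
      if "w \<in> {x + y, x - y, x + \<i> *\<^sub>C y, x - \<i> *\<^sub>C y}" for w
    proof -
      have "p w \<le> p x + p y"
        using that triangle[of x y] triangle_diff[of x y] triangle[of x "\<i> *\<^sub>C y"]
          triangle_diff[of x "\<i> *\<^sub>C y"] by (auto simp: scale)
      then show ?thesis unfolding cstar by (simp add: power_mono)
    qed
    have "4 * p (star y * x) = p (4 *\<^sub>C (star y * x))" by (simp add: scale)
    also have "\<dots> \<le> p (star (x + y) * (x + y)) + p (star (x + \<i> *\<^sub>C y) * (x + \<i> *\<^sub>C y))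
        + p (star (x - y) * (x - y)) + p (star (x - \<i> *\<^sub>C y) * (x - \<i> *\<^sub>C y))"
      unfolding polarization
      by (intro order_trans[OF triangle_diff] order_trans[OF triangle] add_mono)
         (simp_all add: scale)
    also have "\<dots> \<le> 4 * (p x + p y)\<^sup>2"
      using b[of "x + y"] b[of "x - y"] b[of "x + \<i> *\<^sub>C y"] b[of "x - \<i> *\<^sub>C y"] by simp
    finally show ?thesis by simp
  qed
  have "p (star y * x) \<le> 4 * (p x + e) * (p y + e)" if "0 < e" for e
  proof -
    have px: "0 < p x + e" and py: "0 < p y + e" using that nonneg[of x] nonneg[of y] by linarith+
    \<comment> \<open>The value that balances the two summands; \<open>e\<close> keeps it away from zero and infinity.\<close>
    define t where "t = sqrt ((p y + e) / (p x + e))"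
    have t: "0 < t" unfolding t_def using px py by simp
    have t2: "t\<^sup>2 = (p y + e) / (p x + e)" unfolding t_def using px py by simp
    have "star ((1/t) *\<^sub>r y) * (t *\<^sub>r x) = star y * x"
      using t by (simp add: star_simps scaleC_simps scaleC_one)
    then have "p (star y * x) \<le> (t * p x + (1/t) * p y)\<^sup>2"
      using le[of "(1/t) *\<^sub>r y" "t *\<^sub>r x"] t by (simp only: scale_real) simp
    also have "\<dots> \<le> (t * (p x + e) + (1/t) * (p y + e))\<^sup>2"
      using t that by (intro power_mono add_mono mult_left_mono) auto
    also have "\<dots> = t\<^sup>2 * (p x + e)\<^sup>2 + 2 * (p x + e) * (p y + e) + (p y + e)\<^sup>2 / t\<^sup>2"
      using t by (simp add: power2_eq_square field_simps)
    also have "\<dots> = 4 * (p x + e) * (p y + e)"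
      unfolding t2 using px py by (simp add: power2_eq_square) (simp add: algebra_simps)
    finally show ?thesis .
  qed
  then have "eventually (\<lambda>e. p (star y * x) \<le> 4 * (p x + e) * (p y + e)) (at_right 0)"
    by (simp add: eventually_at_right_less eventually_mono[OF eventually_at_right_less])
  moreover have "((\<lambda>e. 4 * (p x + e) * (p y + e)) \<longlongrightarrow> 4 * (p x + 0) * (p y + 0)) (at_right 0)"
    by (intro tendsto_intros)
  ultimately have "p (star y * x) \<le> 4 * (p x + 0) * (p y + 0)"
    by (intro tendsto_lowerbound[where F = "at_right (0::real)"]) simp_all
  then show ?thesis by simp
qed

text \<open>The product of commuting self-adjoint elements is self-adjoint, so the constant four is
  absorbed by passing to powers.\<close>

lemma commuting_mult_bound:
  assumes "self_adjoint h" "self_adjoint k" "h * k = k * h"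
  shows "p (h * k) \<le> p h * p k"
proof (rule le_of_powers_le)
  fix n
  have "self_adjoint (h * k)" using assms by (simp add: star_mult)
  then have "p (h * k) ^ 2 ^ n = p (iter_sq (h * k) n)"
    by (simp add: self_adjoint_iter_sq_power)
  also have "iter_sq (h * k) n = star (iter_sq h n) * iter_sq k n"
    by (simp only: iter_sq_mult[OF assms(3)] self_adjoint_iter_sq[OF assms(1)])
  also have "p \<dots> \<le> 4 * p (iter_sq k n) * p (iter_sq h n)" by (rule weak_mult_bound)
  also have "\<dots> = 4 * (p h * p k) ^ 2 ^ n"
    using assms by (simp add: self_adjoint_iter_sq_power power_mult_distrib)
  finally show "p (h * k) ^ 2 ^ n \<le> 4 * (p h * p k) ^ 2 ^ n" .
qed simp

end

text \<open>With \<open>k = z z\<^sup>*\<close> this is the inner part \<open>m\<close> of the iterated squares \<open>z\<^sup>* m z\<close> of \<open>z\<^sup>* h z\<close>, since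
  \<open>(z\<^sup>* m z)\<^sup>2 = z\<^sup>* (m k m) z\<close>. The two outer factors stay the same, so the growth of the squares
  is governed by products of the self-adjoint elements \<open>h\<close> and \<open>k\<close>.\<close>

primrec sandwich :: "'a::semigroup_mult \<Rightarrow> 'a \<Rightarrow> nat \<Rightarrow> 'a" where
  "sandwich h k 0 = h"
| "sandwich h k (Suc n) = sandwich h k n * k * sandwich h k n"

lemma self_adjoint_sandwich:
  "self_adjoint h \<Longrightarrow> self_adjoint k \<Longrightarrow> self_adjoint (sandwich h k n)"
  for h :: "'a::star_semigroup"
  by (induction n) (simp_all add: star_mult mult.assoc)

lemma iter_sq_sandwich: "iter_sq (star z * h * z) n = star z * sandwich h (z * star z) n * z"
  for h :: "'a::star_semigroup"
  by (induction n) (simp_all add: mult.assoc)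

context cstar_seminormed
begin

text \<open>The powers of \<open>x x\<^sup>*\<close> are powers of \<open>x\<^sup>* x\<close> between \<open>x\<close> and \<open>x\<^sup>*\<close>, so the two elements have the
  same growth, and hence the same seminorm.\<close>

lemma star_le: "p (star x) \<le> p x"
proof -
  define k where "k = star x * x"
  have sk: "self_adjoint k" by (simp add: k_def star_simps)
  have comm: "sandwich k k n * k = k * sandwich k k n" for n
    by (induction n) (simp_all, metis mult.assoc)
  have m: "p (sandwich k k n) * p k \<le> p k ^ 2 ^ (Suc n)" for n
  proof (induction n)
    case 0 then show ?case by (simp add: power2_eq_square)
  next
    case (Suc n)
    have "sandwich k k (Suc n) = sandwich k k n * k * sandwich k k n" by simp
    have s: "self_adjoint (sandwich k k n)" by (rule self_adjoint_sandwich[OF sk sk])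
    have e: "sandwich k k (Suc n) = sandwich k k n * (sandwich k k n * k)"
      by (simp only: sandwich.simps mult.assoc comm[symmetric])
    have "p (sandwich k k (Suc n)) \<le> p (sandwich k k n) * p (sandwich k k n * k)"
      unfolding e
    proof (rule commuting_mult_bound[OF s])
      show "star (sandwich k k n * k) = sandwich k k n * k" by (simp add: star_mult s sk comm)
      show "sandwich k k n * (sandwich k k n * k) = sandwich k k n * k * sandwich k k n"
        by (simp only: mult.assoc comm[symmetric])
    qed
    also have "\<dots> \<le> p (sandwich k k n) * (p (sandwich k k n) * p k)"
      by (intro mult_left_mono commuting_mult_bound) (simp_all add: s sk comm)
    finally have "p (sandwich k k (Suc n)) * p k \<le> (p (sandwich k k n) * (p (sandwich k k n) * p k)) * p k"
      by (rule mult_right_mono) simp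
    also have "\<dots> = (p (sandwich k k n) * p k)\<^sup>2" by (simp add: power2_eq_square)
    also have "\<dots> \<le> (p k ^ 2 ^ (Suc n))\<^sup>2" by (rule power_mono[OF Suc]) simp
    also have "\<dots> = p k ^ 2 ^ (Suc (Suc n))" by (metis power_Suc2 power_mult)
    finally show ?case .
  qed
  have h: "p (x * star x) = (p (star x))\<^sup>2" using cstar[of "star x"] by (simp add: star_star)
  have bound: "p (x * star x) ^ 2 ^ Suc n * p k \<le> 16 * (p (star x))\<^sup>2 * p k ^ 2 ^ Suc n" for n
  proof -
    have "self_adjoint (x * star x)" by (simp add: star_simps)
    then have "p (x * star x) ^ 2 ^ Suc n = p (iter_sq (x * star x) (Suc n))"
      by (simp only: self_adjoint_iter_sq_power)
    also have "iter_sq (x * star x) (Suc n) = iter_sq (x * star x * (x * star x)) n"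
      by (rule iter_sq_Suc_left)
    also have "x * star x * (x * star x) = star (star x) * k * star x"
      by (simp add: k_def star_star mult.assoc)
    also have "iter_sq \<dots> n = star (star x) * (sandwich k k n * star x)"
      by (simp only: iter_sq_sandwich) (simp add: k_def star_star mult.assoc)
    also have "p \<dots> \<le> 4 * p (sandwich k k n * star x) * p (star x)"
      by (rule weak_mult_bound)
    also have "\<dots> \<le> 4 * (4 * p (star x) * p (sandwich k k n)) * p (star x)"
      using weak_mult_bound[of "sandwich k k n" "star x"] self_adjoint_sandwich[OF sk sk, of n]
      by (intro mult_right_mono mult_left_mono) simp_all
    finally have "p (x * star x) ^ 2 ^ Suc n * p k \<le> 16 * (p (star x))\<^sup>2 * (p (sandwich k k n) * p k)"
      by (rule mult_right_mono[THEN order_trans]) (simp_all add: power2_eq_square)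
    also have "\<dots> \<le> 16 * (p (star x))\<^sup>2 * p k ^ 2 ^ Suc n"
      by (rule mult_left_mono[OF m]) simp
    finally show ?thesis .
  qed
  have "p (x * star x) \<le> p k"
  proof (cases "p k = 0")
    case True
    have "(p (x * star x))\<^sup>2 = p (x * star x * (x * star x))"
      by (rule self_adjoint_square[symmetric]) (simp add: star_simps)
    also have "x * star x * (x * star x) = star (star x) * (k * star x)"
      by (simp add: k_def star_star mult.assoc)
    also have "p \<dots> \<le> 4 * p (k * star x) * p (star x)" by (rule weak_mult_bound)
    also have "p (k * star x) = 0"
      using weak_mult_bound[of k "star x"] nonneg[of "k * star x"] by (simp add: sk True)
    finally show ?thesis by simp
  next
    case False
    then have "0 < p k" using nonneg[of k] by linarith
    have "(p (x * star x))\<^sup>2 \<le> (p k)\<^sup>2"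
    proof (rule le_of_powers_le)
      fix n
      show "((p (x * star x))\<^sup>2) ^ 2 ^ n \<le> 16 * (p (star x))\<^sup>2 / p k * ((p k)\<^sup>2) ^ 2 ^ n"
        using bound[of n] \<open>0 < p k\<close>
        by (simp add: pos_le_divide_eq flip: power_mult)
    qed simp
    then show ?thesis by (rule power2_le_imp_le) simp
  qed
  then have "(p (star x))\<^sup>2 \<le> (p x)\<^sup>2" using h cstar[of x] by (simp add: k_def)
  then show ?thesis by (rule power2_le_imp_le) simp
qed

lemma seminorm_star [simp]: "p (star x) = p x"
proof (rule antisym)
  show "p x \<le> p (star x)" using star_le[of "star x"] by (simp only: star_star)
qed (rule star_le)

lemma weak_mult_bound': "p (x * y) \<le> 4 * p y * p x"
  using weak_mult_bound[of "star x" y] by (simp only: star_star seminorm_star)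

end

lemma le_of_le_add_mult:
  fixes a b c :: real
  assumes "0 \<le> c" "\<And>e. 0 < e \<Longrightarrow> a \<le> b + c * e"
  shows "a \<le> b"
proof (rule field_le_epsilon)
  fix e :: real assume "0 < e"
  then have "a \<le> b + c * (e / (c + 1))" using assms(1) by (intro assms(2)) simp
  also have "c * (e / (c + 1)) \<le> e" using \<open>0 < e\<close> assms(1) by (simp add: field_simps)
  finally show "a \<le> b + e" by simp
qed

text \<open>The fixed point is \<open>1 - sqrt (1 - x)\<close>. Starting from zero, no unit is needed.\<close>

primrec sqrt_iter :: "'a::complex_star_algebra \<Rightarrow> nat \<Rightarrow> 'a" where
  "sqrt_iter x 0 = 0"
| "sqrt_iter x (Suc n) = (1/2) *\<^sub>r (x + sqrt_iter x n * sqrt_iter x n)"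

context cstar_seminormed
begin

text \<open>If \<open>c\<^sup>2 + (v + f)\<^sup>2\<close> is nearly the scalar \<open>t\<close>, then \<open>(c + \<i> (v + f)) / sqrt t\<close> is nearly
  unitary, and both its real and its imaginary part are nearly contractions. All elements act on a
  fixed \<open>z\<close>, because the scalar \<open>v\<close> is only available as a multiplier; the defect is \<open>E\<close>.\<close>

lemma dilation:
  assumes c: "self_adjoint c" and f: "self_adjoint f" and cf: "c * f = f * c"
    and eq: "c * (c * z) + (v * v) *\<^sub>r z + (2 * v) *\<^sub>r (f * z) + f * (f * z) = t *\<^sub>r z + E"
    and E: "p E \<le> K * p z" and t: "0 \<le> t"
  shows "(p (c * z))\<^sup>2 \<le> (t + 4 * K) * (p z)\<^sup>2"
    and "(p (v *\<^sub>r z + f * z))\<^sup>2 \<le> (t + 4 * K) * (p z)\<^sup>2"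
proof -
  define w where "w = v *\<^sub>r z + f * z"
  have cf': "c * (f * u) = f * (c * u)" for u using cf by (simp flip: mult.assoc)
  have star_c: "star (c * u) = star u * c" and star_f: "star (f * u) = star u * f" for u
    by (simp_all add: star_mult c f)
  have cw: "star (c * z) * w = star w * (c * z)"
    unfolding w_def by (simp add: star_simps c f scaleC_simps algebra_simps cf')
  have ww: "star w * w = star z * ((v * v) *\<^sub>r z + (2 * v) *\<^sub>r (f * z) + f * (f * z))"
    unfolding w_def
    by (simp add: star_simps c f scaleC_simps algebra_simps scaleC_collect(1,2))
  have cc: "star (c * z) * (c * z) = star z * (c * (c * z))"
    by (simp add: star_c mult.assoc)
  have bound: "(p m)\<^sup>2 \<le> (t + 4 * K) * (p z)\<^sup>2" if "m = c * z + \<i> *\<^sub>C w \<or> m = c * z - \<i> *\<^sub>C w" for m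
  proof -
    have "star m * m = star (c * z) * (c * z) + star w * w"
      using that
    proof
      assume m: "m = c * z + \<i> *\<^sub>C w"
      show ?thesis unfolding m
        using cw by (simp add: star_add star_scaleC scaleC_simps algebra_simps)
    next
      assume m: "m = c * z - \<i> *\<^sub>C w"
      show ?thesis unfolding m
        using cw by (simp add: star_diff star_scaleC scaleC_simps algebra_simps)
    qed
    also have "\<dots> = star z * (t *\<^sub>r z + E)"
      unfolding ww cc by (simp only: eq[symmetric] distrib_left add.assoc)
    also have "\<dots> = t *\<^sub>r (star z * z) + star z * E"
      by (simp add: scaleC_simps distrib_left)
    finally have "(p m)\<^sup>2 = p (t *\<^sub>r (star z * z) + star z * E)" by (metis cstar)
    also have "\<dots> \<le> t * (p z)\<^sup>2 + 4 * p E * p z"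
      using t by (intro order_trans[OF triangle] add_mono weak_mult_bound) (simp_all add: scale cstar)
    also have "\<dots> \<le> t * (p z)\<^sup>2 + 4 * (K * p z) * p z"
      using E by (intro add_left_mono mult_right_mono mult_left_mono) simp_all
    finally show ?thesis by (simp add: power2_eq_square algebra_simps)
  qed
  define B where "B = sqrt ((t + 4 * K) * (p z)\<^sup>2)"
  have m: "p (c * z + \<i> *\<^sub>C w) \<le> B" "p (c * z - \<i> *\<^sub>C w) \<le> B"
    unfolding B_def by (rule real_le_rsqrt, rule bound, simp)+
  have "0 \<le> (t + 4 * K) * (p z)\<^sup>2" using bound[OF disjI1[OF refl]] zero_le_power2 order_trans by blast
  then have B: "0 \<le> B" "B\<^sup>2 = (t + 4 * K) * (p z)\<^sup>2" unfolding B_def by simp_all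
  have "2 * p (c * z) = p (2 *\<^sub>C (c * z))" by (simp add: scale)
  also have "2 *\<^sub>C (c * z) = (c * z + \<i> *\<^sub>C w) + (c * z - \<i> *\<^sub>C w)"
    by (simp flip: scaleC_collect(8))
  also have "p \<dots> \<le> B + B" by (rule order_trans[OF triangle add_mono[OF m]])
  finally have "p (c * z) \<le> B" by simp
  then show "(p (c * z))\<^sup>2 \<le> (t + 4 * K) * (p z)\<^sup>2"
    using power_mono[of "p (c * z)" B 2] B by simp
  have "2 * p w = p ((2 * \<i>) *\<^sub>C w)" by (simp add: scale norm_mult)
  also have "(2 * \<i>) *\<^sub>C w = (c * z + \<i> *\<^sub>C w) - (c * z - \<i> *\<^sub>C w)"
    unfolding mult_2 scaleC_add_left by simp
  also have "p \<dots> \<le> B + B" by (rule order_trans[OF triangle_diff add_mono[OF m]])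
  finally have "p w \<le> B" by simp
  then show "(p (v *\<^sub>r z + f * z))\<^sup>2 \<le> (t + 4 * K) * (p z)\<^sup>2"
    using power_mono[of "p w" B 2] B by (simp add: w_def)
qed

lemma sqrt_iter_bicommutant: "self_adjoint x \<Longrightarrow> sqrt_iter x n \<in> bicommutant x"
proof (induction n)
  case (Suc n)
  then show ?case
    unfolding sqrt_iter.simps by (intro bicommutant_scale bicommutant_add bicommutant_mult bicommutant_self)
qed (simp add: bicommutant_zero)

text \<open>Within the bicommutant the seminorm is already submultiplicative, so the differences of
  consecutive iterates decay geometrically. The defect of \<open>(1 - y)\<^sup>2 = 1 - x\<close> at the
  \<open>n\<close>-th iterate is twice such a difference.\<close>

lemma approx_sqrt_one_minus:
  assumes x: "self_adjoint x" "p x < 1" and e: "0 < e"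
  shows "\<exists>y\<in>bicommutant x. p (y + y - (x + y * y)) \<le> e"
proof -
  let ?y = "sqrt_iter x"
  define r where "r = p x"
  have r: "0 \<le> r" "r < 1" using x by (simp_all add: r_def)
  note y = sqrt_iter_bicommutant[OF x(1)]
  note sa = y[THEN bicommutant_self_adjoint]
  have y_le: "p (?y n) \<le> r" for n
  proof (induction n)
    case (Suc n)
    have "p (?y (Suc n)) \<le> (1/2) * (r + r * r)"
    proof -
      have "p (x + ?y n * ?y n) \<le> r + r * r"
        using Suc r
        by (intro order_trans[OF triangle] add_mono)
           (simp_all add: r_def self_adjoint_square[OF sa] power2_eq_square mult_mono)
      then show ?thesis by (simp add: scale)
    qed
    also have "\<dots> \<le> r" using r mult_left_le[of r r] by simp
    finally show ?case .
  qed (use r in simp)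
  have step: "p (?y (Suc n) - ?y n) \<le> r ^ n" for n
  proof (induction n)
    case 0
    show ?case using y_le[of 1] r by simp
  next
    case (Suc n)
    have "?y (Suc n) * ?y n = ?y n * ?y (Suc n)" by (rule bicommutant_commute[OF y y])
    then have "?y (Suc (Suc n)) - ?y (Suc n) = (1/2) *\<^sub>r ((?y (Suc n) + ?y n) * (?y (Suc n) - ?y n))"
      unfolding sqrt_iter.simps(2)[of x "Suc n"]
      by (subst (3) sqrt_iter.simps(2)) (simp only: flip: scaleC_module.scale_right_diff_distrib, simp add: algebra_simps)
    then have "p (?y (Suc (Suc n)) - ?y (Suc n)) = (1/2) * p ((?y (Suc n) + ?y n) * (?y (Suc n) - ?y n))"
      by (simp only: scale_real, simp?)
    also have "p ((?y (Suc n) + ?y n) * (?y (Suc n) - ?y n)) \<le> p (?y (Suc n) + ?y n) * p (?y (Suc n) - ?y n)"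
      by (rule commuting_mult_bound)
         (intro bicommutant_self_adjoint[of _ x] bicommutant_commute[of _ x] bicommutant_add bicommutant_diff y)+
    also have "\<dots> \<le> (r + r) * r ^ n"
      using Suc r by (intro mult_mono order_trans[OF triangle] add_mono y_le) simp_all
    finally show ?case by simp
  qed
  obtain n where n: "r ^ n < e / 2"
    using real_arch_pow_inv[of "e / 2" r] e r by auto
  have "?y n + ?y n - (x + ?y n * ?y n) = 2 *\<^sub>r (?y n - ?y (Suc n))"
    by (simp add: scaleC_simps scaleC_one algebra_simps scaleC_collect(8))
  then have "p (?y n + ?y n - (x + ?y n * ?y n)) = 2 * p (?y (Suc n) - ?y n)"
    by (simp only: scale_real diff_commute, simp?)
  also have "\<dots> \<le> e" using step[of n] n by simp
  finally show ?thesis using y by blast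
qed

text \<open>The dilation of \<open>h\<close> by \<open>1 - y\<close>, the approximate square root of \<open>1 - h\<^sup>2\<close>: the first claim
  comes from the real part, the second from applying the imaginary part twice.\<close>

lemma self_adjoint_contraction:
  assumes h: "self_adjoint h" "p h < 1"
  shows "p (h * z) \<le> p z" "p (z - h * (h * z)) \<le> p z"
proof -
  have hh: "self_adjoint (h * h)" "p (h * h) < 1"
    using h abs_square_less_1[of "p h"] by (simp_all add: star_mult self_adjoint_square)
  have approx: "(p (h * z))\<^sup>2 \<le> (1 + 16 * e) * (p z)\<^sup>2"
      "p (z - h * (h * z)) \<le> (1 + 20 * e) * p z" if e: "0 < e" for e z
  proof -
    obtain y where y: "y \<in> bicommutant (h * h)" and ye: "p (y + y - (h * h + y * y)) \<le> e"
      using approx_sqrt_one_minus[OF hh e] by blast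
    have sy: "self_adjoint y" using y by (rule bicommutant_self_adjoint)
    have hy: "h * y = y * h" using y by (rule bicommutant_commutes) (simp add: mult.assoc)
    define E where "E z = - ((y + y - (h * h + y * y)) * z)" for z
    have E: "p (E z) \<le> (4 * e) * p z" for z
    proof -
      have "p (E z) \<le> 4 * p z * p (y + y - (h * h + y * y))"
        unfolding E_def minus by (rule weak_mult_bound')
      also have "\<dots> \<le> 4 * p z * e" using ye by (intro mult_left_mono) simp_all
      finally show ?thesis by (simp add: mult_ac)
    qed
    have eq: "h * (h * z) + (1 * 1) *\<^sub>r z + (2 * 1) *\<^sub>r (- y * z) + - y * (- y * z) = 1 *\<^sub>r z + E z" for z
      unfolding E_def by (simp add: scaleC_one algebra_simps scaleC_module.scale_minus_right flip: scaleC_collect(8))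
    have "- y * h = h * - y" "self_adjoint (- y)" using hy sy by (simp_all add: star_minus)
    note D = dilation[OF h(1) this(2) this(1)[symmetric] eq E]
    show "(p (h * z))\<^sup>2 \<le> (1 + 16 * e) * (p z)\<^sup>2" using D(1) by simp
    have V: "(p (z - y * z))\<^sup>2 \<le> (1 + 16 * e) * (p z)\<^sup>2" for z using D(2)[of z] by (simp add: scaleC_one)
    have "(p (z - y * z - y * (z - y * z)))\<^sup>2 \<le> (1 + 16 * e) * (p (z - y * z))\<^sup>2" by (rule V)
    also have "\<dots> \<le> (1 + 16 * e) * ((1 + 16 * e) * (p z)\<^sup>2)"
      using e by (intro mult_left_mono V) simp
    also have "\<dots> = ((1 + 16 * e) * p z)\<^sup>2" by (simp add: power2_eq_square)
    finally have "p (z - y * z - y * (z - y * z)) \<le> (1 + 16 * e) * p z"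
      by (rule power2_le_imp_le) (use e in simp)
    moreover have "z - h * (h * z) = (z - y * z - y * (z - y * z)) - E z"
      unfolding E_def by (simp add: algebra_simps)
    ultimately show "p (z - h * (h * z)) \<le> (1 + 20 * e) * p z"
      using triangle_diff[of "z - y * z - y * (z - y * z)" "E z"] E[of z] by (simp add: algebra_simps)
  qed
  have "(p (h * z))\<^sup>2 \<le> (p z)\<^sup>2"
    by (rule le_of_le_add_mult[where c = "16 * (p z)\<^sup>2"]) (use approx(1) in \<open>simp_all add: algebra_simps\<close>)
  then show "p (h * z) \<le> p z" by (rule power2_le_imp_le) simp
  show "p (z - h * (h * z)) \<le> p z"
    by (rule le_of_le_add_mult[where c = "20 * p z"]) (use approx(2) in \<open>simp_all add: algebra_simps\<close>)
qed

lemma self_adjoint_mult_bound: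
  assumes h: "self_adjoint h"
  shows "p (h * z) \<le> p h * p z"
proof (rule le_of_le_add_mult[where c = "p z"])
  fix e :: real assume e: "0 < e"
  let ?t = "p h + e"
  have t: "0 < ?t" using e nonneg[of h] by linarith
  have "p (((1 / ?t) *\<^sub>r h) * z) \<le> p z"
  proof (rule self_adjoint_contraction(1))
    show "self_adjoint ((1 / ?t) *\<^sub>r h)" by (simp add: star_scaleC h)
    show "p ((1 / ?t) *\<^sub>r h) < 1" unfolding scale_real using t e by simp
  qed
  then have "(1 / ?t) * p (h * z) \<le> p z"
    using t by (simp only: mult_scaleC_left scale_real) simp
  then show "p (h * z) \<le> p h * p z + p z * e" using t by (simp add: field_simps)
qed simp

lemma square_contraction:
  assumes h: "self_adjoint h" and t: "(p h)\<^sup>2 \<le> t"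
  shows "p (t *\<^sub>r z - h * (h * z)) \<le> t * p z"
proof (rule le_of_le_add_mult[where c = "2 * p z"])
  fix e :: real assume e: "0 < e"
  define s where "s = sqrt (t + e)"
  have te: "0 < t + e" using t e zero_le_power2[of "p h"] by linarith
  have s: "0 < s" "s * s = t + e" unfolding s_def using te by simp_all
  have "p h < s" unfolding s_def using t e by (intro real_less_rsqrt) simp
  then have ph: "p ((1 / s) *\<^sub>r h) < 1" using s by (simp only: scale_real) simp
  have "p (z - ((1 / s) *\<^sub>r h) * (((1 / s) *\<^sub>r h) * z)) \<le> p z"
    by (rule self_adjoint_contraction(2)[OF _ ph]) (simp add: star_scaleC h)
  then have "s * s * p (z - ((1 / s) *\<^sub>r h) * (((1 / s) *\<^sub>r h) * z)) \<le> s * s * p z"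
    using te s by (intro mult_left_mono) simp_all
  then have "p ((s * s) *\<^sub>r (z - ((1 / s) *\<^sub>r h) * (((1 / s) *\<^sub>r h) * z))) \<le> (t + e) * p z"
    using s te by (simp only: scale_real, simp?)
  also have "(s * s) *\<^sub>r (z - ((1 / s) *\<^sub>r h) * (((1 / s) *\<^sub>r h) * z)) = (t + e) *\<^sub>r z - h * (h * z)"
    using s by (simp add: scaleC_simps scaleC_one flip: s(2))
  finally have "p ((t + e) *\<^sub>r z - h * (h * z)) \<le> (t + e) * p z" .
  moreover have "t *\<^sub>r z - h * (h * z) = ((t + e) *\<^sub>r z - h * (h * z)) - e *\<^sub>r z"
    by (simp add: scaleC_add_left)
  ultimately show "p (t *\<^sub>r z - h * (h * z)) \<le> t * p z + 2 * p z * e"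
    using triangle_diff[of "(t + e) *\<^sub>r z - h * (h * z)" "e *\<^sub>r z"] e
    by (simp add: scale algebra_simps)
qed simp

text \<open>The powers of \<open>y\<^sup>* h y\<close> with \<open>h = x\<^sup>* x\<close> contain only products of the self-adjoint elements
  \<open>h\<close> and \<open>y y\<^sup>*\<close>, for which the estimate is known.\<close>

theorem submultiplicative: "p (x * y) \<le> p x * p y"
proof -
  define h k where "h = star x * x" and "k = y * star y"
  have sa: "self_adjoint h" "self_adjoint k" by (simp_all add: h_def k_def star_simps)
  have pk: "p k = (p y)\<^sup>2" using cstar[of "star y"] by (simp add: k_def star_star)
  have S: "p (sandwich h k n) * p k \<le> (p h * p k) ^ 2 ^ n" for n
  proof (induction n)
    case (Suc n)
    have s: "self_adjoint (sandwich h k n)" by (rule self_adjoint_sandwich[OF sa])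
    have "p (sandwich h k (Suc n)) \<le> p (sandwich h k n) * (p k * p (sandwich h k n))"
      by (simp add: mult.assoc)
         (rule order_trans[OF self_adjoint_mult_bound[OF s] mult_left_mono[OF self_adjoint_mult_bound[OF sa(2)]]], simp)
    then have "p (sandwich h k (Suc n)) * p k \<le> (p (sandwich h k n) * (p k * p (sandwich h k n))) * p k"
      by (rule mult_right_mono) simp
    also have "\<dots> = (p (sandwich h k n) * p k)\<^sup>2" by (simp add: power2_eq_square)
    also have "\<dots> \<le> ((p h * p k) ^ 2 ^ n)\<^sup>2" by (rule power_mono[OF Suc]) simp
    also have "\<dots> = (p h * p k) ^ 2 ^ Suc n" by (metis power_Suc2 power_mult)
    finally show ?case .
  qed simp
  have "p (star y * h * y) \<le> p h * p k"
  proof (rule le_of_powers_le)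
    fix n
    have "self_adjoint (star y * h * y)" by (simp add: star_simps sa mult.assoc)
    then have "p (star y * h * y) ^ 2 ^ n = p (iter_sq (star y * h * y) n)"
      by (simp only: self_adjoint_iter_sq_power)
    also have "iter_sq (star y * h * y) n = star y * (sandwich h k n * y)"
      unfolding iter_sq_sandwich by (simp only: k_def mult.assoc)
    also have "p \<dots> \<le> 4 * p (sandwich h k n * y) * p y" by (rule weak_mult_bound)
    also have "\<dots> \<le> 4 * (p (sandwich h k n) * p y) * p y"
      by (intro mult_right_mono mult_left_mono self_adjoint_mult_bound self_adjoint_sandwich sa) simp_all
    also have "\<dots> = 4 * (p (sandwich h k n) * p k)" by (simp add: pk power2_eq_square)
    also have "\<dots> \<le> 4 * (p h * p k) ^ 2 ^ n" using S by simp
    finally show "p (star y * h * y) ^ 2 ^ n \<le> 4 * (p h * p k) ^ 2 ^ n" .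
  qed simp
  moreover have "star y * h * y = star (x * y) * (x * y)" by (simp add: h_def star_mult mult.assoc)
  ultimately have "(p (x * y))\<^sup>2 \<le> (p x * p y)\<^sup>2"
    by (simp add: cstar pk h_def power_mult_distrib)
  then show ?thesis by (rule power2_le_imp_le) simp
qed

end

section \<open>Square roots of contractive multipliers\<close>

text \<open>The same iteration for \<open>1 - sqrt (1 - (\<xi> + x))\<close>, where the multiplier \<open>\<xi> + x\<close> has a scalar part:
  the iterate is \<open>scalar_iter + element_iter\<close>. For \<open>\<xi> = 1\<close> and \<open>x = 0\<close> it runs at the boundary of
  the domain of convergence, and its increments, which tend to zero slowly, dominate those of any
  contractive multiplier.\<close>

primrec scalar_iter :: "real \<Rightarrow> nat \<Rightarrow> real" where
  "scalar_iter \<xi> 0 = 0"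
| "scalar_iter \<xi> (Suc n) = (1/2) * (\<xi> + scalar_iter \<xi> n * scalar_iter \<xi> n)"

primrec element_iter :: "real \<Rightarrow> 'a::complex_star_algebra \<Rightarrow> nat \<Rightarrow> 'a" where
  "element_iter \<xi> x 0 = 0"
| "element_iter \<xi> x (Suc n) = (1/2) *\<^sub>r (x + (2 * scalar_iter \<xi> n) *\<^sub>r element_iter \<xi> x n
     + element_iter \<xi> x n * element_iter \<xi> x n)"

text \<open>Left multiplication by \<open>r + a\<close>, which is an element of the unitisation but not of the algebra.\<close>

definition unital_mult :: "real \<Rightarrow> 'a \<Rightarrow> 'a \<Rightarrow> 'a::complex_star_algebra" where
  "unital_mult r a z = r *\<^sub>r z + a * z"

lemma unital_mult_add: "unital_mult (r + s) (a + b) z = unital_mult r a z + unital_mult s b z"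
  by (simp add: unital_mult_def scaleC_add_left algebra_simps)

lemma unital_mult_diff: "unital_mult (r - s) (a - b) z = unital_mult r a z - unital_mult s b z"
  by (simp add: unital_mult_def scaleC_module.scale_left_diff_distrib algebra_simps)

lemma unital_mult_diff_right: "unital_mult r a (y - z) = unital_mult r a y - unital_mult r a z"
  by (simp add: unital_mult_def scaleC_module.scale_right_diff_distrib algebra_simps)

lemma unital_mult_scale: "unital_mult (t * r) (t *\<^sub>r a) z = t *\<^sub>r unital_mult r a z"
  by (simp add: unital_mult_def scaleC_simps)

lemma unital_mult_mult:
  "unital_mult r a (unital_mult s b z) = unital_mult (r * s) (r *\<^sub>r b + s *\<^sub>r a + a * b) z"
  by (simp add: unital_mult_def scaleC_simps algebra_simps)

lemma unital_mult_commute: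
  "a * b = b * a \<Longrightarrow> unital_mult r a (unital_mult s b z) = unital_mult s b (unital_mult r a z)"
  by (simp add: unital_mult_mult algebra_simps)

lemma unital_mult_iter_Suc:
  "unital_mult (scalar_iter \<xi> (Suc n)) (element_iter \<xi> x (Suc n)) z =
    (1/2) *\<^sub>r (unital_mult \<xi> x z + unital_mult (scalar_iter \<xi> n) (element_iter \<xi> x n)
      (unital_mult (scalar_iter \<xi> n) (element_iter \<xi> x n) z))"
  unfolding unital_mult_mult scalar_iter.simps element_iter.simps unital_mult_scale
    unital_mult_add[symmetric]
  by (rule arg_cong[where f = "\<lambda>a. (1/2) *\<^sub>r unital_mult _ a z"])
     (simp add: algebra_simps flip: scaleC_add_left)

lemma element_iter_bicommutant: "self_adjoint x \<Longrightarrow> element_iter \<xi> x n \<in> bicommutant x"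
proof (induction n)
  case (Suc n)
  then show ?case
    unfolding element_iter.simps
    by (intro bicommutant_scale bicommutant_add bicommutant_mult bicommutant_self)
qed (simp add: bicommutant_zero)

lemma scalar_iter_one_bounds: "0 \<le> scalar_iter 1 n \<and> scalar_iter 1 n \<le> 1"
proof (induction n)
  case (Suc n)
  then show ?case using mult_le_one[of "scalar_iter 1 n" "scalar_iter 1 n"] by auto
qed simp

lemma scalar_iter_step:
  "scalar_iter \<xi> (Suc (Suc n)) - scalar_iter \<xi> (Suc n) =
    (1/2) * ((scalar_iter \<xi> (Suc n) + scalar_iter \<xi> n) * (scalar_iter \<xi> (Suc n) - scalar_iter \<xi> n))"
  unfolding scalar_iter.simps(2)[of \<xi> "Suc n"]
  by (subst (3) scalar_iter.simps(2)) (simp add: algebra_simps)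

lemma scalar_iter_one_gap: "2 * (scalar_iter 1 (Suc n) - scalar_iter 1 n) = (1 - scalar_iter 1 n)\<^sup>2"
  by (simp add: power2_eq_square algebra_simps)

declare scalar_iter.simps(2) [simp del] element_iter.simps(2) [simp del]

lemma scalar_iter_one_increasing: "scalar_iter 1 n \<le> scalar_iter 1 (Suc n)"
proof -
  have "0 \<le> 2 * (scalar_iter 1 (Suc n) - scalar_iter 1 n)"
    unfolding scalar_iter_one_gap by simp
  then show ?thesis by simp
qed

lemma scalar_iter_one_converges:
  assumes "0 < e"
  shows "\<exists>n. scalar_iter 1 (Suc n) - scalar_iter 1 n \<le> e"
proof (rule ccontr)
  assume "\<nexists>n. scalar_iter 1 (Suc n) - scalar_iter 1 n \<le> e"
  then have step: "e < scalar_iter 1 (Suc n) - scalar_iter 1 n" for n by (simp add: not_le)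
  have "real n * e \<le> scalar_iter 1 n" for n
  proof (induction n)
    case (Suc n)
    then show ?case using step[of n] by (simp add: algebra_simps)
  qed simp
  moreover obtain n where "1 < real n * e" using ex_less_of_nat_mult[OF assms] by blast
  ultimately show False using scalar_iter_one_bounds[of n] by (meson not_le order_trans)
qed

context cstar_seminormed
begin

lemma unital_iter_bound:
  assumes contr: "\<And>z. p (unital_mult \<xi> x z) \<le> p z"
  shows "p (unital_mult (scalar_iter \<xi> n) (element_iter \<xi> x n) z) \<le> scalar_iter 1 n * p z"
proof (induction n arbitrary: z)
  case 0
  show ?case by (simp add: unital_mult_def)
next
  case (Suc n)
  let ?Y = "unital_mult (scalar_iter \<xi> n) (element_iter \<xi> x n)"
  have "p (?Y (?Y z)) \<le> scalar_iter 1 n * (scalar_iter 1 n * p z)"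
    by (rule order_trans[OF Suc mult_left_mono[OF Suc]]) (use scalar_iter_one_bounds in blast)
  then have "p (unital_mult \<xi> x z + ?Y (?Y z)) \<le> p z + scalar_iter 1 n * (scalar_iter 1 n * p z)"
    by (rule order_trans[OF triangle add_mono[OF contr]])
  then show ?case unfolding unital_mult_iter_Suc scale_real by (simp add: scalar_iter.simps algebra_simps)
qed

text \<open>Increments factor as \<open>(Y' + Y) (Y' - Y) / 2\<close>, so they are bounded by the increments of the
  scalar iteration, which satisfy the same recursion with equality.\<close>

lemma unital_iter_step_bound:
  assumes x: "self_adjoint x" and contr: "\<And>z. p (unital_mult \<xi> x z) \<le> p z"
  shows "p (unital_mult (scalar_iter \<xi> (Suc n)) (element_iter \<xi> x (Suc n)) z
            - unital_mult (scalar_iter \<xi> n) (element_iter \<xi> x n) z)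
          \<le> (scalar_iter 1 (Suc n) - scalar_iter 1 n) * p z"
proof (induction n arbitrary: z)
  case 0
  show ?case using contr[of z] unfolding unital_mult_iter_Suc scale_real
    by (simp add: unital_mult_def scale scalar_iter.simps)
next
  case (Suc n)
  define Y where "Y n = unital_mult (scalar_iter \<xi> n) (element_iter \<xi> x n)" for n
  have comm: "Y (Suc n) (Y n z) = Y n (Y (Suc n) z)" for z
    unfolding Y_def
    by (rule unital_mult_commute bicommutant_commute element_iter_bicommutant x)+
  have Y_Suc: "Y (Suc n) z = (1/2) *\<^sub>r (unital_mult \<xi> x z + Y n (Y n z))" for n
    unfolding Y_def by (rule unital_mult_iter_Suc)
  have "Y (Suc (Suc n)) z - Y (Suc n) z
      = (1/2) *\<^sub>r (Y (Suc n) (Y (Suc n) z) - Y n (Y n z))"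
    unfolding Y_Suc[of "Suc n"] Y_Suc[of n, THEN arg_cong[where f = "\<lambda>u. w - u" for w]]
      scaleC_module.scale_right_diff_distrib[symmetric] by simp
  also have "Y (Suc n) (Y (Suc n) z) - Y n (Y n z)
      = Y (Suc n) (Y (Suc n) z - Y n z) + Y n (Y (Suc n) z - Y n z)"
    using comm[of z] unfolding Y_def unital_mult_diff_right by simp
  finally have "p (Y (Suc (Suc n)) z - Y (Suc n) z)
      = (1/2) * p (Y (Suc n) (Y (Suc n) z - Y n z) + Y n (Y (Suc n) z - Y n z))"
    by (simp only: scale_real, simp?)
  also have "p (Y (Suc n) (Y (Suc n) z - Y n z) + Y n (Y (Suc n) z - Y n z))
      \<le> (scalar_iter 1 (Suc n) + scalar_iter 1 n) * p (Y (Suc n) z - Y n z)"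
    unfolding Y_def distrib_right
    by (rule order_trans[OF triangle add_mono[OF unital_iter_bound unital_iter_bound]]) (rule contr)+
  also have "\<dots> \<le> (scalar_iter 1 (Suc n) + scalar_iter 1 n) *
      ((scalar_iter 1 (Suc n) - scalar_iter 1 n) * p z)"
    unfolding Y_def
    by (rule mult_left_mono[OF Suc]) (use scalar_iter_one_bounds[of n] scalar_iter_one_bounds[of "Suc n"] in linarith)
  finally show ?case unfolding Y_def scalar_iter_step by (simp)
qed

text \<open>An approximate square root \<open>v + f\<close> of the multiplier \<open>1 - (\<xi> + x)\<close>.\<close>

lemma unital_sqrt:
  assumes x: "self_adjoint x" and contr: "\<And>z. p (unital_mult \<xi> x z) \<le> p z" and e: "0 < e"
  shows "\<exists>v. \<exists>f\<in>bicommutant x. \<forall>z.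
    p (unital_mult v f (unital_mult v f z) - unital_mult (1 - \<xi>) (- x) z) \<le> e * p z"
proof -
  obtain n where n: "scalar_iter 1 (Suc n) - scalar_iter 1 n \<le> e / 2"
    using scalar_iter_one_converges[of "e / 2"] e by auto
  define Y where "Y n = unital_mult (scalar_iter \<xi> n) (element_iter \<xi> x n)" for n
  have V: "unital_mult (1 - scalar_iter \<xi> n) (- element_iter \<xi> x n) z = z - Y n z" for z
    by (simp add: Y_def unital_mult_def scaleC_module.scale_left_diff_distrib scaleC_one)
  have X: "unital_mult (1 - \<xi>) (- x) z = z - unital_mult \<xi> x z" for z
    by (simp add: unital_mult_def scaleC_module.scale_left_diff_distrib scaleC_one)
  have "p (z - Y n z - Y n (z - Y n z) - (z - unital_mult \<xi> x z)) \<le> e * p z" for z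
  proof -
    have "2 *\<^sub>r Y (Suc n) z = unital_mult \<xi> x z + Y n (Y n z)"
      unfolding Y_def unital_mult_iter_Suc by (simp add: scaleC_simps scaleC_one)
    then have "z - Y n z - Y n (z - Y n z) - (z - unital_mult \<xi> x z) = 2 *\<^sub>r (Y (Suc n) z - Y n z)"
      unfolding scaleC_module.scale_right_diff_distrib
      by (simp add: Y_def unital_mult_diff_right algebra_simps flip: scaleC_collect(8))
    then have "p (z - Y n z - Y n (z - Y n z) - (z - unital_mult \<xi> x z)) = 2 * p (Y (Suc n) z - Y n z)"
      by (simp only: scale_real, simp?)
    also have "\<dots> \<le> 2 * (e / 2 * p z)"
      unfolding Y_def
      by (intro mult_left_mono order_trans[OF unital_iter_step_bound[OF x contr] mult_right_mono[OF n]]) simp_all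
    finally show ?thesis by simp
  qed
  then show ?thesis
    unfolding V[symmetric] X[symmetric]
    using bicommutant_minus[OF element_iter_bicommutant[OF x]] by blast
qed

lemma self_adjoint_bound:
  assumes "self_adjoint a" "\<And>z. p (a * z) \<le> C * p z" "0 \<le> C"
  shows "p a \<le> C"
proof (cases "p a = 0")
  case False
  have "p a * p a \<le> C * p a"
    using assms(2)[of a] self_adjoint_square[OF assms(1)] by (simp add: power2_eq_square)
  then show ?thesis using False nonneg[of a] by (simp add: mult_le_cancel_right)
qed (use assms in simp)

text \<open>For \<open>\<xi> = 1\<close> and \<open>x = - d\<close> the scalar part of the approximate root of \<open>d\<close> is \<open>1 - \<alpha>\<close>, which
  tends to zero; dropping it leaves an element \<open>f\<close> of the algebra. The second property of \<open>f\<close>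
  allows the construction to be repeated with \<open>f\<close> in place of \<open>d\<close>.\<close>

lemma sqrt_of_contraction:
  assumes d: "self_adjoint d" and contr: "\<And>z. p (z - d * z) \<le> p z" and e: "0 < e"
  shows "\<exists>f\<in>bicommutant d. p (f * f - d) \<le> e \<and> (\<forall>z. p (z - f * z) \<le> p z)"
proof -
  \<comment> \<open>Both the increment and \<open>1 - \<alpha>\<close>, whose square is twice the increment, are to be at most \<open>e'\<close>.\<close>
  define e' where "e' = min 1 (e / 8)"
  have e': "0 < e'" "e' \<le> 1" "8 * e' \<le> e" using e by (auto simp: e'_def)
  obtain n where n: "scalar_iter 1 (Suc n) - scalar_iter 1 n \<le> e'\<^sup>2 / 2"
    using scalar_iter_one_converges[of "e'\<^sup>2 / 2"] e' by auto
  let ?\<alpha> = "scalar_iter 1 n" and ?\<alpha>' = "scalar_iter 1 (Suc n)"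
  let ?y = "element_iter 1 (- d) n" and ?y' = "element_iter 1 (- d) (Suc n)"
  have md: "self_adjoint (- d)" using d by (simp add: star_minus)
  have contr': "p (unital_mult 1 (- d) z) \<le> p z" for z
    using contr[of z] by (simp add: unital_mult_def scaleC_one)
  have bd: "w \<in> bicommutant d" if "w \<in> bicommutant (- d)" for w
    using that by (auto simp: bicommutant_def)
  note y = element_iter_bicommutant[OF md, of 1, THEN bd]
  have \<alpha>: "0 \<le> ?\<alpha>" "?\<alpha> \<le> 1" "1 - ?\<alpha> \<le> e'" "?\<alpha>' - ?\<alpha> \<le> e' / 2" "?\<alpha> \<le> ?\<alpha>'"
  proof -
    have "(1 - ?\<alpha>)\<^sup>2 \<le> e'\<^sup>2" unfolding scalar_iter_one_gap[symmetric] using n by simp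
    then show "1 - ?\<alpha> \<le> e'" by (rule power2_le_imp_le) (use e' in simp)
    show "?\<alpha>' - ?\<alpha> \<le> e' / 2"
      using n mult_left_le[of e' e'] e' unfolding power2_eq_square by linarith
  qed (use scalar_iter_one_bounds[of n] scalar_iter_one_increasing[of n] in auto)
  have Y: "p (?\<alpha> *\<^sub>r z + ?y * z) \<le> ?\<alpha> * p z" for z
    using unital_iter_bound[OF contr', of n z] by (simp add: unital_mult_def)
  have D: "p ((?\<alpha>' - ?\<alpha>) *\<^sub>r z + (?y' - ?y) * z) \<le> (?\<alpha>' - ?\<alpha>) * p z" for z
    using unital_iter_step_bound[OF md contr', of n z]
    unfolding unital_mult_diff[symmetric] by (simp only: unital_mult_def)
  have py: "p ?y \<le> 2"
  proof (rule self_adjoint_bound[OF y[THEN bicommutant_self_adjoint]])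
    show "p (?y * z) \<le> 2 * p z" for z
      using triangle_diff[of "?\<alpha> *\<^sub>r z + ?y * z" "?\<alpha> *\<^sub>r z"] Y[of z] \<alpha> mult_right_mono[OF \<alpha>(2), of "p z"]
      by (simp add: scale)
  qed simp
  have pd: "p (?y' - ?y) \<le> e'"
  proof (rule self_adjoint_bound)
    show "self_adjoint (?y' - ?y)" by (rule bicommutant_self_adjoint[OF bicommutant_diff[OF y y]])
    have "p ((?y' - ?y) * z) \<le> (?\<alpha>' - ?\<alpha>) * p z + (?\<alpha>' - ?\<alpha>) * p z" for z
      using triangle_diff[of "(?\<alpha>' - ?\<alpha>) *\<^sub>r z + (?y' - ?y) * z" "(?\<alpha>' - ?\<alpha>) *\<^sub>r z"] D[of z] \<alpha>(5)
      by (simp only: scale_real add_diff_cancel_left' abs_of_nonneg diff_ge_0_iff_ge, linarith?)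
    moreover have "(?\<alpha>' - ?\<alpha>) * p z + (?\<alpha>' - ?\<alpha>) * p z \<le> e' * p z" for z
      using mult_right_mono[OF \<alpha>(4) nonneg[of z]] by (simp add: mult_ac)
    ultimately show "p ((?y' - ?y) * z) \<le> e' * p z" for z by (rule order_trans)
  qed (use e' in simp)
  have "2 *\<^sub>r ?y' = - d + (2 * ?\<alpha>) *\<^sub>r ?y + ?y * ?y"
    by (simp add: element_iter.simps scaleC_simps scaleC_one algebra_simps)
  then have "?y * ?y - d = 2 *\<^sub>r ?y' - (2 * ?\<alpha>) *\<^sub>r ?y" by (simp add: algebra_simps)
  also have "\<dots> = 2 *\<^sub>r (?y' - ?y) + (2 * (1 - ?\<alpha>)) *\<^sub>r ?y"
    by (simp add: scaleC_simps algebra_simps scaleC_module.scale_left_diff_distrib)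
  finally have "p (?y * ?y - d) \<le> 2 * p (?y' - ?y) + 2 * (1 - ?\<alpha>) * p ?y"
    using triangle[of "2 *\<^sub>r (?y' - ?y)" "(2 * (1 - ?\<alpha>)) *\<^sub>r ?y"] \<alpha> by (simp only: scale_real, simp?)
  also have "\<dots> \<le> 2 * e' + 2 * e' * 2"
    using pd py \<alpha> by (intro add_mono mult_mono mult_left_mono) simp_all
  also have "\<dots> \<le> e" using e' by simp
  finally have 1: "p ((- ?y) * (- ?y) - d) \<le> e" by simp
  have "p (z - (- ?y) * z) \<le> p z" for z
  proof -
    have "z - (- ?y) * z = (1 - ?\<alpha>) *\<^sub>r z + (?\<alpha> *\<^sub>r z + ?y * z)"
      by (simp add: scaleC_module.scale_left_diff_distrib scaleC_one)
    then have "p (z - (- ?y) * z) \<le> (1 - ?\<alpha>) * p z + ?\<alpha> * p z"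
      using triangle[of "(1 - ?\<alpha>) *\<^sub>r z" "?\<alpha> *\<^sub>r z + ?y * z"] Y[of z] \<alpha> by (simp only: scale_real, simp?)
    then show ?thesis by (simp add: algebra_simps)
  qed
  with 1 bicommutant_minus[OF y] show ?thesis by blast
qed

end

section \<open>Limits in locally \<open>C\<^sup>*\<close>-algebras\<close>

lemma cstar_seminormed_of_cont: "p \<in> S\<^sub>* \<Longrightarrow> cstar_seminormed p"
  by (simp add: cont_cstar_seminorms_def cstar_seminormed_def)

text \<open>The family that defines the uniformity consists of continuous seminorms, so it may be enlarged to
  the set of all of them, which is directed.\<close>

lemma uniformity_by_cont_seminorms:
  "(uniformity :: ('a::locally_cstar_algebra \<times> 'a) filter)
     = (INF p\<in>S\<^sub>*. INF e\<in>{0<..}. principal {(x, y). p (x - y) < e})"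
  and eventually_cont_seminorm_less:
  "p \<in> S\<^sub>* \<Longrightarrow> 0 < e \<Longrightarrow> \<forall>\<^sub>F x in nhds (y::'a). p (x - y) < e"
proof -
  obtain P :: "('a \<Rightarrow> real) set" where P: "\<And>p. p \<in> P \<Longrightarrow> cstar_seminorm p"
    and U: "uniformity = (INF p\<in>P. INF e\<in>{0<..}. principal {(x, y). p (x - y) < e})"
    using uniformity_cstar_seminorms by blast
  have ev: "eventually (\<lambda>(x, y). p (x - y) < e) uniformity" if "p \<in> P" "0 < e" for p e
  proof -
    have "(uniformity :: ('a \<times> 'a) filter) \<le> principal {(x, y). p (x - y) < e}"
      unfolding U by (rule INF_lower2[OF that(1)], rule INF_lower) (use that in simp)
    then show ?thesis by (simp add: le_principal)
  qed
  have near: "\<forall>\<^sub>F x in nhds y. p (x - y) < e" if "p \<in> P" "0 < e" for p e y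
  proof -
    interpret cstar_seminormed p by unfold_locales (rule P[OF that(1)])
    show ?thesis unfolding eventually_nhds_uniformity
      using ev[OF that] by (rule eventually_mono) (auto simp: diff_commute)
  qed
  have PS: "p \<in> S\<^sub>*" if "p \<in> P" for p
  proof -
    interpret cstar_seminormed p by unfold_locales (rule P[OF that])
    have "(p \<longlongrightarrow> p y) (nhds y)" for y
    proof (rule tendstoI)
      fix e :: real assume "0 < e"
      have "dist (p x) (p y) \<le> p (x - y)" for x
        using triangle_minus[of x y] triangle_minus[of y x] by (simp add: dist_real_def diff_commute)
      then show "\<forall>\<^sub>F x in nhds y. dist (p x) (p y) < e"
        using near[OF that \<open>0 < e\<close>, of y] by (elim eventually_mono) (meson le_less_trans)
    qed
    then have "(p \<longlongrightarrow> p y) (at y)" for y by (rule tendsto_mono[rotated]) (simp add: at_within_def)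
    then show ?thesis using P[OF that]
      by (simp add: cont_cstar_seminorms_def continuous_on_def)
  qed
  \<comment> \<open>Translations are uniformly continuous, as the generating seminorms are invariant under them. So
    an estimate near zero, which continuity provides, holds near every point.\<close>
  have transl: "filterlim (\<lambda>x. x - y) (nhds 0) (nhds (y::'a))" for y
    unfolding filterlim_iff eventually_nhds_uniformity[of _ "0::'a"]
  proof safe
    fix Q assume "\<forall>\<^sub>F (x', u) in uniformity. x' = (0::'a) \<longrightarrow> Q u"
    moreover have "filterlim (\<lambda>(u, v). (u - y, v - y)) (uniformity :: ('a \<times> 'a) filter) uniformity"
      by (subst (1) U) (auto simp: filterlim_INF filterlim_principal case_prod_unfold
            intro!: ev[unfolded case_prod_unfold])
    ultimately have "\<forall>\<^sub>F (u, v) in uniformity. u - y = 0 \<longrightarrow> Q (v - y)"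
      unfolding filterlim_iff case_prod_unfold by fastforce
    then show "\<forall>\<^sub>F x in nhds y. Q (x - y)"
      unfolding eventually_nhds_uniformity by (rule eventually_mono) auto
  qed
  have S_near: "\<forall>\<^sub>F x in nhds y. p (x - y) < e" if "p \<in> S\<^sub>*" "0 < e" for p e and y :: 'a
  proof -
    interpret cstar_seminormed p by (rule cstar_seminormed_of_cont[OF that(1)])
    have "continuous_on UNIV p" using that by (simp add: cont_cstar_seminorms_def)
    then have "(p \<longlongrightarrow> p 0) (nhds 0)"
      by (metis UNIV_I continuous_on_eq_continuous_at isCont_def open_UNIV tendsto_at_iff_tendsto_nhds)
    then have "((\<lambda>x. p (x - y)) \<longlongrightarrow> p 0) (nhds y)" by (rule filterlim_compose[OF _ transl])
    then show ?thesis using order_tendstoD(2)[of _ "p 0" "nhds y" e] that by simp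
  qed
  then show "p \<in> S\<^sub>* \<Longrightarrow> 0 < e \<Longrightarrow> \<forall>\<^sub>F x in nhds (y::'a). p (x - y) < e" for p e y .
  show "(uniformity :: ('a \<times> 'a) filter)
     = (INF p\<in>S\<^sub>*. INF e\<in>{0<..}. principal {(x, y). p (x - y) < e})"
  proof (rule antisym)
    show "(INF p\<in>S\<^sub>*. INF e\<in>{0<..}. principal {(x, y). p (x - y) < e}) \<le> (uniformity :: ('a \<times> 'a) filter)"
      unfolding U using PS by (intro INF_superset_mono) auto
    show "(uniformity :: ('a \<times> 'a) filter) \<le> (INF p\<in>S\<^sub>*. INF e\<in>{0<..}. principal {(x, y). p (x - y) < e})"
    proof (intro INF_greatest, simp only: le_principal)
      fix p :: "'a \<Rightarrow> real" and e :: real assume p: "p \<in> S\<^sub>*" "e \<in> {0<..}"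
      have "\<forall>\<^sub>F x in nhds (0::'a). p x < e" using S_near[OF p(1), of e 0] p(2) by simp
      then have "\<forall>\<^sub>F (x', u) in uniformity. x' = (0::'a) \<longrightarrow> p u < e"
        by (simp add: eventually_nhds_uniformity)
      moreover have "filterlim (\<lambda>(u, v). (0, u - v)) (uniformity :: ('a \<times> 'a) filter) uniformity"
        unfolding U[THEN arg_cong[where f = "\<lambda>F. filterlim f F G" for f G]]
      proof (auto simp: filterlim_INF filterlim_principal case_prod_unfold)
        fix p :: "'a \<Rightarrow> real" and e :: real assume "p \<in> P" "0 < e"
        interpret cstar_seminormed p by unfold_locales (rule P[OF \<open>p \<in> P\<close>])
        show "\<forall>\<^sub>F x in uniformity. p (snd x - fst x) < e"
          using ev[OF \<open>p \<in> P\<close> \<open>0 < e\<close>] by (simp add: case_prod_unfold diff_commute)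
      qed
      ultimately have "\<forall>\<^sub>F (u, v) in uniformity. p (u - v) < e"
        unfolding filterlim_iff case_prod_unfold by fastforce
      then show "\<forall>\<^sub>F x in uniformity. x \<in> {(x, y). p (x - y) < e}" by (simp add: case_prod_unfold)
    qed
  qed
qed

lemma cont_seminorms_separate:
  fixes x :: "'a::locally_cstar_algebra"
  assumes "\<And>p. p \<in> S\<^sub>* \<Longrightarrow> p x = 0"
  shows "x = 0"
proof (rule ccontr)
  assume "x \<noteq> 0"
  have "principal {(0, x)} \<le> (uniformity :: ('a \<times> 'a) filter)"
    unfolding uniformity_by_cont_seminorms
  proof (intro INF_greatest, simp)
    fix p :: "'a \<Rightarrow> real" and e :: real assume p: "p \<in> S\<^sub>*" "0 < e"
    interpret cstar_seminormed p by (rule cstar_seminormed_of_cont[OF p(1)])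
    show "p (- x) < e" using assms[OF p(1)] p(2) by simp
  qed
  then have "\<forall>\<^sub>F y in nhds 0. Q y \<Longrightarrow> Q x" for Q
    unfolding eventually_nhds_uniformity by (auto simp: le_filter_def eventually_principal)
  then obtain "\<And>U. open U \<Longrightarrow> 0 \<in> U \<Longrightarrow> x \<in> U" by (metis eventually_nhds_in_open)
  then show False using hausdorff[OF \<open>x \<noteq> 0\<close>] by blast
qed

lemma max_cont_seminorm:
  assumes p: "p \<in> S\<^sub>*" and q: "q \<in> S\<^sub>*"
  shows "(\<lambda>x. max (p x) (q x)) \<in> S\<^sub>*"
proof -
  interpret p: cstar_seminormed p by (rule cstar_seminormed_of_cont[OF p])
  interpret q: cstar_seminormed q by (rule cstar_seminormed_of_cont[OF q])
  have "max (p (x + y)) (q (x + y)) \<le> max (p x) (q x) + max (p y) (q y)" for x y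
    using p.triangle[of x y] q.triangle[of x y] by linarith
  moreover have "max ((p x)\<^sup>2) ((q x)\<^sup>2) = (max (p x) (q x))\<^sup>2" for x
    by (metis max_def p.nonneg power_mono_iff q.nonneg zero_less_numeral)
  ultimately have "cstar_seminorm (\<lambda>x. max (p x) (q x))"
    by (auto simp: cstar_seminorm_def p.scale q.scale p.cstar q.cstar max_mult_distrib_left)
  then show ?thesis using p q by (auto simp: cont_cstar_seminorms_def intro!: continuous_on_max)
qed

lemma zero_cont_seminorm: "(\<lambda>x. 0) \<in> S\<^sub>*"
  by (simp add: cont_cstar_seminorms_def cstar_seminorm_def)

text \<open>Completeness in the form in which it is used throughout. Approximate solutions can only be
  constructed for one seminorm at a time; since their sets shrink when the seminorm grows, they form
  the base of a filter, and this filter is Cauchy as soon as good approximate solutions for a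
  seminorm are close to each other in it.\<close>

lemma limit_of_approximations:
  fixes Y :: "('a::locally_cstar_algebra \<Rightarrow> real) \<Rightarrow> real \<Rightarrow> 'a set"
  assumes ne: "\<And>p d. p \<in> S\<^sub>* \<Longrightarrow> 0 < d \<Longrightarrow> Y p d \<noteq> {}"
    and mono: "\<And>p q d d'. p \<in> S\<^sub>* \<Longrightarrow> q \<in> S\<^sub>* \<Longrightarrow> (\<And>x. p x \<le> q x) \<Longrightarrow> 0 < d \<Longrightarrow> d \<le> d' \<Longrightarrow> Y q d \<subseteq> Y p d'"
    and cauchy: "\<And>p e. p \<in> S\<^sub>* \<Longrightarrow> 0 < e \<Longrightarrow> \<exists>d>0. \<forall>y\<in>Y p d. \<forall>y'\<in>Y p d. p (y - y') < e"
  shows "\<exists>y. \<forall>p\<in>S\<^sub>*. \<forall>e>0. \<forall>d>0. \<exists>y'\<in>Y p d. p (y' - y) < e"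
proof -
  define I where "I = (S\<^sub>* :: ('a \<Rightarrow> real) set) \<times> {0::real<..}"
  define F where "F = (INF (p, d)\<in>I. principal (Y p d))"
  have I0: "I \<noteq> {}" using zero_cont_seminorm by (auto simp: I_def)
  have ev: "eventually Q F \<longleftrightarrow> (\<exists>(p, d)\<in>I. \<forall>y\<in>Y p d. Q y)" for Q
  proof -
    have "eventually Q F \<longleftrightarrow> (\<exists>i\<in>I. eventually Q (principal (case i of (p, d) \<Rightarrow> Y p d)))"
      unfolding F_def case_prod_unfold
    proof (rule eventually_INF_base[OF I0])
      fix a b assume a: "a \<in> I" and b: "b \<in> I"
      let ?c = "(\<lambda>x. max (fst a x) (fst b x), min (snd a) (snd b))"
      have "?c \<in> I" using a b max_cont_seminorm by (auto simp: I_def)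
      moreover have "Y (fst ?c) (snd ?c) \<subseteq> Y (fst a) (snd a)" "Y (fst ?c) (snd ?c) \<subseteq> Y (fst b) (snd b)"
        using a b \<open>?c \<in> I\<close> by (intro mono; force simp: I_def)+
      ultimately show "\<exists>x\<in>I. principal (Y (fst x) (snd x)) \<le>
          inf (principal (Y (fst a) (snd a))) (principal (Y (fst b) (snd b)))"
        by (intro bexI[of _ ?c]) auto
    qed
    then show ?thesis by (simp add: eventually_principal case_prod_unfold)
  qed
  have "F \<noteq> bot"
    unfolding trivial_limit_def ev using ne by (fastforce simp: I_def)
  moreover have "cauchy_filter F"
    unfolding cauchy_filter_def uniformity_by_cont_seminorms
  proof (intro INF_greatest, simp only: le_principal)
    fix p :: "'a \<Rightarrow> real" and e :: real assume p: "p \<in> S\<^sub>*" "e \<in> {0<..}"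
    then obtain d where d: "d > 0" "\<forall>y\<in>Y p d. \<forall>y'\<in>Y p d. p (y - y') < e" using cauchy[of p e] by auto
    have "eventually (\<lambda>y. y \<in> Y p d) F" unfolding ev using p d(1) by (intro bexI[of _ "(p, d)"]) (auto simp: I_def)
    then show "\<forall>\<^sub>F x in F \<times>\<^sub>F F. x \<in> {(x, y). p (x - y) < e}"
      unfolding eventually_prod_filter using d(2) by auto
  qed
  ultimately obtain y where y: "F \<le> nhds y"
    using complete_UNIV_uniform unfolding complete_uniform by auto
  have "\<exists>y'\<in>Y p d. p (y' - y) < e" if p: "p \<in> S\<^sub>*" and e: "0 < e" and d: "0 < d" for p e d
  proof -
    have "eventually (\<lambda>y'. p (y' - y) < e) F"
      using eventually_cont_seminorm_less[OF p e, of y] y by (simp add: le_filter_def)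
    moreover have "eventually (\<lambda>y'. y' \<in> Y p d) F"
      unfolding ev using p d by (intro bexI[of _ "(p, d)"]) (auto simp: I_def)
    ultimately have "eventually (\<lambda>y'. y' \<in> Y p d \<and> p (y' - y) < e) F" by (simp add: eventually_conj)
    then show ?thesis using eventually_happens'[OF \<open>F \<noteq> bot\<close>] by blast
  qed
  then show ?thesis by blast
qed

lemma zero_if_small:
  fixes x :: "'a::locally_cstar_algebra"
  assumes "\<And>p e. p \<in> S\<^sub>* \<Longrightarrow> 0 < e \<Longrightarrow> p x \<le> e"
  shows "x = 0"
proof (rule cont_seminorms_separate)
  fix p :: "'a \<Rightarrow> real" assume p: "p \<in> S\<^sub>*"
  interpret cstar_seminormed p by (rule cstar_seminormed_of_cont[OF p])
  have "p x \<le> 0" by (rule field_le_epsilon) (use assms[OF p] in simp)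
  then show "p x = 0" using nonneg[of x] by simp
qed

text \<open>Equations that hold approximately for the approximate solutions hold exactly in the limit.\<close>

lemma lipschitz_limit_zero:
  fixes L :: "'a::locally_cstar_algebra \<Rightarrow> 'a" and Y :: "('a \<Rightarrow> real) \<Rightarrow> real \<Rightarrow> 'a set"
  assumes approx: "\<And>p e d. p \<in> S\<^sub>* \<Longrightarrow> 0 < e \<Longrightarrow> 0 < d \<Longrightarrow> \<exists>y'\<in>Y p d. p (y' - y) < e"
    and small: "\<And>p d y'. p \<in> S\<^sub>* \<Longrightarrow> y' \<in> Y p d \<Longrightarrow> p (L y') \<le> d"
    and lipschitz: "\<And>p. p \<in> S\<^sub>* \<Longrightarrow> \<exists>K. \<forall>u v. p (L u - L v) \<le> K * p (u - v)"
  shows "L y = 0"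
proof (rule zero_if_small)
  fix p :: "'a \<Rightarrow> real" and e :: real assume p: "p \<in> S\<^sub>*" and e: "0 < e"
  interpret cstar_seminormed p by (rule cstar_seminormed_of_cont[OF p])
  obtain K where K: "\<And>u v. p (L u - L v) \<le> K * p (u - v)" using lipschitz[OF p] by blast
  define K' where "K' = \<bar>K\<bar> + 1"
  have K': "0 < K'" "K \<le> K'" by (auto simp: K'_def)
  obtain y' where y': "y' \<in> Y p (e / 2)" "p (y' - y) < e / (2 * K')"
    using approx[OF p, of "e / (2 * K')" "e / 2"] e K' by auto
  have "p (L y) \<le> p (L y - L y') + p (L y')" by (rule triangle_minus)
  also have "p (L y - L y') \<le> K' * p (y' - y)"
    using K[of y y'] mult_right_mono[OF K'(2) nonneg[of "y - y'"]] by (simp add: diff_commute)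
  also have "K' * p (y' - y) \<le> e / 2" using y'(2) K' by (simp add: field_simps)
  also have "p (L y') \<le> e / 2" by (rule small[OF p y'(1)])
  finally show "p (L y) \<le> e" by simp
qed

section \<open>The positive cone\<close>

context cstar_seminormed
begin

text \<open>The \<open>C\<^sup>*\<close>-identity for \<open>z \<plusminus> \<i> c\<close>, whose mean is \<open>z\<close>.\<close>

lemma commuting_square_mono:
  assumes "self_adjoint z" "self_adjoint c" "z * c = c * z"
  shows "(p z)\<^sup>2 \<le> p (z * z + c * c)"
proof -
  define B where "B = sqrt (p (z * z + c * c))"
  have "star (z + \<i> *\<^sub>C c) * (z + \<i> *\<^sub>C c) = z * z + c * c"
    "star (z - \<i> *\<^sub>C c) * (z - \<i> *\<^sub>C c) = z * z + c * c"
    using assms by (simp_all add: star_simps scaleC_simps algebra_simps scaleC_one)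
  then have "(p (z + \<i> *\<^sub>C c))\<^sup>2 = p (z * z + c * c)" "(p (z - \<i> *\<^sub>C c))\<^sup>2 = p (z * z + c * c)"
    by (simp_all flip: cstar)
  then have "p (z + \<i> *\<^sub>C c) \<le> B" "p (z - \<i> *\<^sub>C c) \<le> B"
    by (simp_all add: B_def real_le_rsqrt)
  moreover have "2 * p z = p ((z + \<i> *\<^sub>C c) + (z - \<i> *\<^sub>C c))"
    using scale[of 2 z] by (simp add: scaleC_collect)
  ultimately have "p z \<le> B"
    using triangle[of "z + \<i> *\<^sub>C c" "z - \<i> *\<^sub>C c"] by linarith
  then show ?thesis using power_mono[of "p z" B 2] by (simp add: B_def)
qed

lemma star_defect_lipschitz: "p ((star u - u) - (star v - v)) \<le> 2 * p (u - v)"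
proof -
  have split: "(star u - u) - (star v - v) = star (u - v) - (u - v)" by (simp add: star_diff)
  show ?thesis unfolding split using triangle_diff[of "star (u - v)" "u - v"] by simp
qed

text \<open>Square roots depend on their squares uniformly continuously: with \<open>r = g\<^sup>2 - h\<^sup>2\<close> and
  \<open>s = g\<^sup>2 + h\<^sup>2\<close> one has \<open>(r s)\<^sup>2 = (r\<^sup>2)\<^sup>2 + (2 r g h)\<^sup>2\<close>. That \<open>g\<^sup>2\<close> and \<open>h\<^sup>2\<close> are squares is
  essential, since \<open>c\<close> and \<open>- c\<close> have the same square.\<close>

lemma square_diff_le:
  assumes g: "self_adjoint g" and h: "self_adjoint h" and gh: "g * h = h * g"
  shows "(p (g * g - h * h))\<^sup>2 \<le> p (g * g * (g * g) - h * h * (h * h))"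
proof -
  define r s where "r = g * g - h * h" and "s = g * g + h * h"
  have gh': "g * (h * w) = h * (g * w)" for w using gh by (simp flip: mult.assoc)
  have r: "self_adjoint r" and s: "self_adjoint s" by (simp_all add: r_def s_def star_simps g h)
  have rs: "r * s = g * g * (g * g) - h * h * (h * h)"
    by (simp add: r_def s_def algebra_simps gh gh')
  define w where "w = r * (g * h) + r * (g * h)"
  have w: "self_adjoint w" "(r * r) * w = w * (r * r)"
    unfolding w_def r_def by (simp_all add: star_simps g h scaleC_simps algebra_simps gh gh')
  have eq: "(r * s) * (r * s) = (r * r) * (r * r) + w * w"
    unfolding w_def r_def s_def
    by (simp add: algebra_simps gh gh')
  have sa: "self_adjoint (r * s)" by (simp add: rs star_simps g h mult.assoc)
  have "(p r)\<^sup>2 = p (r * r)" by (simp add: self_adjoint_square r)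
  moreover have "(p (r * r))\<^sup>2 \<le> (p (r * s))\<^sup>2"
    unfolding self_adjoint_square[OF sa, symmetric] eq
    by (rule commuting_square_mono) (simp_all add: star_mult r w)
  then have "p (r * r) \<le> p (r * s)" by (rule power2_le_imp_le) simp
  ultimately show ?thesis unfolding rs by (simp only: r_def)
qed

text \<open>A fourth root rather than a square root: its square is an approximate root of \<open>a\<close> that is itself
  a square, so that approximate roots for different seminorms can be compared.\<close>

lemma approx_fourth_root:
  assumes a: "self_adjoint a" and t: "0 \<le> t" "\<And>z. p (t *\<^sub>r z - a * z) \<le> t * p z" and e: "0 < e"
  shows "\<exists>g\<in>bicommutant a. p (g * g * (g * g) - a) \<le> e"
proof -
  define T where "T = t + 1"
  have T: "0 < T" using t by (simp add: T_def)
  define d where "d = (1 / T) *\<^sub>r a"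
  have a_eq: "a = T *\<^sub>r d" using T by (simp add: d_def scaleC_simps scaleC_one)
  have d: "self_adjoint d" by (simp add: d_def star_scaleC a)
  have contr: "p (z - d * z) \<le> p z" for z
  proof -
    have "T * p (z - d * z) = p (T *\<^sub>r (z - d * z))" using T by (simp add: scale)
    also have "T *\<^sub>r (z - d * z) = (t *\<^sub>r z - a * z) + z"
      unfolding a_eq by (simp add: scaleC_simps T_def scaleC_add_left scaleC_one algebra_simps)
    also have "p \<dots> \<le> T * p z"
      using triangle[of "t *\<^sub>r z - a * z" z] t(2)[of z] by (simp add: T_def algebra_simps)
    finally show ?thesis using T by simp
  qed
  define e' where "e' = min 1 (e / (6 * T))"
  have e': "0 < e'" "e' \<le> 1" "T * (6 * e') \<le> e" using e T by (auto simp: e'_def field_simps min_def)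
  obtain f where f: "f \<in> bicommutant d" "p (f * f - d) \<le> e'" "\<And>z. p (z - f * z) \<le> p z"
    using sqrt_of_contraction[OF d contr e'(1)] by blast
  have fs: "self_adjoint f" by (rule bicommutant_self_adjoint[OF f(1)])
  obtain g where g: "g \<in> bicommutant f" "p (g * g - f) \<le> e'"
    using sqrt_of_contraction[OF fs f(3) e'(1)] by blast
  have pf: "p f \<le> 2"
  proof (rule self_adjoint_bound[OF fs])
    show "p (f * z) \<le> 2 * p z" for z using triangle_diff[of z "z - f * z"] f(3)[of z] by simp
  qed simp
  have pg: "p (g * g) \<le> 3" using triangle[of "g * g - f" f] g(2) pf e' by simp
  have split: "g * g * (g * g) - d = (g * g) * (g * g - f) + (g * g - f) * f + (f * f - d)"
    by (simp add: algebra_simps)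
  have "p (g * g * (g * g) - d) \<le> p (g * g) * p (g * g - f) + p (g * g - f) * p f + p (f * f - d)"
    unfolding split by (intro order_trans[OF triangle add_mono] submultiplicative order_refl)
  also have "\<dots> \<le> 3 * e' + e' * 2 + e'"
    using pg pf g f e' by (intro add_mono mult_mono) simp_all
  finally have bound: "p (g * g * (g * g) - d) \<le> 6 * e'" by simp
  define r where "r = sqrt (sqrt T)"
  have r: "r * r * (r * r) = T" using T by (simp add: r_def)
  have "(r *\<^sub>r g) * (r *\<^sub>r g) * ((r *\<^sub>r g) * (r *\<^sub>r g)) = (r * r * (r * r)) *\<^sub>r (g * g * (g * g))"
    by (simp add: scaleC_simps mult.assoc)
  then have "(r *\<^sub>r g) * (r *\<^sub>r g) * ((r *\<^sub>r g) * (r *\<^sub>r g)) - a = T *\<^sub>r (g * g * (g * g) - d)"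
    unfolding r a_eq scaleC_module.scale_right_diff_distrib by simp
  then have "p ((r *\<^sub>r g) * (r *\<^sub>r g) * ((r *\<^sub>r g) * (r *\<^sub>r g)) - a) = T * p (g * g * (g * g) - d)"
    using T by (simp only: scale_real abs_of_pos)
  also have "\<dots> \<le> e" using bound T e'(3) by (meson less_imp_le mult_left_mono order_trans)
  finally have "p ((r *\<^sub>r g) * (r *\<^sub>r g) * ((r *\<^sub>r g) * (r *\<^sub>r g)) - a) \<le> e" .
  moreover have "w \<in> bicommutant a" if "w \<in> bicommutant d" for w
    using that T unfolding a_eq by (auto simp: bicommutant_def scaleC_simps)
  then have "r *\<^sub>r g \<in> bicommutant a"
    using bicommutant_scale[OF bicommutant_trans[OF f(1) g(1)]] by blast
  ultimately show ?thesis by blast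
qed

text \<open>The inequalities that define positivity, with the best possible range of \<open>t\<close>, pass to limits.\<close>

lemma contraction_limit:
  assumes approx: "\<And>e. 0 < e \<Longrightarrow> \<exists>y. p (y - c) < e \<and> (\<forall>t z. p y \<le> t \<longrightarrow> p (t *\<^sub>r z - y * z) \<le> t * p z)"
    and t: "p c \<le> t"
  shows "p (t *\<^sub>r z - c * z) \<le> t * p z"
proof (rule le_of_le_add_mult[where c = "3 * p z"])
  fix e :: real assume e: "0 < e"
  then obtain y where y: "p (y - c) < e" "\<And>t z. p y \<le> t \<Longrightarrow> p (t *\<^sub>r z - y * z) \<le> t * p z"
    using approx by blast
  have "p y \<le> t + e" using triangle[of "y - c" c] y(1) t by simp
  then have "p ((t + e) *\<^sub>r z - y * z) \<le> (t + e) * p z" by (rule y(2))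
  moreover have "t *\<^sub>r z - c * z = ((t + e) *\<^sub>r z - y * z) - e *\<^sub>r z + (y - c) * z"
    by (simp add: scaleC_add_left algebra_simps)
  then have "p (t *\<^sub>r z - c * z) \<le> p ((t + e) *\<^sub>r z - y * z) + p (e *\<^sub>r z) + p ((y - c) * z)"
    using triangle[of "((t + e) *\<^sub>r z - y * z) - e *\<^sub>r z" "(y - c) * z"]
      triangle_diff[of "(t + e) *\<^sub>r z - y * z" "e *\<^sub>r z"] by simp
  moreover have "p ((y - c) * z) \<le> e * p z"
    using submultiplicative[of "y - c" z] mult_right_mono[of "p (y - c)" e "p z"] y(1) by simp
  ultimately show "p (t *\<^sub>r z - c * z) \<le> t * p z + 3 * p z * e"
    using e by (simp add: scale algebra_simps)
qed simp

end

text \<open>In terms of the spectrum: the norm of \<open>t - a\<close> is at most \<open>t\<close>. The formulation with an unspecified \<open>t\<close>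
  is stable under sums, the one with all \<open>t \<ge> p a\<close>
  (\<open>spectrally_nonneg_contraction\<close>) is stable under limits.\<close>

definition spectrally_nonneg :: "'a::locally_cstar_algebra \<Rightarrow> bool" where
  "spectrally_nonneg a \<longleftrightarrow> self_adjoint a \<and>
     (\<forall>p\<in>S\<^sub>*. \<exists>t\<ge>0. \<forall>z. p (t *\<^sub>r z - a * z) \<le> t * p z)"

lemma spectrally_nonneg_self_adjoint: "spectrally_nonneg a \<Longrightarrow> self_adjoint a"
  by (simp add: spectrally_nonneg_def)

lemma square_spectrally_nonneg:
  fixes c :: "'a::locally_cstar_algebra"
  assumes "self_adjoint c" shows "spectrally_nonneg (c * c)"
  unfolding spectrally_nonneg_def
proof (intro conjI ballI)
  show "self_adjoint (c * c)" using assms by (simp add: star_mult)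
  fix p :: "'a \<Rightarrow> real" assume p: "p \<in> S\<^sub>*"
  interpret cstar_seminormed p by (rule cstar_seminormed_of_cont[OF p])
  show "\<exists>t\<ge>0. \<forall>z. p (t *\<^sub>r z - c * c * z) \<le> t * p z"
    using square_contraction[OF assms order_refl] by (intro exI[of _ "(p c)\<^sup>2"]) (simp add: mult.assoc)
qed

lemma spectrally_nonneg_add:
  fixes a b :: "'a::locally_cstar_algebra"
  assumes a: "spectrally_nonneg a" and b: "spectrally_nonneg b" shows "spectrally_nonneg (a + b)"
  unfolding spectrally_nonneg_def
proof (intro conjI ballI)
  show "self_adjoint (a + b)" using a b by (simp add: star_add spectrally_nonneg_def)
  fix p :: "'a \<Rightarrow> real" assume p: "p \<in> S\<^sub>*"
  interpret cstar_seminormed p by (rule cstar_seminormed_of_cont[OF p])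
  obtain s t where s: "0 \<le> s" "\<And>z. p (s *\<^sub>r z - a * z) \<le> s * p z"
    and t: "0 \<le> t" "\<And>z. p (t *\<^sub>r z - b * z) \<le> t * p z"
    using a b p unfolding spectrally_nonneg_def by meson
  have "p ((s + t) *\<^sub>r z - (a + b) * z) \<le> (s + t) * p z" for z
  proof -
    have "(s + t) *\<^sub>r z - (a + b) * z = (s *\<^sub>r z - a * z) + (t *\<^sub>r z - b * z)"
      by (simp add: scaleC_add_left algebra_simps)
    then show ?thesis
      using triangle[of "s *\<^sub>r z - a * z" "t *\<^sub>r z - b * z"] s(2)[of z] t(2)[of z]
      by (simp add: algebra_simps)
  qed
  then show "\<exists>t\<ge>0. \<forall>z. p (t *\<^sub>r z - (a + b) * z) \<le> t * p z"
    using s t by (intro exI[of _ "s + t"]) simp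
qed

lemma spectrally_nonneg_scale:
  fixes a :: "'a::locally_cstar_algebra"
  assumes a: "spectrally_nonneg a" and r: "0 \<le> r" shows "spectrally_nonneg (r *\<^sub>r a)"
  unfolding spectrally_nonneg_def
proof (intro conjI ballI)
  show "self_adjoint (r *\<^sub>r a)" using a by (simp add: star_scaleC spectrally_nonneg_def)
  fix p :: "'a \<Rightarrow> real" assume p: "p \<in> S\<^sub>*"
  interpret cstar_seminormed p by (rule cstar_seminormed_of_cont[OF p])
  obtain t where t: "0 \<le> t" "\<And>z. p (t *\<^sub>r z - a * z) \<le> t * p z"
    using a p unfolding spectrally_nonneg_def by meson
  have "p ((r * t) *\<^sub>r z - (r *\<^sub>r a) * z) \<le> (r * t) * p z" for z
  proof -
    have "(r * t) *\<^sub>r z - (r *\<^sub>r a) * z = r *\<^sub>r (t *\<^sub>r z - a * z)" by (simp add: scaleC_simps)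
    then have "p ((r * t) *\<^sub>r z - (r *\<^sub>r a) * z) = r * p (t *\<^sub>r z - a * z)"
      using r by (simp only: scale_real abs_of_nonneg)
    also have "\<dots> \<le> r * (t * p z)" by (rule mult_left_mono[OF t(2) r])
    finally show ?thesis by (simp add: mult.assoc)
  qed
  then show "\<exists>t\<ge>0. \<forall>z. p (t *\<^sub>r z - (r *\<^sub>r a) * z) \<le> t * p z"
    using r t(1) by (intro exI[of _ "r * t"]) simp
qed

text \<open>The approximate roots of a single seminorm need not be approximate roots for another one; they are
  glued by completeness, since \<open>square_diff_le\<close> makes them a Cauchy family.\<close>

theorem spectrally_nonneg_sqrt:
  fixes a :: "'a::locally_cstar_algebra"
  assumes a: "spectrally_nonneg a"
  shows "\<exists>c\<in>bicommutant a. c * c = a \<and> spectrally_nonneg c"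
proof -
  define Y where "Y p d = {g * g | g. g \<in> bicommutant a \<and> p (g * g * (g * g) - a) \<le> d}"
    for p :: "'a \<Rightarrow> real" and d :: real
  have sa: "self_adjoint a" using a by (rule spectrally_nonneg_self_adjoint)
  have "\<exists>y. \<forall>p\<in>S\<^sub>*. \<forall>e>0. \<forall>d>0. \<exists>y'\<in>Y p d. p (y' - y) < e"
  proof (rule limit_of_approximations)
    fix p :: "'a \<Rightarrow> real" and d :: real assume p: "p \<in> S\<^sub>*" and d: "0 < d"
    interpret cstar_seminormed p by (rule cstar_seminormed_of_cont[OF p])
    obtain t where "0 \<le> t" "\<And>z. p (t *\<^sub>r z - a * z) \<le> t * p z"
      using a p unfolding spectrally_nonneg_def by meson
    then show "Y p d \<noteq> {}" using approx_fourth_root[OF sa _ _ d] by (fastforce simp: Y_def)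
  next
    fix p q :: "'a \<Rightarrow> real" and d d' :: real
    assume pq: "\<And>x. p x \<le> q x" and "d \<le> d'"
    then have "p x \<le> d'" if "q x \<le> d" for x using pq[of x] that by linarith
    then show "Y q d \<subseteq> Y p d'" unfolding Y_def by blast
  next
    fix p :: "'a \<Rightarrow> real" and e :: real assume p: "p \<in> S\<^sub>*" and e: "0 < e"
    interpret cstar_seminormed p by (rule cstar_seminormed_of_cont[OF p])
    have "p (y - y') < e" if yy: "y \<in> Y p (e\<^sup>2 / 4)" "y' \<in> Y p (e\<^sup>2 / 4)" for y y'
    proof -
      obtain g h where g: "y = g * g" "g \<in> bicommutant a" "p (g * g * (g * g) - a) \<le> e\<^sup>2 / 4"
        and h: "y' = h * h" "h \<in> bicommutant a" "p (h * h * (h * h) - a) \<le> e\<^sup>2 / 4"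
        using yy unfolding Y_def by blast
      have "(p (y - y'))\<^sup>2 \<le> p (g * g * (g * g) - h * h * (h * h))"
        unfolding g h
        by (rule square_diff_le[OF g(2)[THEN bicommutant_self_adjoint] h(2)[THEN bicommutant_self_adjoint]
              bicommutant_commute[OF g(2) h(2)]])
      also have "\<dots> \<le> e\<^sup>2 / 4 + e\<^sup>2 / 4"
        using triangle_diff[of "g * g * (g * g) - a" "h * h * (h * h) - a"] g(3) h(3) by simp
      also have "\<dots> < e\<^sup>2" using e by simp
      finally show ?thesis by (rule power_less_imp_less_base) (use e in simp)
    qed
    then show "\<exists>d>0. \<forall>y\<in>Y p d. \<forall>y'\<in>Y p d. p (y - y') < e"
      using e by (intro exI[of _ "e\<^sup>2 / 4"]) simp
  qed
  then obtain c where c: "\<And>p e d. p \<in> S\<^sub>* \<Longrightarrow> 0 < e \<Longrightarrow> 0 < d \<Longrightarrow> \<exists>y\<in>Y p d. p (y - c) < e"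
    by blast
  have Y: "y \<in> bicommutant a" "p (y * y - a) \<le> d" if "y \<in> Y p d" for y p d
    using that by (auto simp: Y_def intro: bicommutant_mult)
  have c': "\<exists>y\<in>(if 0 < d then bicommutant a else {}). p (y - c) < e"
    if "p \<in> S\<^sub>*" "0 < e" "0 < d" for p e and d :: real
    using c[OF that] Y(1) that(3) by auto
  have cs: "star c = c"
  proof -
    have "star c - c = 0"
    proof (rule lipschitz_limit_zero[where L = "\<lambda>u. star u - u", OF c'])
      fix p :: "'a \<Rightarrow> real" assume p: "p \<in> S\<^sub>*"
      interpret cstar_seminormed p by (rule cstar_seminormed_of_cont[OF p])
      show "p (star y - y) \<le> d" if "y \<in> (if 0 < d then bicommutant a else {})" for y d
        using that by (auto simp: bicommutant_self_adjoint split: if_splits)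
      show "\<exists>K. \<forall>u v. p ((star u - u) - (star v - v)) \<le> K * p (u - v)" using star_defect_lipschitz by blast
    qed
    then show ?thesis by simp
  qed
  have cw: "w * c = c * w" if w: "w * a = a * w" for w
  proof -
    have "w * c - c * w = 0"
    proof (rule lipschitz_limit_zero[where L = "\<lambda>u. w * u - u * w", OF c'])
      fix p :: "'a \<Rightarrow> real" assume p: "p \<in> S\<^sub>*"
      interpret cstar_seminormed p by (rule cstar_seminormed_of_cont[OF p])
      show "p (w * y - y * w) \<le> d" if "y \<in> (if 0 < d then bicommutant a else {})" for y d
        using that by (auto simp: bicommutant_commutes[OF _ w] split: if_splits)
      have "p ((w * u - u * w) - (w * v - v * w)) \<le> (2 * p w) * p (u - v)" for u v
      proof -
        have split: "(w * u - u * w) - (w * v - v * w) = w * (u - v) - (u - v) * w"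
          by (simp add: algebra_simps)
        have "p (w * (u - v) - (u - v) * w) \<le> p w * p (u - v) + p (u - v) * p w"
          by (intro order_trans[OF triangle_diff add_mono] submultiplicative)
        then show ?thesis unfolding split by simp
      qed
      then show "\<exists>K. \<forall>u v. p ((w * u - u * w) - (w * v - v * w)) \<le> K * p (u - v)" by blast
    qed
    then show ?thesis by simp
  qed
  have "c * c - a = 0"
  proof (rule zero_if_small)
    fix p :: "'a \<Rightarrow> real" and e :: real assume p: "p \<in> S\<^sub>*" and e: "0 < e"
    interpret cstar_seminormed p by (rule cstar_seminormed_of_cont[OF p])
    define e' where "e' = min 1 (e / (4 * (p c + 1)))"
    have pc: "0 < p c + 1" using nonneg[of c] by linarith
    have e': "0 < e'" "e' \<le> 1" "e' * (2 * p c + 1) \<le> e / 2"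
    proof -
      have "e' * (2 * p c + 1) \<le> e / (4 * (p c + 1)) * (2 * (p c + 1))"
        using e pc by (intro mult_mono) (auto simp: e'_def)
      also have "\<dots> = e / 2" using pc by (simp add: field_simps)
      finally show "e' * (2 * p c + 1) \<le> e / 2" .
    qed (use e pc in \<open>auto simp: e'_def\<close>)
    obtain y where y: "y \<in> Y p (e / 2)" "p (y - c) < e'" using c[OF p, of e' "e/2"] e e' by auto
    have py: "p y \<le> p c + 1" using triangle[of "y - c" c] y(2) e' by simp
    have split: "c * c - a = (y * y - a) - (y - c) * y - c * (y - c)" by (simp add: algebra_simps)
    have "p (c * c - a) \<le> p (y * y - a) + p ((y - c) * y) + p (c * (y - c))"
      unfolding split by (intro order_trans[OF triangle_diff add_mono] order_refl)
    also have "\<dots> \<le> e / 2 + e' * (p c + 1) + p c * e'"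
      using Y(2)[OF y(1)] y(2) py e'(1)
      by (intro add_mono order_trans[OF submultiplicative] mult_mono) simp_all
    also have "\<dots> \<le> e" using e'(3) by (simp add: algebra_simps)
    finally show "p (c * c - a) \<le> e" .
  qed
  then have "c * c = a" by simp
  moreover have "c \<in> bicommutant a" using cs cw by (simp add: bicommutant_def)
  moreover have "spectrally_nonneg c"
    unfolding spectrally_nonneg_def
  proof (intro conjI ballI cs)
    fix p :: "'a \<Rightarrow> real" assume p: "p \<in> S\<^sub>*"
    interpret cstar_seminormed p by (rule cstar_seminormed_of_cont[OF p])
    have "p (p c *\<^sub>r z - c * z) \<le> p c * p z" for z
    proof (rule contraction_limit[OF _ order_refl])
      fix e :: real assume "0 < e"
      then obtain g where g: "g \<in> bicommutant a" "p (g * g - c) < e"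
        using c[OF p, of e 1] by (auto simp: Y_def)
      note gs = bicommutant_self_adjoint[OF g(1)]
      have "p (t *\<^sub>r z - g * g * z) \<le> t * p z" if "p (g * g) \<le> t" for t z
        using square_contraction[OF gs, of t z] that by (simp add: self_adjoint_square[OF gs] mult.assoc)
      then show "\<exists>y. p (y - c) < e \<and> (\<forall>t z. p y \<le> t \<longrightarrow> p (t *\<^sub>r z - y * z) \<le> t * p z)"
        using g(2) by blast
    qed
    then show "\<exists>t\<ge>0. \<forall>z. p (t *\<^sub>r z - c * z) \<le> t * p z" by (intro exI[of _ "p c"]) simp
  qed
  ultimately show ?thesis by blast
qed

lemma spectrally_nonneg_contraction:
  fixes a :: "'a::locally_cstar_algebra"
  assumes a: "spectrally_nonneg a" and p: "p \<in> S\<^sub>*" and t: "p a \<le> t"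
  shows "p (t *\<^sub>r z - a * z) \<le> t * p z"
proof -
  interpret cstar_seminormed p by (rule cstar_seminormed_of_cont[OF p])
  obtain c where c: "c \<in> bicommutant a" "c * c = a" using spectrally_nonneg_sqrt[OF a] by blast
  note cs = bicommutant_self_adjoint[OF c(1)]
  show ?thesis
    using square_contraction[OF cs, of t z] t unfolding c(2)[symmetric]
    by (simp add: self_adjoint_square[OF cs] mult.assoc)
qed

text \<open>Write \<open>a = c\<^sup>2\<close> and \<open>t = p (a + b)\<close>. Then \<open>t - a = (t - (a + b)) + b\<close> is positive as a multiplier, so
  it is nearly a square \<open>w\<^sup>2\<close>, and \<open>c\<^sup>2 + w\<^sup>2 = t\<close> bounds \<open>c\<close> by dilation. To apply \<open>unital_sqrt\<close>,
  \<open>t - a\<close> is written as \<open>T (1 - (\<beta> / T + a / T))\<close> with \<open>T = t + \<beta>\<close> and \<open>\<beta> > p b\<close>.\<close>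

theorem spectrally_nonneg_mono:
  fixes a b :: "'a::locally_cstar_algebra"
  assumes a: "spectrally_nonneg a" and b: "spectrally_nonneg b" and p: "p \<in> S\<^sub>*"
  shows "p a \<le> p (a + b)"
proof -
  interpret cstar_seminormed p by (rule cstar_seminormed_of_cont[OF p])
  obtain c where c: "c \<in> bicommutant a" "c * c = a" using spectrally_nonneg_sqrt[OF a] by blast
  note cs = bicommutant_self_adjoint[OF c(1)]
  define t T where "t = p (a + b)" and "T = p (a + b) + p b + 1"
  have T: "0 < T" "p b + 1 \<le> T" using nonneg[of "a + b"] nonneg[of b] by (auto simp: T_def intro: add_nonneg_pos)
  define \<beta> where "\<beta> = p b + 1"
  define x where "x = (1 / T) *\<^sub>r a"
  have ax: "a = T *\<^sub>r x" using T by (simp add: x_def scaleC_simps scaleC_one)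
  have xs: "self_adjoint x" using a by (simp add: x_def star_scaleC spectrally_nonneg_def)
  have contr: "p (unital_mult (\<beta> / T) x z) \<le> p z" for z
  proof -
    have "T * p (unital_mult (\<beta> / T) x z) = p (T *\<^sub>r unital_mult (\<beta> / T) x z)"
      using T by (simp only: scale_real abs_of_pos)
    also have "T *\<^sub>r unital_mult (\<beta> / T) x z = (a + b) * z + (\<beta> *\<^sub>r z - b * z)"
      unfolding ax unital_mult_def using T by (simp add: scaleC_simps algebra_simps)
    also have "p \<dots> \<le> p (a + b) * p z + \<beta> * p z"
      by (intro order_trans[OF triangle] add_mono submultiplicative spectrally_nonneg_contraction[OF b p])
         (simp add: \<beta>_def)
    also have "\<dots> = T * p z" by (simp add: T_def \<beta>_def algebra_simps)
    finally show ?thesis using T by simp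
  qed
  have "(p (c * z))\<^sup>2 \<le> t * (p z)\<^sup>2" for z
  proof (rule le_of_le_add_mult[where c = "4 * T * (p z)\<^sup>2"])
    fix e :: real assume e: "0 < e"
    obtain v f where f: "f \<in> bicommutant x"
      and vf: "\<And>z. p (unital_mult v f (unital_mult v f z) - unital_mult (1 - \<beta> / T) (- x) z) \<le> e * p z"
      using unital_sqrt[OF xs contr e] by blast
    define s where "s = sqrt T"
    have s: "s * s = T" using T by (simp add: s_def)
    define E where "E = T *\<^sub>r (unital_mult v f (unital_mult v f z) - unital_mult (1 - \<beta> / T) (- x) z)"
    have "c * a = a * c" unfolding c(2)[symmetric] by (simp add: mult.assoc)
    then have "c * x = x * c" by (simp add: x_def scaleC_simps)
    then have "c * f = f * c" by (rule bicommutant_commutes[OF f])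
    then have comm: "c * (s *\<^sub>r f) = (s *\<^sub>r f) * c" by (simp add: scaleC_simps)
    have fs: "self_adjoint (s *\<^sub>r f)" using bicommutant_self_adjoint[OF f] by (simp add: star_scaleC)
    have eq: "c * (c * z) + ((s * v) * (s * v)) *\<^sub>r z + (2 * (s * v)) *\<^sub>r ((s *\<^sub>r f) * z)
        + (s *\<^sub>r f) * ((s *\<^sub>r f) * z) = t *\<^sub>r z + E"
    proof -
      have cc: "c * (c * z) = T *\<^sub>r (x * z)" using c(2) ax by (simp add: scaleC_simps flip: mult.assoc)
      have two: "(2 * r) *\<^sub>r u = r *\<^sub>r u + r *\<^sub>r u" for r and u :: 'a
        unfolding mult_2 of_real_add scaleC_add_left ..
      have V: "T *\<^sub>r unital_mult v f (unital_mult v f z)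
          = ((s * v) * (s * v)) *\<^sub>r z + (2 * (s * v)) *\<^sub>r ((s *\<^sub>r f) * z) + (s *\<^sub>r f) * ((s *\<^sub>r f) * z)"
        unfolding s[symmetric] unital_mult_def two by (simp add: scaleC_simps algebra_simps)
      have "T *\<^sub>r unital_mult (1 - \<beta> / T) (- x) z = (T - \<beta>) *\<^sub>r z - T *\<^sub>r (x * z)"
        using T unfolding unital_mult_def
        by (simp add: scaleC_simps right_diff_distrib flip: of_real_mult of_real_diff)
      moreover have "T - \<beta> = t" by (simp add: T_def \<beta>_def t_def)
      ultimately show ?thesis
        unfolding E_def scaleC_module.scale_right_diff_distrib V cc by (simp add: algebra_simps)
    qed
    have "p E \<le> (T * e) * p z"
      using mult_left_mono[OF vf[of z], of T] T unfolding E_def by (simp only: scale_real abs_of_pos) simp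
    then have "(p (c * z))\<^sup>2 \<le> (t + 4 * (T * e)) * (p z)\<^sup>2"
      by (rule dilation(1)[OF cs fs comm eq]) (simp add: t_def)
    then show "(p (c * z))\<^sup>2 \<le> t * (p z)\<^sup>2 + 4 * T * (p z)\<^sup>2 * e" by (simp add: algebra_simps)
  qed (use T in simp)
  from this[of c] have "p a * p a \<le> t * p a"
    unfolding c(2) self_adjoint_square[OF cs, symmetric] by (simp add: power2_eq_square)
  then show ?thesis unfolding t_def[symmetric]
    using nonneg[of a] nonneg[of "a + b"] by (cases "p a = 0") (auto simp: t_def mult_le_cancel_right)
qed

text \<open>Twice the imaginary part of \<open>x\<close>, up to sign.\<close>

lemma self_adjoint_i_diff_star: "self_adjoint (\<i> *\<^sub>C (x - star x))"
  for x :: "'a::complex_star_algebra"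
  by (simp add: star_simps scaleC_simps)

text \<open>The core of the positivity of \<open>b\<^sup>* b\<close>. If \<open>x\<^sup>* x\<close> is negative, then \<open>x x\<^sup>*\<close> is positive because
  \<open>x x\<^sup>* + x\<^sup>* x\<close> is a sum of squares of self-adjoint elements. With \<open>g = e\<^sup>2\<close> and \<open>t = p g\<close>,
  the inequality for \<open>t - x x\<^sup>*\<close> is applied to \<open>x e\<close>. Since \<open>(t - x x\<^sup>*) x = x (t + g)\<close>, and \<open>x k\<close> has
  the same seminorm as \<open>e k\<close> for all \<open>k\<close>, it says \<open>p (t g + g\<^sup>2) \<le> t\<^sup>2\<close>. As \<open>(t g + g\<^sup>2)\<^sup>2\<close> dominates \<open>2 t g\<^sup>3\<close>, whose seminorm
  is \<open>2 t\<^sup>4\<close>, this forces \<open>t = 0\<close>.\<close>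

lemma star_mult_eq_neg_square:
  fixes x e :: "'a::locally_cstar_algebra"
  assumes e: "self_adjoint e" and xe: "star x * x = - (e * e)"
  shows "e = 0"
proof (rule cont_seminorms_separate)
  fix p :: "'a \<Rightarrow> real" assume p: "p \<in> S\<^sub>*"
  interpret cstar_seminormed p by (rule cstar_seminormed_of_cont[OF p])
  define u v where "u = x + star x" and "v = \<i> *\<^sub>C (x - star x)"
  have u: "self_adjoint u" by (simp add: u_def star_simps add.commute)
  have v: "self_adjoint v" unfolding v_def by (rule self_adjoint_i_diff_star)
  have "x * star x + x * star x = (u * u + v * v) + (e * e + e * e)"
    using xe by (simp add: u_def v_def scaleC_simps scaleC_one algebra_simps)
  then have "spectrally_nonneg (x * star x + x * star x)"
    by (simp only:) (intro spectrally_nonneg_add square_spectrally_nonneg u v e)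
  then have "spectrally_nonneg ((1/2) *\<^sub>r (x * star x + x * star x))"
    by (rule spectrally_nonneg_scale) simp
  then have xx: "spectrally_nonneg (x * star x)"
    by (simp add: scaleC_simps scaleC_collect scaleC_one)
  define g where "g = e * e"
  define t where "t = p g"
  have t: "0 \<le> t" by (simp add: t_def)
  have tx: "t = (p x)\<^sup>2" using cstar[of x] xe by (simp add: t_def g_def)
  have g: "self_adjoint g" by (simp add: g_def star_mult e)
  have px: "p (x * k) = p (e * k)" for k
  proof -
    have "star (x * k) * (x * k) = - (star (e * k) * (e * k))"
      using xe by (simp add: star_mult e mult.assoc) (simp add: algebra_simps flip: mult.assoc)
    then have "(p (x * k))\<^sup>2 = (p (e * k))\<^sup>2" by (simp flip: cstar)
    then show ?thesis by simp
  qed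
  have "p (t *\<^sub>r (x * e) - x * star x * (x * e)) \<le> t * p (x * e)"
    using cstar[of "star x"] by (intro spectrally_nonneg_contraction[OF xx p]) (simp add: star_star tx)
  also have "t *\<^sub>r (x * e) - x * star x * (x * e) = x * (t *\<^sub>r e + g * e)"
    using xe by (simp add: g_def scaleC_simps algebra_simps) (simp add: algebra_simps flip: mult.assoc)
  finally have "p (t *\<^sub>r g + g * g) \<le> t * t"
    unfolding px by (simp add: t_def g_def scaleC_simps distrib_left mult.assoc)
  then have "(p (t *\<^sub>r g + g * g))\<^sup>2 \<le> (t * t)\<^sup>2" by (rule power_mono) simp
  also have "(p (t *\<^sub>r g + g * g))\<^sup>2 = p ((t *\<^sub>r g + g * g) * (t *\<^sub>r g + g * g))"
    by (rule self_adjoint_square[symmetric]) (simp add: star_simps g)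
  also have "(t *\<^sub>r g + g * g) * (t *\<^sub>r g + g * g)
      = (2 * t) *\<^sub>r (g * g * g) + ((t *\<^sub>r g) * (t *\<^sub>r g) + (g * g) * (g * g))"
    unfolding mult_2 of_real_add scaleC_add_left by (simp add: scaleC_simps algebra_simps)
  finally have sum: "p ((2 * t) *\<^sub>r (g * g * g) + ((t *\<^sub>r g) * (t *\<^sub>r g) + (g * g) * (g * g))) \<le> (t * t)\<^sup>2" .
  have "g * g * g = (e * g) * (e * g)" by (simp add: g_def mult.assoc)
  moreover have "self_adjoint (e * g)" by (simp add: g_def star_mult e mult.assoc)
  ultimately have "spectrally_nonneg (g * g * g)" by (metis square_spectrally_nonneg)
  then have "p ((2 * t) *\<^sub>r (g * g * g)) \<le> (t * t)\<^sup>2"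
    using t g
    by (intro order_trans[OF spectrally_nonneg_mono[OF _ _ p] sum] spectrally_nonneg_add
        spectrally_nonneg_scale square_spectrally_nonneg) (simp_all add: star_simps)
  then have 1: "2 * t * p (g * g * g) \<le> t ^ 4"
    using t unfolding scale_real by (simp add: power2_eq_square power4_eq_xxxx mult.assoc)
  have "t ^ 4 = (p (g * g))\<^sup>2"
    using self_adjoint_square[OF g] by (simp add: t_def flip: power_mult)
  also have "\<dots> = p ((g * g) * (g * g))"
    by (rule self_adjoint_square[symmetric]) (simp add: star_mult g)
  also have "\<dots> \<le> p g * p (g * g * g)"
    using submultiplicative[of g "g * g * g"] by (simp add: mult.assoc)
  finally have 2: "t ^ 4 \<le> t * p (g * g * g)" by (simp add: t_def)
  have "t ^ 4 \<le> 0" using 1 2 by linarith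
  then have "t = 0" using t by (metis power_eq_0_iff zero_le_power antisym)
  then show "p e = 0" using self_adjoint_square[OF e] by (simp add: t_def g_def)
qed

text \<open>For \<open>a = b\<^sup>* b\<close> let \<open>c\<close> be the positive root of \<open>a\<^sup>2\<close> and \<open>m = c - a\<close>, twice the negative part of
  \<open>a\<close>. Then \<open>(b m)\<^sup>* (b m) = m a m = - m c m\<close> is minus a square, so it vanishes by the preceding
  lemma; hence \<open>m = 0\<close> and \<open>a = c\<close>.\<close>

theorem nonneg_iff_spectrally_nonneg: "nonneg a \<longleftrightarrow> spectrally_nonneg a"
  for a :: "'a::locally_cstar_algebra"
proof
  assume "spectrally_nonneg a"
  then obtain c where "c \<in> bicommutant a" "c * c = a" using spectrally_nonneg_sqrt by blast
  then have "a = star c * c" by (simp add: bicommutant_self_adjoint)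
  then show "nonneg a" unfolding nonneg_def by blast
next
  assume "nonneg a"
  then obtain b where b: "a = star b * b" unfolding nonneg_def by blast
  then have a: "self_adjoint a" by (simp add: star_simps)
  obtain c where c: "c \<in> bicommutant (a * a)" "c * c = a * a" "spectrally_nonneg c"
    using spectrally_nonneg_sqrt[OF square_spectrally_nonneg[OF a]] by blast
  have ac: "a * c = c * a" by (rule bicommutant_commutes[OF c(1)]) (simp add: mult.assoc)
  obtain d where d: "d \<in> bicommutant c" "d * d = c" using spectrally_nonneg_sqrt[OF c(3)] by blast
  have ad: "a * d = d * a" by (rule bicommutant_commutes[OF d(1) ac])
  have cd: "c * d = d * c" by (rule bicommutant_commutes[OF d(1) refl])
  have cs: "self_adjoint c" and ds: "self_adjoint d"
    using c d by (auto intro: bicommutant_self_adjoint)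
  define m where "m = c - a"
  have ms: "self_adjoint m" by (simp add: m_def star_diff cs a)
  have am: "a * m = - (c * m)" unfolding m_def right_diff_distrib using ac c(2) by simp
  have dm: "d * m = m * d" unfolding m_def by (simp add: algebra_simps ad cd)
  have cm: "c * m = m * c" unfolding m_def by (simp add: algebra_simps ac)
  have "star (b * m) * (b * m) = m * (a * m)" by (simp add: b star_mult ms mult.assoc)
  also have "\<dots> = - (m * (c * m))" by (simp add: am)
  also have "m * (c * m) = (d * m) * (d * m)"
    unfolding d(2)[symmetric] by (metis dm mult.assoc)
  finally have "star (b * m) * (b * m) = - ((d * m) * (d * m))" .
  then have "d * m = 0"
    by (rule star_mult_eq_neg_square[rotated]) (simp add: star_mult ms ds dm)
  then have cm0: "c * m = 0" by (simp add: mult.assoc flip: d(2))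
  then have "m * m = 0" using am unfolding m_def left_diff_distrib by simp
  have "m = 0"
  proof (rule cont_seminorms_separate)
    fix p :: "'a \<Rightarrow> real" assume p: "p \<in> S\<^sub>*"
    interpret cstar_seminormed p by (rule cstar_seminormed_of_cont[OF p])
    show "p m = 0" using self_adjoint_square[OF ms] \<open>m * m = 0\<close> by simp
  qed
  then show "spectrally_nonneg a" using c(3) by (simp add: m_def)
qed

lemma nonneg_self_adjoint: "nonneg a \<Longrightarrow> self_adjoint a" for a :: "'a::locally_cstar_algebra"
  by (auto simp: nonneg_def star_simps)

lemma nonneg_mono:
  "nonneg a \<Longrightarrow> nonneg b \<Longrightarrow> p \<in> S\<^sub>* \<Longrightarrow> p a \<le> p (a + b)" for a b :: "'a::locally_cstar_algebra"
  unfolding nonneg_iff_spectrally_nonneg by (rule spectrally_nonneg_mono)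

theorem nonneg_limit:
  fixes a :: "'a::locally_cstar_algebra"
  assumes "\<And>p e. p \<in> S\<^sub>* \<Longrightarrow> 0 < e \<Longrightarrow> \<exists>y. nonneg y \<and> p (y - a) < e"
  shows "nonneg a"
  unfolding nonneg_iff_spectrally_nonneg spectrally_nonneg_def
proof (intro conjI ballI)
  have "star a - a = 0"
  proof (rule zero_if_small)
    fix p :: "'a \<Rightarrow> real" and e :: real assume p: "p \<in> S\<^sub>*" and e: "0 < e"
    interpret cstar_seminormed p by (rule cstar_seminormed_of_cont[OF p])
    obtain y where y: "nonneg y" "p (y - a) < e / 2" using assms[OF p, of "e / 2"] e by auto
    have "star a - a = (y - a) - star (y - a)" using nonneg_self_adjoint[OF y(1)] by (simp add: star_diff)
    then have "p (star a - a) \<le> p (y - a) + p (star (y - a))" by (simp only: triangle_diff)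
    then show "p (star a - a) \<le> e" using y(2) by simp
  qed
  then show "self_adjoint a" by simp
  fix p :: "'a \<Rightarrow> real" assume p: "p \<in> S\<^sub>*"
  interpret cstar_seminormed p by (rule cstar_seminormed_of_cont[OF p])
  have "p (p a *\<^sub>r z - a * z) \<le> p a * p z" for z
  proof (rule contraction_limit[OF _ order_refl])
    fix e :: real assume "0 < e"
    then obtain y where "spectrally_nonneg y" "p (y - a) < e"
      using assms[OF p] unfolding nonneg_iff_spectrally_nonneg by blast
    then show "\<exists>y. p (y - a) < e \<and> (\<forall>t z. p y \<le> t \<longrightarrow> p (t *\<^sub>r z - y * z) \<le> t * p z)"
      using spectrally_nonneg_contraction[OF _ p] by blast
  qed
  then show "\<exists>t\<ge>0. \<forall>z. p (t *\<^sub>r z - a * z) \<le> t * p z" by (intro exI[of _ "p a"]) simp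
qed

section \<open>The element \<open>b\<^sup>2 (1 + b\<^sup>2)\<^sup>-\<^sup>1\<close>\<close>

lemma (in cstar_seminormed) le_plus_square:
  assumes "self_adjoint z" "self_adjoint b" "z * b = b * z"
  shows "p z \<le> p (z + b * b * z)"
proof -
  have zb: "z * (b * w) = b * (z * w)" for w using assms(3) by (simp flip: mult.assoc)
  have "(p z)\<^sup>2 \<le> p (z * z + (b * z) * (b * z))"
    by (rule commuting_square_mono) (simp_all add: assms star_mult mult.assoc zb)
  also have "z * z + (b * z) * (b * z) = z * (z + b * b * z)"
    by (simp add: distrib_left mult.assoc zb)
  also have "p \<dots> \<le> p z * p (z + b * b * z)" by (rule submultiplicative)
  finally have le: "p z * p z \<le> p z * p (z + b * b * z)" by (simp add: power2_eq_square)
  show ?thesis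
  proof (cases "p z = 0")
    case False
    then have "0 < p z" using nonneg[of z] by linarith
    then show ?thesis using le by simp
  qed simp
qed

text \<open>For a fixed seminorm the solution \<open>y\<close> is approximated by a Neumann series, as \<open>1 + b\<^sup>2\<close> is
  \<open>1 + t\<close> minus a multiplier of norm at most \<open>t\<close> with \<open>t = (p b)\<^sup>2\<close>; \<open>le_plus_square\<close> shows that
  approximate solutions are close to each other.\<close>

theorem bounded_transform:
  fixes b :: "'a::locally_cstar_algebra"
  assumes b: "self_adjoint b"
  shows "\<exists>y. self_adjoint y \<and> y * b = b * y \<and> y + b * b * y = b * b"
proof -
  define Y where "Y p d = {y \<in> bicommutant (b * b). p (b * b - (y + b * b * y)) \<le> d}"
    for p :: "'a \<Rightarrow> real" and d :: real
  have bb: "self_adjoint (b * b)" by (simp add: star_mult b)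
  have comm: "y * b = b * y" if "y \<in> bicommutant (b * b)" for y
    using bicommutant_commutes[OF that, of b] by (simp add: mult.assoc)
  have "\<exists>y. \<forall>p\<in>S\<^sub>*. \<forall>e>0. \<forall>d>0. \<exists>y'\<in>Y p d. p (y' - y) < e"
  proof (rule limit_of_approximations)
    fix p :: "'a \<Rightarrow> real" and d :: real assume p: "p \<in> S\<^sub>*" and d: "0 < d"
    interpret cstar_seminormed p by (rule cstar_seminormed_of_cont[OF p])
    define t where "t = (p b)\<^sup>2"
    have t: "0 \<le> t" by (simp add: t_def)
    define q where "q = t / (1 + t)"
    have q: "0 \<le> q" "q < 1" using t by (simp_all add: q_def)
    have step: "\<exists>y\<in>bicommutant (b * b). p (b * b - (y + b * b * y)) \<le> q ^ n * t" for n
    proof (induction n)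
      case 0
      show ?case using self_adjoint_square[OF b] by (intro bexI[of _ 0]) (simp_all add: t_def bicommutant_zero)
    next
      case (Suc n)
      then obtain y where y: "y \<in> bicommutant (b * b)" "p (b * b - (y + b * b * y)) \<le> q ^ n * t" by blast
      define r where "r = b * b - (y + b * b * y)"
      \<comment> \<open>One more term of the series multiplies the residual \<open>r\<close> by \<open>(t - b\<^sup>2) / (1 + t)\<close>.\<close>
      define y' where "y' = y + (1 / (1 + t)) *\<^sub>r r"
      have r: "r \<in> bicommutant (b * b)"
        unfolding r_def by (intro bicommutant_diff bicommutant_add bicommutant_mult bicommutant_self bb y)
      have y': "y' \<in> bicommutant (b * b)"
        unfolding y'_def by (intro bicommutant_add bicommutant_scale y r)
      have "r = (1 / (1 + t)) *\<^sub>r ((1 + t) *\<^sub>r r)"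
        unfolding scaleC_scaleC of_real_mult[symmetric] using t by (simp add: scaleC_one)
      then have "b * b - (y' + b * b * y') = (1 / (1 + t)) *\<^sub>r ((1 + t) *\<^sub>r r) - (1 / (1 + t)) *\<^sub>r (r + b * (b * r))"
        by (simp add: y'_def scaleC_add_right mult_scaleC_right algebra_simps) (simp add: r_def algebra_simps)
      also have "\<dots> = (1 / (1 + t)) *\<^sub>r (t *\<^sub>r r - b * (b * r))"
        unfolding scaleC_module.scale_right_diff_distrib[symmetric] by (simp add: scaleC_add_left scaleC_one)
      finally have "p (b * b - (y' + b * b * y')) = (1 / (1 + t)) * p (t *\<^sub>r r - b * (b * r))"
        using t by (simp only: scale_real, simp?)
      also have "\<dots> \<le> (1 / (1 + t)) * (t * p r)"
        using t by (intro mult_left_mono square_contraction b) (simp_all add: t_def)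
      also have "\<dots> = q * p r" by (simp add: q_def)
      also have "\<dots> \<le> q * (q ^ n * t)" unfolding r_def by (rule mult_left_mono[OF y(2) q(1)])
      finally show ?case using y' by (auto simp: mult.assoc)
    qed
    obtain n where "q ^ n < d / (t + 1)" using real_arch_pow_inv[of "d / (t + 1)" q] q d t by auto
    then have "q ^ n * (t + 1) < d" using t by (simp add: pos_less_divide_eq)
    moreover have "0 \<le> q ^ n" using q by simp
    ultimately have "q ^ n * t \<le> d" by (simp add: algebra_simps)
    then show "Y p d \<noteq> {}" using step[of n] unfolding Y_def by fastforce
  next
    fix p q :: "'a \<Rightarrow> real" and d d' :: real
    assume pq: "\<And>x. p x \<le> q x" and "d \<le> d'"
    then have "p x \<le> d'" if "q x \<le> d" for x using pq[of x] that by linarith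
    then show "Y q d \<subseteq> Y p d'" unfolding Y_def by blast
  next
    fix p :: "'a \<Rightarrow> real" and e :: real assume p: "p \<in> S\<^sub>*" and e: "0 < e"
    interpret cstar_seminormed p by (rule cstar_seminormed_of_cont[OF p])
    have "p (y - y') < e" if "y \<in> Y p (e / 3)" "y' \<in> Y p (e / 3)" for y y'
    proof -
      have y: "y \<in> bicommutant (b * b)" "p (b * b - (y + b * b * y)) \<le> e / 3"
        and y': "y' \<in> bicommutant (b * b)" "p (b * b - (y' + b * b * y')) \<le> e / 3"
        using that by (auto simp: Y_def)
      note z = bicommutant_diff[OF y(1) y'(1)]
      have "p (y - y') \<le> p ((y - y') + b * b * (y - y'))"
        by (rule le_plus_square[OF bicommutant_self_adjoint[OF z] b comm[OF z]])
      also have "(y - y') + b * b * (y - y') = (b * b - (y' + b * b * y')) - (b * b - (y + b * b * y))"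
        by (simp add: algebra_simps)
      also have "p \<dots> \<le> e / 3 + e / 3" by (rule order_trans[OF triangle_diff add_mono[OF y'(2) y(2)]])
      also have "\<dots> < e" using e by simp
      finally show ?thesis .
    qed
    then show "\<exists>d>0. \<forall>y\<in>Y p d. \<forall>y'\<in>Y p d. p (y - y') < e" using e by (intro exI[of _ "e / 3"]) simp
  qed
  then obtain y where y: "\<And>p e d. p \<in> S\<^sub>* \<Longrightarrow> 0 < e \<Longrightarrow> 0 < d \<Longrightarrow> \<exists>y'\<in>Y p d. p (y' - y) < e" by blast
  have c: "\<exists>y'\<in>(if 0 < d then bicommutant (b * b) else {}). p (y' - y) < e"
    if "p \<in> S\<^sub>*" "0 < e" "0 < d" for p e and d :: real
    using y[OF that] that(3) by (auto simp: Y_def)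
  have "star y - y = 0"
  proof (rule lipschitz_limit_zero[where L = "\<lambda>u. star u - u", OF c])
    fix p :: "'a \<Rightarrow> real" assume p: "p \<in> S\<^sub>*"
    interpret cstar_seminormed p by (rule cstar_seminormed_of_cont[OF p])
    show "p (star y - y) \<le> d" if "y \<in> (if 0 < d then bicommutant (b * b) else {})" for y d
      using that by (auto simp: bicommutant_self_adjoint split: if_splits)
    show "\<exists>K. \<forall>u v. p ((star u - u) - (star v - v)) \<le> K * p (u - v)" using star_defect_lipschitz by blast
  qed
  moreover have "y * b - b * y = 0"
  proof (rule lipschitz_limit_zero[where L = "\<lambda>u. u * b - b * u", OF c])
    fix p :: "'a \<Rightarrow> real" assume p: "p \<in> S\<^sub>*"
    interpret cstar_seminormed p by (rule cstar_seminormed_of_cont[OF p])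
    show "p (y * b - b * y) \<le> d" if "y \<in> (if 0 < d then bicommutant (b * b) else {})" for y d
      using that by (auto simp: comm split: if_splits)
    have "p ((u * b - b * u) - (v * b - b * v)) \<le> (2 * p b) * p (u - v)" for u v
    proof -
      have split: "(u * b - b * u) - (v * b - b * v) = (u - v) * b - b * (u - v)"
        by (simp add: algebra_simps)
      have "p ((u - v) * b - b * (u - v)) \<le> p (u - v) * p b + p b * p (u - v)"
        by (intro order_trans[OF triangle_diff add_mono] submultiplicative)
      then show ?thesis unfolding split by simp
    qed
    then show "\<exists>K. \<forall>u v. p ((u * b - b * u) - (v * b - b * v)) \<le> K * p (u - v)" by blast
  qed
  moreover have "b * b - (y + b * b * y) = 0"
  proof (rule lipschitz_limit_zero[where L = "\<lambda>u. b * b - (u + b * b * u)", OF y])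
    fix p :: "'a \<Rightarrow> real" assume p: "p \<in> S\<^sub>*"
    interpret cstar_seminormed p by (rule cstar_seminormed_of_cont[OF p])
    show "p (b * b - (y + b * b * y)) \<le> d" if "y \<in> Y p d" for y d
      using that by (simp add: Y_def)
    have "p ((b * b - (u + b * b * u)) - (b * b - (v + b * b * v))) \<le> (1 + p (b * b)) * p (u - v)" for u v
    proof -
      have split: "(b * b - (u + b * b * u)) - (b * b - (v + b * b * v)) = - ((u - v) + b * b * (u - v))"
        by (simp add: algebra_simps)
      have "p ((u - v) + b * b * (u - v)) \<le> p (u - v) + p (b * b) * p (u - v)"
        by (intro order_trans[OF triangle add_mono] submultiplicative order_refl)
      then show ?thesis unfolding split minus by (simp add: algebra_simps)
    qed
    then show "\<exists>K. \<forall>u v. p ((b * b - (u + b * b * u)) - (b * b - (v + b * b * v))) \<le> K * p (u - v)"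
      by blast
  qed
  ultimately show ?thesis by (intro exI[of _ y]) simp
qed

text \<open>With \<open>w = b - b y\<close>, which is \<open>b (1 + b\<^sup>2)\<^sup>-\<^sup>1\<close>, one has \<open>y\<^sup>2 + w\<^sup>2 = y\<close>. The bounds by one do not
  depend on the seminorm.\<close>

lemma bounded_transform_bounds:
  fixes b y :: "'a::locally_cstar_algebra"
  assumes b: "self_adjoint b" and y: "self_adjoint y" and yb: "y * b = b * y"
    and eq: "y + b * b * y = b * b" and p: "p \<in> S\<^sub>*"
  shows "p y \<le> 1" "p (b - b * y) \<le> 1" "p y \<le> (p b)\<^sup>2"
proof -
  interpret cstar_seminormed p by (rule cstar_seminormed_of_cont[OF p])
  define w where "w = b - b * y"
  have yb': "y * (b * u) = b * (y * u)" for u using yb by (simp flip: mult.assoc)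
  have w: "self_adjoint w" by (simp add: w_def star_simps b y yb)
  have yw: "y * w = w * y" by (simp add: w_def algebra_simps yb yb')
  have bw: "b * w = y" using eq by (simp add: w_def algebra_simps)
  have "y * y + w * w = y"
  proof -
    have wb: "w * b = y" using bw by (simp add: w_def algebra_simps yb)
    have "y * y = w * (b * y)" using wb by (simp flip: mult.assoc)
    moreover have "w * b = w * (b * y) + w * w" by (simp add: w_def algebra_simps)
    ultimately show ?thesis using wb by simp
  qed
  then have le: "(p y)\<^sup>2 \<le> p y" "(p w)\<^sup>2 \<le> p y"
    using commuting_square_mono[OF y w yw] commuting_square_mono[OF w y yw[symmetric]]
    by (simp_all add: add.commute)
  show 1: "p y \<le> 1"
    using le(1) nonneg[of y] by (cases "p y = 0") (auto simp: power2_eq_square)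
  have "(p w)\<^sup>2 \<le> 1\<^sup>2" using le(2) 1 by simp
  then show "p (b - b * y) \<le> 1" unfolding w_def[symmetric] by (rule power2_le_imp_le) simp
  show "p y \<le> (p b)\<^sup>2"
    using le_plus_square[OF y b yb] unfolding eq self_adjoint_square[OF b] .
qed

section \<open>The seminorms of a Hilbert module\<close>

text \<open>The Cauchy-Schwarz inequality for \<open>v = [x, y]\<close>, \<open>A = [x, x]\<close> and \<open>B = [y, y]\<close>: the assumption is
  the positivity of the gramian of \<open>x - y (t v\<^sup>*)\<close>. It is stated without a module because it
  also serves for finite sums of kernel sections, before these form a module.\<close>

lemma cauchy_schwarz_criterion:
  fixes A B v :: "'a::locally_cstar_algebra"
  assumes p: "p \<in> S\<^sub>*" and A: "nonneg A" and B: "nonneg B"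
    and pos: "\<And>t. 0 < t \<Longrightarrow> nonneg (A - t *\<^sub>r (v * star v) - t *\<^sub>r (v * star v) + (t * t) *\<^sub>r (v * B * star v))"
  shows "(p v)\<^sup>2 \<le> p A * p B"
proof -
  interpret cstar_seminormed p by (rule cstar_seminormed_of_cont[OF p])
  have le: "2 * t * (p v)\<^sup>2 \<le> p A + t * t * ((p v)\<^sup>2 * p B)" if t: "0 < t" for t
  proof -
    define D where "D = A - t *\<^sub>r (v * star v) - t *\<^sub>r (v * star v) + (t * t) *\<^sub>r (v * B * star v)"
    define N where "N = (2 * t) *\<^sub>r (v * star v)"
    have "N = star (sqrt (2 * t) *\<^sub>r star v) * (sqrt (2 * t) *\<^sub>r star v)"
      using t by (simp add: N_def star_simps scaleC_simps flip: of_real_mult)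
    then have "nonneg N" unfolding nonneg_def by blast
    then have "p N \<le> p (N + D)" using pos[OF t] p unfolding D_def by (rule nonneg_mono)
    also have "N + D = A + (t * t) *\<^sub>r (v * B * star v)"
      unfolding N_def D_def mult_2 of_real_add scaleC_add_left by simp
    also have "p \<dots> \<le> p A + (t * t) * p (v * B * star v)"
      using triangle[of A "(t * t) *\<^sub>r (v * B * star v)"] by (simp only: scale_real) simp
    also have "p (v * B * star v) \<le> (p v)\<^sup>2 * p B"
      using submultiplicative[of "v * B" "star v"] mult_right_mono[OF submultiplicative[of v B], of "p v"]
      by (simp add: power2_eq_square algebra_simps)
    finally show ?thesis
      using t cstar[of "star v"] unfolding N_def scale_real by (simp add: star_star)
  qed
  have 0: "0 \<le> (p v)\<^sup>2" "0 \<le> p A" "0 \<le> p B" by simp_all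
  show ?thesis
  proof (cases "p B = 0")
    case True
    have "(p v)\<^sup>2 \<le> 0"
    proof (rule ccontr)
      assume "\<not> ?thesis"
      then have v: "0 < (p v)\<^sup>2" by simp
      \<comment> \<open>Any value above \<open>p A / (2 (p v)\<^sup>2)\<close> contradicts the inequality.\<close>
      define t where "t = (p A + 1) / (p v)\<^sup>2"
      have "0 < t" "t * (p v)\<^sup>2 = p A + 1" using v 0(2) by (simp_all add: t_def add_nonneg_pos)
      then show False using le[of t] True 0(2) by simp
    qed
    then show ?thesis using 0 by simp
  next
    case False
    then have B0: "0 < p B" using 0(3) by linarith
    have "2 * (1 / p B) * (p v)\<^sup>2 \<le> p A + (1 / p B) * (1 / p B) * ((p v)\<^sup>2 * p B)"
      by (rule le) (use B0 in simp)
    also have "(1 / p B) * (1 / p B) * ((p v)\<^sup>2 * p B) = (1 / p B) * (p v)\<^sup>2" using B0 by simp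
    finally have "(1 / p B) * (p v)\<^sup>2 \<le> p A" by linarith
    then show ?thesis using B0 by (simp add: pos_divide_le_eq)
  qed
qed

lemma
  shows carrier_ring_of_type_algebra: "carrier (ring_of_type_algebra :: complex ring) = UNIV"
    and add_ring_of_type_algebra: "c \<oplus>\<^bsub>ring_of_type_algebra\<^esub> d = (c + d :: complex)"
    and mult_ring_of_type_algebra: "c \<otimes>\<^bsub>ring_of_type_algebra\<^esub> d = (c * d :: complex)"
    and one_ring_of_type_algebra: "\<one>\<^bsub>ring_of_type_algebra\<^esub> = (1 :: complex)"
    and zero_ring_of_type_algebra: "\<zero>\<^bsub>ring_of_type_algebra\<^esub> = (0 :: complex)"
  by (simp_all add: ring_of_type_algebra_def)

lemmas complex_ring_simps = carrier_ring_of_type_algebra add_ring_of_type_algebra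
  mult_ring_of_type_algebra one_ring_of_type_algebra zero_ring_of_type_algebra

context hilbert_module
begin

abbreviation norm_by :: "('a \<Rightarrow> real) \<Rightarrow> 'h \<Rightarrow> real" where
  "norm_by \<equiv> gram_seminorm H"

lemma scale_closed [simp]: "x \<in> carrier H \<Longrightarrow> c \<odot>\<^bsub>H\<^esub> x \<in> carrier H"
  using smult_closed[of c x] by (simp add: complex_ring_simps)

lemma scale_one [simp]: "x \<in> carrier H \<Longrightarrow> 1 \<odot>\<^bsub>H\<^esub> x = x"
  using smult_one[of x] by (simp add: complex_ring_simps)

lemma scale_scale: "x \<in> carrier H \<Longrightarrow> c \<odot>\<^bsub>H\<^esub> (d \<odot>\<^bsub>H\<^esub> x) = (c * d) \<odot>\<^bsub>H\<^esub> x"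
  using smult_assoc1[of c d x] by (simp add: complex_ring_simps)

lemma scale_minus_one: "x \<in> carrier H \<Longrightarrow> (-1) \<odot>\<^bsub>H\<^esub> x = \<ominus> x"
proof -
  assume x: "x \<in> carrier H"
  have "x \<oplus> (-1) \<odot>\<^bsub>H\<^esub> x = (1 + -1) \<odot>\<^bsub>H\<^esub> x"
    using x smult_l_distr[of 1 "-1" x] by (simp add: complex_ring_simps)
  also have "\<dots> = \<zero>" using x smult_l_null[of x] by (simp add: complex_ring_simps)
  finally show ?thesis using x by (metis M.minus_equality M.a_comm scale_closed)
qed

declare ract_closed [simp]

lemma ract_zero: "x \<in> carrier H \<Longrightarrow> x \<cdot> 0 = \<zero>"
  using ract_add_right[of x 0 0] by (metis M.add.r_cancel_one' add_0 ract_closed)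

lemma gram_zero_right: "x \<in> carrier H \<Longrightarrow> gram H x \<zero> = 0"
  using gram_add_right[of x \<zero> \<zero>] by simp

lemma gram_ract: "x \<in> carrier H \<Longrightarrow> y \<in> carrier H \<Longrightarrow> gram H x (y \<cdot> a) = gram H x y * a"
  using gram_ract_right[of x y y a 0] by (simp add: ract_zero)

lemma gram_add_left:
  "x \<in> carrier H \<Longrightarrow> y \<in> carrier H \<Longrightarrow> z \<in> carrier H \<Longrightarrow> gram H (x \<oplus> y) z = gram H x z + gram H y z"
  by (simp add: gram_star[of "x \<oplus> y"] gram_add_right star_add gram_star[of x] gram_star[of y])

lemma gram_smult_left:
  "x \<in> carrier H \<Longrightarrow> y \<in> carrier H \<Longrightarrow> gram H (c \<odot>\<^bsub>H\<^esub> x) y = cnj c *\<^sub>C gram H x y"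
  by (simp add: gram_star[of "c \<odot>\<^bsub>H\<^esub> x"] gram_smult_right star_scaleC gram_star[of x])

lemma gram_ract_left:
  "x \<in> carrier H \<Longrightarrow> y \<in> carrier H \<Longrightarrow> gram H (x \<cdot> a) y = star a * gram H x y"
  by (simp add: gram_star[of "x \<cdot> a"] gram_ract star_mult gram_star[of x])

lemma gram_zero_left: "x \<in> carrier H \<Longrightarrow> gram H \<zero> x = 0"
  by (simp add: gram_star[of \<zero>] gram_zero_right)

lemma gram_minus_right: "x \<in> carrier H \<Longrightarrow> y \<in> carrier H \<Longrightarrow> gram H x (\<ominus> y) = - gram H x y"
  using gram_smult_right[of x y "-1"] by (simp add: scale_minus_one scaleC_one)

lemma gram_minus_left: "x \<in> carrier H \<Longrightarrow> y \<in> carrier H \<Longrightarrow> gram H (\<ominus> x) y = - gram H x y"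
  using gram_smult_left[of x y "-1"] by (simp add: scale_minus_one scaleC_one)

lemma gram_diff_right:
  "x \<in> carrier H \<Longrightarrow> y \<in> carrier H \<Longrightarrow> z \<in> carrier H \<Longrightarrow> gram H x (y \<ominus> z) = gram H x y - gram H x z"
  by (simp add: a_minus_def gram_add_right gram_minus_right)

lemma gram_diff_left:
  "x \<in> carrier H \<Longrightarrow> y \<in> carrier H \<Longrightarrow> z \<in> carrier H \<Longrightarrow> gram H (x \<ominus> y) z = gram H x z - gram H y z"
  by (simp add: a_minus_def gram_add_left gram_minus_left)

lemmas gram_simps = gram_add_right gram_add_left gram_smult_right gram_smult_left gram_ract
  gram_ract_left gram_zero_right gram_zero_left gram_minus_right gram_minus_left
  gram_diff_right gram_diff_left

lemma gram_nondegenerate: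
  assumes "x \<in> carrier H" "y \<in> carrier H" "\<And>z. z \<in> carrier H \<Longrightarrow> gram H z x = gram H z y"
  shows "x = y"
proof -
  have "gram H (x \<ominus> y) (x \<ominus> y) = 0"
    using assms by (simp add: gram_simps)
  then have "x \<ominus> y = \<zero>" using assms gram_eq_zero_iff by simp
  moreover have "x = (x \<ominus> y) \<oplus> y"
    using assms(1,2) by (simp add: a_minus_def M.a_assoc M.l_neg)
  ultimately show ?thesis using assms(2) by simp
qed

lemma gram_seminorm_square:
  assumes "p \<in> S\<^sub>*" shows "(norm_by p x)\<^sup>2 = p (gram H x x)"
proof -
  interpret cstar_seminormed p by (rule cstar_seminormed_of_cont[OF assms])
  show ?thesis by (simp add: gram_seminorm_def)
qed

lemma gram_seminorm_nonneg [simp]: assumes "p \<in> S\<^sub>*" shows "0 \<le> norm_by p x"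
proof -
  interpret cstar_seminormed p by (rule cstar_seminormed_of_cont[OF assms])
  show ?thesis by (simp add: gram_seminorm_def)
qed

theorem cauchy_schwarz:
  assumes p: "p \<in> S\<^sub>*" and x: "x \<in> carrier H" and y: "y \<in> carrier H"
  shows "p (gram H x y) \<le> norm_by p x * norm_by p y"
proof -
  interpret cstar_seminormed p by (rule cstar_seminormed_of_cont[OF p])
  define v where "v = gram H x y"
  have sv: "gram H y x = star v" unfolding v_def by (rule gram_star[OF y x])
  have "(p v)\<^sup>2 \<le> p (gram H x x) * p (gram H y y)"
  proof (rule cauchy_schwarz_criterion[OF p gram_nonneg[OF x] gram_nonneg[OF y]])
    fix t :: real
    define a where "a = t *\<^sub>r star v"
    have "gram H (x \<ominus> y \<cdot> a) (x \<ominus> y \<cdot> a) =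
       gram H x x - t *\<^sub>r (v * star v) - t *\<^sub>r (v * star v) + (t * t) *\<^sub>r (v * gram H y y * star v)"
      using x y by (simp add: gram_simps sv v_def[symmetric])
         (simp add: a_def star_simps scaleC_simps algebra_simps)
    moreover have "nonneg (gram H (x \<ominus> y \<cdot> a) (x \<ominus> y \<cdot> a))" using x y by (intro gram_nonneg) simp
    ultimately show "nonneg (gram H x x - t *\<^sub>r (v * star v) - t *\<^sub>r (v * star v)
        + (t * t) *\<^sub>r (v * gram H y y * star v))" by simp
  qed
  also have "\<dots> = (norm_by p x * norm_by p y)\<^sup>2"
    using p by (simp add: power_mult_distrib gram_seminorm_square)
  finally show ?thesis unfolding v_def by (rule power2_le_imp_le) (use p in simp)
qed

lemma gram_seminorm_triangle:
  assumes p: "p \<in> S\<^sub>*" and x: "x \<in> carrier H" and y: "y \<in> carrier H"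
  shows "norm_by p (x \<oplus> y) \<le> norm_by p x + norm_by p y"
proof -
  interpret cstar_seminormed p by (rule cstar_seminormed_of_cont[OF p])
  have "(norm_by p (x \<oplus> y))\<^sup>2 = p ((gram H x x + gram H x y) + (gram H y x + gram H y y))"
    using x y p by (simp add: gram_seminorm_square gram_simps algebra_simps)
  also have "\<dots> \<le> (p (gram H x x) + p (gram H x y)) + (p (gram H y x) + p (gram H y y))"
    by (intro order_trans[OF triangle add_mono] triangle)
  also have "\<dots> \<le> ((norm_by p x)\<^sup>2 + norm_by p x * norm_by p y) + (norm_by p y * norm_by p x + (norm_by p y)\<^sup>2)"
    unfolding gram_seminorm_square[OF p]
    by (intro add_mono order_refl cauchy_schwarz p x y)
  also have "\<dots> = (norm_by p x + norm_by p y)\<^sup>2" by (simp add: power2_eq_square algebra_simps)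
  finally show ?thesis by (rule power2_le_imp_le) (use p in simp)
qed

lemma gram_seminorm_scale:
  assumes p: "p \<in> S\<^sub>*" and x: "x \<in> carrier H"
  shows "norm_by p (c \<odot>\<^bsub>H\<^esub> x) = cmod c * norm_by p x"
proof -
  interpret cstar_seminormed p by (rule cstar_seminormed_of_cont[OF p])
  have "p (gram H (c \<odot>\<^bsub>H\<^esub> x) (c \<odot>\<^bsub>H\<^esub> x)) = (cmod c)\<^sup>2 * p (gram H x x)"
    using x by (simp add: gram_simps scale power2_eq_square norm_mult)
  then show ?thesis by (simp add: gram_seminorm_def real_sqrt_mult)
qed

lemma gram_seminorm_minus:
  assumes p: "p \<in> S\<^sub>*" and x: "x \<in> carrier H"
  shows "norm_by p (\<ominus> x) = norm_by p x"
  using gram_seminorm_scale[OF p x, of "-1"] x by (simp add: scale_minus_one)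

lemma gram_seminorm_diff_commute:
  assumes p: "p \<in> S\<^sub>*" and x: "x \<in> carrier H" and y: "y \<in> carrier H"
  shows "norm_by p (x \<ominus> y) = norm_by p (y \<ominus> x)"
proof -
  have "\<ominus> (x \<ominus> y) = y \<ominus> x" using x y by (simp add: a_minus_def M.minus_add M.a_comm)
  then show ?thesis using gram_seminorm_minus[OF p, of "x \<ominus> y"] x y by simp
qed

lemma gram_seminorm_triangle_diff:
  assumes p: "p \<in> S\<^sub>*" and x: "x \<in> carrier H" and y: "y \<in> carrier H" and z: "z \<in> carrier H"
  shows "norm_by p (x \<ominus> z) \<le> norm_by p (x \<ominus> y) + norm_by p (y \<ominus> z)"
proof -
  have "x \<ominus> z = (x \<ominus> y) \<oplus> (y \<ominus> z)"
    using x y z by (simp add: a_minus_def M.a_ac M.r_neg1 M.r_neg2 M.l_neg)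
  then show ?thesis using gram_seminorm_triangle[OF p, of "x \<ominus> y" "y \<ominus> z"] x y z by simp
qed

text \<open>Take \<open>g = h (1 + b\<^sup>2)\<^sup>-\<^sup>1\<close> with \<open>b = [h, h]\<close>. The error \<open>h - g = h y\<close> is of higher order in \<open>h\<close>, so
  it is much smaller than \<open>h\<close> for a seminorm in which \<open>h\<close> is small.\<close>

lemma truncation:
  assumes h: "h \<in> carrier H"
  obtains g where "g \<in> carrier H" "\<And>q. q \<in> S\<^sub>* \<Longrightarrow> (norm_by q g)\<^sup>2 \<le> 2"
    "\<And>p. p \<in> S\<^sub>* \<Longrightarrow> (norm_by p (h \<ominus> g))\<^sup>2 \<le> (norm_by p h)^10"
proof -
  define b where "b = gram H h h"
  have b: "self_adjoint b" using gram_star[OF h h] by (simp add: b_def)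
  obtain y where y: "self_adjoint y" "y * b = b * y" "y + b * b * y = b * b"
    using bounded_transform[OF b] by blast
  note bounds = bounded_transform_bounds[OF b y]
  define g where "g = h \<ominus> h \<cdot> y"
  have g: "g \<in> carrier H" using h by (simp add: g_def)
  have hg: "h \<ominus> g = h \<cdot> y"
    using h by (simp add: g_def a_minus_def M.minus_add M.minus_minus M.a_assoc[symmetric] M.r_neg)
  have "(norm_by q g)\<^sup>2 \<le> 2" if q: "q \<in> S\<^sub>*" for q
  proof -
    interpret cstar_seminormed q by (rule cstar_seminormed_of_cont[OF q])
    have gg: "gram H g g = (b - b * y) - y * (b - b * y)"
      using h by (simp add: g_def gram_simps b_def[symmetric] y(1) algebra_simps)
    have "q ((b - b * y) - y * (b - b * y)) \<le> 1 + 1 * 1"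
      using bounds(1,2)[OF q]
      by (intro order_trans[OF triangle_diff add_mono] order_trans[OF submultiplicative mult_mono]) simp_all
    then show ?thesis using gram_seminorm_square[OF q, of g] gg by simp
  qed
  moreover have "(norm_by p (h \<ominus> g))\<^sup>2 \<le> (norm_by p h)^10" if p: "p \<in> S\<^sub>*" for p
  proof -
    interpret cstar_seminormed p by (rule cstar_seminormed_of_cont[OF p])
    have "(norm_by p (h \<ominus> g))\<^sup>2 = p (y * (b * y))"
      using h by (simp add: gram_seminorm_square[OF p] hg gram_simps b_def[symmetric] y(1) mult.assoc)
    also have "\<dots> \<le> (p b)\<^sup>2 * (p b * (p b)\<^sup>2)"
      using bounds(3)[OF p]
      by (intro order_trans[OF submultiplicative mult_mono]
          order_trans[OF submultiplicative mult_left_mono]) simp_all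
    also have "\<dots> = ((norm_by p h)\<^sup>2) ^ 5" unfolding gram_seminorm_square[OF p] b_def[symmetric]
      by (simp add: numeral_eq_Suc)
    also have "\<dots> = (norm_by p h)^10" by (simp flip: power_mult)
    finally show ?thesis .
  qed
  ultimately show ?thesis using that g by blast
qed

lemma geometric_limit:
  assumes x: "\<And>n. x n \<in> carrier H" and C: "0 \<le> C"
    and step: "\<And>p n. p \<in> S\<^sub>* \<Longrightarrow> norm_by p (x (Suc n) \<ominus> x n) \<le> C * (1/16)^n"
  obtains l where "l \<in> carrier H" "\<And>p n. p \<in> S\<^sub>* \<Longrightarrow> norm_by p (x n \<ominus> l) \<le> C * (16/15) * (1/16)^n"
proof -
  have tail: "norm_by p (x (n + k) \<ominus> x n) \<le> C * (16/15) * ((1/16)^n - (1/16)^(n + k))"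
    if p: "p \<in> S\<^sub>*" for p n k
  proof (induction k)
    case 0
    show ?case using x[of n] p by (simp add: a_minus_def M.r_neg gram_seminorm_def gram_simps
          cstar_seminormed.zero[OF cstar_seminormed_of_cont])
  next
    case (Suc k)
    have "norm_by p (x (n + Suc k) \<ominus> x n) \<le> norm_by p (x (Suc (n + k)) \<ominus> x (n + k)) + norm_by p (x (n + k) \<ominus> x n)"
      using gram_seminorm_triangle_diff[OF p x[of "Suc (n + k)"] x[of "n + k"] x[of n]] by simp
    also have "\<dots> \<le> C * (1/16)^(n + k) + C * (16/15) * ((1/16)^n - (1/16)^(n + k))"
      by (intro add_mono step[OF p] Suc)
    also have "\<dots> = C * (16/15) * ((1/16)^n - (1/16)^(n + Suc k))"
      by (simp add: algebra_simps)
    finally show ?case .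
  qed
  have tail': "norm_by p (x m \<ominus> x n) \<le> C * (16/15) * (1/16)^n" if p: "p \<in> S\<^sub>*" and "n \<le> m" for p n m
  proof -
    have "norm_by p (x m \<ominus> x n) \<le> C * (16/15) * ((1/16)^n - (1/16)^m)"
      using tail[OF p, of n "m - n"] \<open>n \<le> m\<close> by simp
    also have "\<dots> \<le> C * (16/15) * (1/16)^n" using C by (intro mult_left_mono) simp_all
    finally show ?thesis .
  qed
  define F where "F = filtermap x sequentially"
  have "F \<noteq> bot" by (simp add: F_def filtermap_bot_iff)
  moreover have "F \<le> principal (carrier H)"
    using x by (simp add: F_def le_principal eventually_filtermap)
  moreover have "F \<times>\<^sub>F F \<le> gram_uniformity H"
    unfolding gram_uniformity_def
  proof (intro INF_greatest, simp only: le_principal)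
    fix p :: "'a \<Rightarrow> real" and e :: real assume p: "p \<in> S\<^sub>*" and "e \<in> {0<..}"
    then obtain N where N: "(1/16)^N < e / (2 * (C * (16/15) + 1))"
      using real_arch_pow_inv[of "e / (2 * (C * (16/15) + 1))" "1/16"] C by auto
    have pos: "0 < C * (16/15) + 1" using C by simp
    have N': "2 * (C * (16/15) * (1/16)^N) < e"
    proof -
      have "(1/16)^N * (2 * (C * (16/15) + 1)) < e"
        using N pos by (simp add: pos_less_divide_eq)
      moreover have "(1/16)^N * (2 * (C * (16/15) + 1)) = 2 * (C * (16/15) * (1/16)^N) + 2 * (1/16)^N"
        by (simp add: algebra_simps)
      moreover have "0 < (1/16::real)^N" by simp
      ultimately show ?thesis by linarith
    qed
    have "norm_by p (x m \<ominus> x n) < e" if "N \<le> m" "N \<le> n" for m n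
    proof -
      have "norm_by p (x m \<ominus> x n) \<le> norm_by p (x m \<ominus> x N) + norm_by p (x n \<ominus> x N)"
        using gram_seminorm_triangle_diff[OF p x[of m] x[of N] x[of n]] gram_seminorm_diff_commute[OF p x[of N] x[of n]] by simp
      then show ?thesis using tail'[OF p, of N m] tail'[OF p, of N n] that N' by linarith
    qed
    then have "\<forall>\<^sub>F (m, n) in sequentially \<times>\<^sub>F sequentially. norm_by p (x m \<ominus> x n) < e"
      unfolding eventually_prod_filter by (intro exI[of _ "\<lambda>n. N \<le> n"]) (auto simp: eventually_ge_at_top)
    then show "\<forall>\<^sub>F y in F \<times>\<^sub>F F. y \<in> {(x, y). norm_by p (x \<ominus> y) < e}"
      unfolding F_def prod_filtermap1 prod_filtermap2 by (simp add: eventually_filtermap case_prod_unfold)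
  qed
  ultimately obtain l where l: "l \<in> carrier H" "\<And>p. p \<in> S\<^sub>* \<Longrightarrow> ((\<lambda>y. norm_by p (y \<ominus> l)) \<longlongrightarrow> 0) F"
    using complete unfolding gram_complete_def by blast
  have "norm_by p (x n \<ominus> l) \<le> C * (16/15) * (1/16)^n" if p: "p \<in> S\<^sub>*" for p n
  proof (rule tendsto_lowerbound[where F = sequentially])
    have "(\<lambda>m. norm_by p (x m \<ominus> l)) \<longlonglongrightarrow> 0"
      using l(2)[OF p] unfolding F_def by (simp add: filterlim_filtermap)
    then show "(\<lambda>m. norm_by p (x m \<ominus> l) + C * (16/15) * (1/16)^n) \<longlonglongrightarrow> C * (16/15) * (1/16)^n"
      using tendsto_add[OF _ tendsto_const, of _ 0] by fastforce
    have "norm_by p (x n \<ominus> l) \<le> norm_by p (x m \<ominus> l) + C * (16/15) * (1/16)^n" if "n \<le> m" for m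
      using gram_seminorm_triangle_diff[OF p x[of n] x[of m] l(1)] gram_seminorm_diff_commute[OF p x[of n] x[of m]]
        tail'[OF p that] by simp
    then show "\<forall>\<^sub>F m in sequentially. norm_by p (x n \<ominus> l) \<le> norm_by p (x m \<ominus> l) + C * (16/15) * (1/16)^n"
      by (rule eventually_mono[OF eventually_ge_at_top])
  qed simp
  then show ?thesis using that l(1) by blast
qed

end

section \<open>Adjointable operators are bounded\<close>

lemma
  assumes "T \<in> linear_ops H K"
  shows linear_ops_closed: "x \<in> carrier H \<Longrightarrow> T x \<in> carrier K"
    and linear_ops_add: "x \<in> carrier H \<Longrightarrow> y \<in> carrier H \<Longrightarrow> T (x \<oplus>\<^bsub>H\<^esub> y) = T x \<oplus>\<^bsub>K\<^esub> T y"
    and linear_ops_smult: "x \<in> carrier H \<Longrightarrow> T (c \<odot>\<^bsub>H\<^esub> x) = c \<odot>\<^bsub>K\<^esub> T x"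
  using assms by (auto simp: linear_ops_def)

lemma
  assumes "is_adjoint H K T S"
  shows is_adjoint_linear: "S \<in> linear_ops K H"
    and is_adjoint_gram: "h \<in> carrier H \<Longrightarrow> k \<in> carrier K \<Longrightarrow> gram K (T h) k = gram H h (S k)"
  using assms by (auto simp: is_adjoint_def)

lemma is_adjoint_sym:
  assumes H: "hilbert_module H" and K: "hilbert_module K"
    and T: "T \<in> linear_ops H K" and S: "is_adjoint H K T S"
  shows "is_adjoint K H S T"
proof -
  interpret H: hilbert_module H by (rule H)
  interpret K: hilbert_module K by (rule K)
  have "gram H (S k) h = gram K k (T h)" if "k \<in> carrier K" "h \<in> carrier H" for k h
    using H.gram_star[of "S k" h] K.gram_star[of k "T h"] is_adjoint_gram[OF S that(2,1)]
      linear_ops_closed[OF is_adjoint_linear[OF S] that(1)] linear_ops_closed[OF T that(2)] that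
    by simp
  then show ?thesis using T by (simp add: is_adjoint_def)
qed

lemma is_adjoint_unique:
  assumes "hilbert_module H" and S: "is_adjoint H K T S" and S': "is_adjoint H K T S'"
  shows "S = S'"
proof
  interpret H: hilbert_module H by fact
  fix k
  show "S k = S' k"
  proof (cases "k \<in> carrier K")
    case True
    note closed = linear_ops_closed[OF is_adjoint_linear[OF S] True] linear_ops_closed[OF is_adjoint_linear[OF S'] True]
    show ?thesis
      by (rule H.gram_nondegenerate[OF closed])
         (simp add: True flip: is_adjoint_gram[OF S] is_adjoint_gram[OF S'])
  next
    case False
    then show ?thesis using is_adjoint_linear[OF S] is_adjoint_linear[OF S']
      by (auto simp: linear_ops_def PiE_def extensional_def)
  qed
qed

lemma adjoint_eq:
  assumes "hilbert_module H" and "is_adjoint H K T S" shows "adjoint H K T = S"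
  unfolding adjoint_def using assms by (blast intro: is_adjoint_unique)

lemma adjointable_is_adjoint:
  assumes "hilbert_module H" and "T \<in> \<L>\<^sub>* H K" shows "is_adjoint H K T (adjoint H K T)"
  using assms by (auto simp: adjointable_ops_def adjoint_eq)

text \<open>A gliding hump argument. If \<open>S\<close> is not bounded, choose vectors \<open>w\<^sub>n\<close> of norm at most one for which
  the norm \<open>N\<^sub>n\<close> of \<open>z\<^sub>n = S w\<^sub>n\<close> grows fast. Then \<open>[z\<^sub>n, g\<^sub>n]\<close> is of size \<open>N\<^sub>n\<close> for a truncation \<open>g\<^sub>n\<close> of a
  multiple of \<open>z\<^sub>n\<close>. Because the \<open>g\<^sub>n\<close> are bounded in all seminorms, a suitable series of multiples
  of them converges, to a vector \<open>l\<close> such that \<open>[z\<^sub>n, l] = [w\<^sub>n, T l]\<close> is unbounded in \<open>n\<close>. But the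
  right-hand side is bounded by the norm of \<open>T l\<close>.\<close>

lemma is_adjoint_norm_bounded:
  fixes H :: "('h, 'a::locally_cstar_algebra) hilbert_mod" and K :: "('k, 'a) hilbert_mod"
  assumes H: "hilbert_module H" and K: "hilbert_module K" and S: "is_adjoint H K T S" and p: "p \<in> S\<^sub>*"
    and T: "T \<in> linear_ops H K"
  shows "\<exists>c. \<forall>w\<in>carrier K. gram_seminorm H p (S w) \<le> c * gram_seminorm K p w"
proof (rule ccontr)
  interpret H: hilbert_module H by (rule H)
  interpret K: hilbert_module K by (rule K)
  interpret cstar_seminormed p by (rule cstar_seminormed_of_cont[OF p])
  note S_lin = is_adjoint_linear[OF S]
  assume unbounded: "\<nexists>c. \<forall>w\<in>carrier K. H.norm_by p (S w) \<le> c * K.norm_by p w"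
  have "\<exists>w\<in>carrier K. K.norm_by p w \<le> 1 \<and> H.norm_by p (S w) = c" if c: "0 < c" for c
  proof -
    obtain w where w: "w \<in> carrier K" "c * K.norm_by p w < H.norm_by p (S w)"
      using unbounded by (meson not_le)
    have pos: "0 < H.norm_by p (S w)"
      using w(2) c K.gram_seminorm_nonneg[OF p, of w] by (meson le_less_trans less_imp_le mult_nonneg_nonneg)
    define s where "s = complex_of_real (c / H.norm_by p (S w))"
    have s: "cmod s = c / H.norm_by p (S w)" using c pos unfolding s_def norm_of_real by simp
    have "K.norm_by p (s \<odot>\<^bsub>K\<^esub> w) \<le> 1"
      unfolding K.gram_seminorm_scale[OF p w(1)] s using w(2) pos by simp
    moreover have "H.norm_by p (S (s \<odot>\<^bsub>K\<^esub> w)) = c"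
      unfolding linear_ops_smult[OF S_lin w(1)] H.gram_seminorm_scale[OF p linear_ops_closed[OF S_lin w(1)]] s
      using pos by simp
    ultimately show ?thesis using w(1) by (intro bexI[of _ "s \<odot>\<^bsub>K\<^esub> w"]) simp_all
  qed
  then have "\<exists>w\<in>carrier K. K.norm_by p w \<le> 1 \<and> H.norm_by p (S w) = real (Suc n) * 16 ^ n" for n by simp
  then obtain w where w: "\<And>n. w n \<in> carrier K" "\<And>n. K.norm_by p (w n) \<le> 1"
      "\<And>n. H.norm_by p (S (w n)) = real (Suc n) * 16 ^ n"
    by metis
  define N where "N n = real (Suc n) * 16 ^ n" for n
  have N: "0 < N n" for n by (simp add: N_def)
  define z where "z n = S (w n)" for n
  have z: "z n \<in> carrier H" "H.norm_by p (z n) = N n" for n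
    unfolding z_def N_def by (rule linear_ops_closed[OF S_lin w(1)], rule w(3))
  have "\<exists>g\<in>carrier H. (\<forall>q\<in>S\<^sub>*. H.norm_by q g \<le> 3/2) \<and> N n / 4 \<le> p (gram H (z n) g)" for n
  proof -
    \<comment> \<open>Norm one half is small enough for the truncation error, at most \<open>1/32\<close>, to be harmless.\<close>
    define s where "s = complex_of_real (1 / (2 * N n))"
    have s: "cmod s = 1 / (2 * N n)" unfolding s_def norm_of_real using N[of n] by simp
    define h where "h = s \<odot>\<^bsub>H\<^esub> z n"
    have h: "h \<in> carrier H" "H.norm_by p h = 1/2"
      using N[of n] z by (simp_all add: h_def H.gram_seminorm_scale[OF p] s)
    obtain g where g: "g \<in> carrier H" "\<And>q. q \<in> S\<^sub>* \<Longrightarrow> (H.norm_by q g)\<^sup>2 \<le> 2"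
      "\<And>p. p \<in> S\<^sub>* \<Longrightarrow> (H.norm_by p (h \<ominus>\<^bsub>H\<^esub> g))\<^sup>2 \<le> (H.norm_by p h)^10"
      using H.truncation[OF h(1)] by blast
    have "H.norm_by q g \<le> 3/2" if "q \<in> S\<^sub>*" for q
      by (rule power2_le_imp_le[OF order_trans[OF g(2)[OF that]]]) (simp_all add: power2_eq_square)
    moreover have "N n / 4 \<le> p (gram H (z n) g)"
    proof -
      have "(H.norm_by p (h \<ominus>\<^bsub>H\<^esub> g))\<^sup>2 \<le> (1/32)\<^sup>2"
        using g(3)[OF p] unfolding h(2) by (simp add: power_divide)
      then have close: "H.norm_by p (h \<ominus>\<^bsub>H\<^esub> g) \<le> 1/32" by (rule power2_le_imp_le) simp
      have "p (gram H (z n) h) = N n / 2"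
      proof -
        have "p (gram H (z n) h) = 1 / (2 * N n) * (H.norm_by p (z n))\<^sup>2"
          using z(1)[of n] by (simp add: h_def H.gram_simps H.gram_seminorm_square[OF p] scale s)
        then show ?thesis using N[of n] by (simp add: z(2) power2_eq_square)
      qed
      moreover have "p (gram H (z n) (h \<ominus>\<^bsub>H\<^esub> g)) \<le> N n * (1/32)"
      proof (rule order_trans)
        show "p (gram H (z n) (h \<ominus>\<^bsub>H\<^esub> g)) \<le> H.norm_by p (z n) * H.norm_by p (h \<ominus>\<^bsub>H\<^esub> g)"
          by (rule H.cauchy_schwarz[OF p z(1)]) (use h(1) g(1) in simp)
        show "H.norm_by p (z n) * H.norm_by p (h \<ominus>\<^bsub>H\<^esub> g) \<le> N n * (1/32)"
          unfolding z(2) by (rule mult_left_mono[OF close less_imp_le[OF N]])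
      qed
      moreover have "gram H (z n) h = gram H (z n) (h \<ominus>\<^bsub>H\<^esub> g) + gram H (z n) g"
        using h(1) g(1) z(1)[of n] by (simp add: H.gram_simps)
      ultimately show ?thesis using triangle[of "gram H (z n) (h \<ominus>\<^bsub>H\<^esub> g)" "gram H (z n) g"] N[of n] by simp
    qed
    ultimately show ?thesis using g(1) by blast
  qed
  then obtain g where g: "\<And>n. g n \<in> carrier H" "\<And>n q. q \<in> S\<^sub>* \<Longrightarrow> H.norm_by q (g n) \<le> 3/2"
      "\<And>n. N n / 4 \<le> p (gram H (z n) (g n))"
    by metis
  define r where "r n = (1/16::real)^n" for n
  have r: "0 < r n" for n by (simp add: r_def)
  \<comment> \<open>With \<open>r\<^sub>n = (1/16)\<^sup>n\<close>, the total of all steps after the \<open>n\<close>-th is at most \<open>r\<^sub>n / 10\<close>.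
    Of \<open>u\<close> and \<open>u + r\<^sub>n g\<^sub>n\<close> at least one pairs with \<open>z\<^sub>n\<close> to half of the size of \<open>[z\<^sub>n, r\<^sub>n g\<^sub>n]\<close>.
    The later steps change the value by at most \<open>r\<^sub>n N\<^sub>n / 10\<close>, so \<open>r\<^sub>n N\<^sub>n / 40\<close> remains.\<close>
  define x where "x = rec_nat \<zero>\<^bsub>H\<^esub> (\<lambda>n u. if r n * N n / 8 \<le> p (gram H (z n) u) then u
      else u \<oplus>\<^bsub>H\<^esub> complex_of_real (r n) \<odot>\<^bsub>H\<^esub> g n)"
  have x_Suc: "x (Suc n) = (if r n * N n / 8 \<le> p (gram H (z n) (x n)) then x n
      else x n \<oplus>\<^bsub>H\<^esub> complex_of_real (r n) \<odot>\<^bsub>H\<^esub> g n)" for n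
    by (simp add: x_def)
  have x: "x n \<in> carrier H" for n
    by (induction n) (simp_all add: x_def g(1))
  have big: "r n * N n / 8 \<le> p (gram H (z n) (x (Suc n)))" for n
  proof (cases "r n * N n / 8 \<le> p (gram H (z n) (x n))")
    case False
    have "r n * (N n / 4) \<le> r n * p (gram H (z n) (g n))"
      using r[of n] by (intro mult_left_mono g(3)) simp
    also have "\<dots> = p (gram H (z n) (complex_of_real (r n) \<odot>\<^bsub>H\<^esub> g n))"
      using r[of n] g(1)[of n] z(1)[of n] by (simp add: H.gram_simps scale)
    also have "\<dots> = p (gram H (z n) (x (Suc n)) - gram H (z n) (x n))"
      using False g(1)[of n] z(1)[of n] x[of n] by (simp add: x_Suc H.gram_simps)
    also have "\<dots> \<le> p (gram H (z n) (x (Suc n))) + p (gram H (z n) (x n))"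
      by (rule triangle_diff)
    finally show ?thesis using False by linarith
  qed (simp add: x_Suc)
  have "H.norm_by q (x (Suc n) \<ominus>\<^bsub>H\<^esub> x n) \<le> 3/2 * (1/16)^n" if q: "q \<in> S\<^sub>*" for q n
  proof (cases "r n * N n / 8 \<le> p (gram H (z n) (x n))")
    case True
    interpret q: cstar_seminormed q by (rule cstar_seminormed_of_cont[OF q])
    show ?thesis using True x[of n]
      by (simp add: x_Suc a_minus_def H.M.r_neg gram_seminorm_def H.gram_simps)
  next
    case False
    have "x (Suc n) \<ominus>\<^bsub>H\<^esub> x n = complex_of_real (r n) \<odot>\<^bsub>H\<^esub> g n"
      using False x[of n] g(1)[of n] by (simp add: x_Suc a_minus_def H.M.a_ac H.M.r_neg2)
    then have "H.norm_by q (x (Suc n) \<ominus>\<^bsub>H\<^esub> x n) = r n * H.norm_by q (g n)"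
      using r[of n] by (simp add: H.gram_seminorm_scale[OF q g(1)])
    also have "\<dots> \<le> r n * (3/2)" by (rule mult_left_mono[OF g(2)[OF q] less_imp_le[OF r]])
    finally show ?thesis by (simp add: r_def)
  qed
  then obtain l where l: "l \<in> carrier H"
      "\<And>p n. p \<in> S\<^sub>* \<Longrightarrow> H.norm_by p (x n \<ominus>\<^bsub>H\<^esub> l) \<le> 3/2 * (16/15) * (1/16)^n"
    using H.geometric_limit[of x "3/2"] x by (metis divide_nonneg_pos zero_le_numeral zero_less_numeral)
  have lower: "real (Suc n) / 40 \<le> K.norm_by p (T l)" for n
  proof -
    have rN: "r n * N n = real (Suc n)" by (simp add: r_def N_def power_divide)
    have "p (gram H (z n) (x (Suc n) \<ominus>\<^bsub>H\<^esub> l)) \<le> N n * (3/2 * (16/15) * (1/16)^Suc n)"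
      unfolding z(2)[of n, symmetric] using x[of "Suc n"] l(1) p
      by (intro order_trans[OF H.cauchy_schwarz[OF p z(1)] mult_left_mono[OF l(2)]]) simp_all
    also have "\<dots> = (r n * N n) / 10" by (simp add: r_def)
    finally have 1: "p (gram H (z n) (x (Suc n) \<ominus>\<^bsub>H\<^esub> l)) \<le> real (Suc n) / 10" unfolding rN .
    have 2: "real (Suc n) / 8 \<le> p (gram H (z n) (x (Suc n)))" using big[of n] unfolding rN .
    have "gram H (z n) (x (Suc n)) = gram H (z n) (x (Suc n) \<ominus>\<^bsub>H\<^esub> l) + gram H (z n) l"
      using z(1)[of n] x[of "Suc n"] l(1) by (simp add: H.gram_simps)
    then have "real (Suc n) / 40 \<le> p (gram H (z n) l)"
      using triangle[of "gram H (z n) (x (Suc n) \<ominus>\<^bsub>H\<^esub> l)" "gram H (z n) l"] 1 2 by simp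
    also have "gram H (z n) l = gram K (w n) (T l)"
      unfolding z_def by (rule is_adjoint_gram[OF is_adjoint_sym[OF H K T S] w(1) l(1)])
    also have "p \<dots> \<le> K.norm_by p (w n) * K.norm_by p (T l)"
      by (rule K.cauchy_schwarz[OF p w(1) linear_ops_closed[OF T l(1)]])
    also have "\<dots> \<le> 1 * K.norm_by p (T l)" by (intro mult_right_mono w(2)) (simp add: p)
    finally show ?thesis by simp
  qed
  obtain n where "K.norm_by p (T l) * 40 < real n" using reals_Archimedean2 by blast
  then show False using lower[of n] by simp
qed

theorem adjointable_bounded:
  assumes H: "hilbert_module H" and K: "hilbert_module K" and T: "T \<in> \<L>\<^sub>* H K" and p: "p \<in> S\<^sub>*"
  shows "\<exists>c\<ge>0. \<forall>x\<in>carrier H. gram_seminorm K p (T x) \<le> c * gram_seminorm H p x"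
proof -
  interpret H: hilbert_module H by (rule H)
  have lin: "T \<in> linear_ops H K" using T by (simp add: adjointable_ops_def)
  note A = adjointable_is_adjoint[OF H T]
  obtain c where c: "\<And>x. x \<in> carrier H \<Longrightarrow> gram_seminorm K p (T x) \<le> c * gram_seminorm H p x"
    using is_adjoint_norm_bounded[OF K H is_adjoint_sym[OF H K lin A] p is_adjoint_linear[OF A]] by blast
  have "gram_seminorm K p (T x) \<le> \<bar>c\<bar> * gram_seminorm H p x" if "x \<in> carrier H" for x
    using p by (intro order_trans[OF c[OF that] mult_right_mono]) simp_all
  then show ?thesis by (intro exI[of _ "\<bar>c\<bar>"]) simp
qed

lemma adjointable_ract:
  assumes H: "hilbert_module H" and K: "hilbert_module K" and T: "T \<in> \<L>\<^sub>* H K" and x: "x \<in> carrier H"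
  shows "T (x \<cdot>\<^bsub>H\<^esub> a) = T x \<cdot>\<^bsub>K\<^esub> a"
proof -
  interpret H: hilbert_module H by (rule H)
  interpret K: hilbert_module K by (rule K)
  have lin: "T \<in> linear_ops H K" using T by (simp add: adjointable_ops_def)
  note A = is_adjoint_sym[OF H K lin adjointable_is_adjoint[OF H T]]
  note B = linear_ops_closed[OF is_adjoint_linear[OF adjointable_is_adjoint[OF H T]]]
  show ?thesis
  proof (rule K.gram_nondegenerate)
    fix z assume z: "z \<in> carrier K"
    show "gram K z (T (x \<cdot>\<^bsub>H\<^esub> a)) = gram K z (T x \<cdot>\<^bsub>K\<^esub> a)"
      using x z linear_ops_closed[OF lin x] B[OF z] is_adjoint_gram[OF A z x] is_adjoint_gram[OF A z H.ract_closed[OF x]]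
      by (simp add: H.gram_ract K.gram_ract)
  qed (use x linear_ops_closed[OF lin] in simp_all)
qed

section \<open>From linearisations to kernels, from reproducing kernel modules to linearisations\<close>

context hilbert_module
begin

lemma gram_finsum_right:
  assumes "finite I" "x \<in> carrier H" "\<And>i. i \<in> I \<Longrightarrow> f i \<in> carrier H"
  shows "gram H x (finsum H f I) = (\<Sum>i\<in>I. gram H x (f i))"
  using assms(1,3)
proof (induction I)
  case (insert i I)
  then have "f \<in> I \<rightarrow> carrier H" "f i \<in> carrier H" by auto
  then show ?case using insert assms(2) by (simp add: M.finsum_insert gram_add_right)
qed (simp add: assms(2) gram_zero_right)

lemma gram_finsum_left:
  assumes "finite I" "x \<in> carrier H" "\<And>i. i \<in> I \<Longrightarrow> f i \<in> carrier H"
  shows "gram H (finsum H f I) x = (\<Sum>i\<in>I. gram H (f i) x)"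
  using assms(1,3)
proof (induction I)
  case (insert i I)
  then have "f \<in> I \<rightarrow> carrier H" "f i \<in> carrier H" by auto
  then show ?case using insert assms(2) by (simp add: M.finsum_insert gram_add_left)
qed (simp add: assms(2) gram_zero_left)

lemma gram_finsum:
  assumes "finite I" "\<And>i. i \<in> I \<Longrightarrow> f i \<in> carrier H"
  shows "(\<Sum>i\<in>I. \<Sum>j\<in>I. gram H (f j) (f i)) = gram H (finsum H f I) (finsum H f I)"
proof -
  have "finsum H f I \<in> carrier H" using assms(2) by (simp add: Pi_def)
  then show ?thesis using assms by (simp add: gram_finsum_left gram_finsum_right)
qed

end

lemma linear_ops_finsum:
  assumes H: "hilbert_module H" and K: "hilbert_module K" and T: "T \<in> linear_ops H K"
    and "finite I" "\<And>i. i \<in> I \<Longrightarrow> f i \<in> carrier H"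
  shows "T (finsum H f I) = finsum K (\<lambda>i. T (f i)) I"
proof -
  interpret H: hilbert_module H by (rule H)
  interpret K: hilbert_module K by (rule K)
  have T0: "T \<zero>\<^bsub>H\<^esub> = \<zero>\<^bsub>K\<^esub>"
    using linear_ops_add[OF T, of "\<zero>\<^bsub>H\<^esub>" "\<zero>\<^bsub>H\<^esub>"] linear_ops_closed[OF T, of "\<zero>\<^bsub>H\<^esub>"]
    by (metis H.M.l_zero H.M.zero_closed K.M.add.r_cancel_one')
  from assms(4,5) show ?thesis
  proof (induction I)
    case (insert i I)
    then have "f \<in> I \<rightarrow> carrier H" "f i \<in> carrier H" "(\<lambda>i. T (f i)) \<in> I \<rightarrow> carrier K" "T (f i) \<in> carrier K"
      by (auto intro: linear_ops_closed[OF T])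
    then show ?case using insert
      by (simp add: H.M.finsum_insert K.M.finsum_insert linear_ops_add[OF T])
  qed (simp add: T0)
qed

lemma star_representation_is_adjoint:
  assumes K: "hilbert_module K" and \<pi>: "star_representation K \<pi>"
  shows "is_adjoint K K (\<pi> \<xi>) (\<pi> (star \<xi>))"
  using adjointable_is_adjoint[OF K, of "\<pi> \<xi>"] \<pi> by (simp add: star_representation_def)

lemma linearisation_gram:
  assumes H: "hilbert_module H" and lin: "linearisation H k K V" and h: "h \<in> carrier H" and g: "g \<in> carrier H"
  shows "gram H (k x y h) g = gram K (V y h) (V x g)" and "k x y h \<in> carrier H"
proof -
  have K: "hilbert_module K" and V: "V x \<in> \<L>\<^sub>* H K" "V y \<in> \<L>\<^sub>* H K"
    and k: "k x y = compose (carrier H) (adjoint H K (V x)) (V y)"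
    using lin by (auto simp: linearisation_def)
  note A = adjointable_is_adjoint[OF H V(1)]
  have Vx: "V x \<in> linear_ops H K" and Vy: "V y h \<in> carrier K"
    using V h by (auto simp: adjointable_ops_def intro: linear_ops_closed)
  show "gram H (k x y h) g = gram K (V y h) (V x g)"
    using is_adjoint_gram[OF is_adjoint_sym[OF H K Vx A] Vy g] h by (simp add: k compose_def)
  show "k x y h \<in> carrier H"
    using linear_ops_closed[OF is_adjoint_linear[OF A] Vy] h by (simp add: k compose_def)
qed

text \<open>Only the bound on translations is not formal. It is the boundedness of \<open>\<pi>(\<xi>)\<close>, and it even holds
  with \<open>q = p\<close>.\<close>

theorem invariant_linearisation_necessary:
  assumes H: "hilbert_module H" and inv: "invariant_linearisation act H k K \<pi> V"
  shows "psd_kernel H k" and "invariant_kernel act k" and "bounded_translations act H k"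
proof -
  have lin: "linearisation H k K V" and \<pi>: "star_representation K \<pi>"
    and V_act: "V (act \<xi> x) = compose (carrier H) (\<pi> \<xi>) (V x)" for \<xi> x
    using inv by (auto simp: invariant_linearisation_def)
  have K: "hilbert_module K" and V: "V x \<in> linear_ops H K" for x
    using lin by (auto simp: linearisation_def adjointable_ops_def)
  interpret H: hilbert_module H by (rule H)
  interpret K: hilbert_module K by (rule K)
  note gram_k = linearisation_gram(1)[OF H lin] and k_closed = linearisation_gram(2)[OF H lin]
  note V_closed = linear_ops_closed[OF V]
  have sum_eq: "(\<Sum>i=1..n. \<Sum>j=1..n. gram H (k (x i) (x j) (h j)) (h i))
      = gram K (finsum K (\<lambda>j. V (x j) (h j)) {1..n}) (finsum K (\<lambda>j. V (x j) (h j)) {1..n})"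
    if "\<forall>i\<in>{1..n}. h i \<in> carrier H" for n :: nat and x h
    using that by (subst K.gram_finsum[symmetric]) (auto intro!: sum.cong gram_k V_closed)
  have sum_closed: "finsum K (\<lambda>j. V (x j) (h j)) {1..n} \<in> carrier K"
    if "\<forall>i\<in>{1..n}. h i \<in> carrier H" for n :: nat and x h
    using that by (intro K.M.finsum_closed) (auto intro: V_closed)
  show "psd_kernel H k"
    unfolding psd_kernel_def
  proof (intro allI impI)
    fix n :: nat and x h assume h: "\<forall>i\<in>{1..n}. h i \<in> carrier H"
    show "nonneg (\<Sum>i=1..n. \<Sum>j=1..n. gram H (k (x i) (x j) (h j)) (h i))"
      unfolding sum_eq[OF h] by (rule K.gram_nonneg[OF sum_closed[OF h]])
  qed
  note \<pi>_adj = star_representation_is_adjoint[OF K \<pi>]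
  have \<pi>_lin: "\<pi> \<xi> \<in> linear_ops K K" for \<xi>
    using \<pi> by (auto simp: star_representation_def adjointable_ops_def)
  show "invariant_kernel act k"
    unfolding invariant_kernel_def
  proof (intro allI ext)
    fix x y \<xi> h
    show "k y (act \<xi> x) h = k (act (star \<xi>) y) x h"
    proof (cases "h \<in> carrier H")
      case True
      show ?thesis
      proof (rule H.gram_nondegenerate)
        fix g assume g: "g \<in> carrier H"
        have "gram H (k y (act \<xi> x) h) g = gram H (k (act (star \<xi>) y) x h) g"
          using True g by (simp add: gram_k V_act compose_def is_adjoint_gram[OF \<pi>_adj] V_closed)
        then show "gram H g (k y (act \<xi> x) h) = gram H g (k (act (star \<xi>) y) x h)"
          using True g k_closed by (metis H.gram_star)
      qed (use True k_closed in blast)+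
    next
      case False
      then show ?thesis using lin by (simp add: linearisation_def compose_def)
    qed
  qed
  show "bounded_translations act H k"
    unfolding bounded_translations_def
  proof (intro allI ballI)
    fix \<xi> and p :: "'b \<Rightarrow> real" assume p: "p \<in> S\<^sub>*"
    have "\<pi> \<xi> \<in> \<L>\<^sub>* K K" using \<pi> by (simp add: star_representation_def)
    then obtain c where c: "0 \<le> c" "\<And>u. u \<in> carrier K \<Longrightarrow> K.norm_by p (\<pi> \<xi> u) \<le> c * K.norm_by p u"
      using adjointable_bounded[OF K K _ p] by blast
    have "p (\<Sum>i=1..n. \<Sum>j=1..n. gram H (k (act \<xi> (x i)) (act \<xi> (x j)) (h j)) (h i))
        \<le> c\<^sup>2 * p (\<Sum>i=1..n. \<Sum>j=1..n. gram H (k (x i) (x j) (h j)) (h i))"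
      if h: "\<forall>i\<in>{1..n}. h i \<in> carrier H" for n :: nat and x h
    proof -
      define u where "u = finsum K (\<lambda>j. V (x j) (h j)) {1..n}"
      have u: "u \<in> carrier K" unfolding u_def by (rule sum_closed[OF h])
      have "finsum K (\<lambda>j. V (act \<xi> (x j)) (h j)) {1..n} = finsum K (\<lambda>j. \<pi> \<xi> (V (x j) (h j))) {1..n}"
        using h by (intro K.M.finsum_cong') (auto simp: V_act compose_def intro!: linear_ops_closed[OF \<pi>_lin] V_closed)
      also have "\<dots> = \<pi> \<xi> u"
        unfolding u_def using h by (intro linear_ops_finsum[symmetric, OF K K \<pi>_lin]) (auto intro: V_closed)
      finally have "p (\<Sum>i=1..n. \<Sum>j=1..n. gram H (k (act \<xi> (x i)) (act \<xi> (x j)) (h j)) (h i)) = (K.norm_by p (\<pi> \<xi> u))\<^sup>2"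
        using sum_eq[OF h, of "\<lambda>i. act \<xi> (x i)"] p by (simp add: K.gram_seminorm_square)
      also have "\<dots> \<le> (c * K.norm_by p u)\<^sup>2" by (rule power_mono[OF c(2)[OF u]]) (simp add: p)
      also have "\<dots> = c\<^sup>2 * p (\<Sum>i=1..n. \<Sum>j=1..n. gram H (k (x i) (x j) (h j)) (h i))"
        unfolding sum_eq[OF h] u_def[symmetric] power_mult_distrib K.gram_seminorm_square[OF p] ..
      finally show ?thesis .
    qed
    then show "\<exists>q\<in>S\<^sub>*. \<exists>c\<ge>0. \<forall>(n::nat) h x. (\<forall>i\<in>{1..n}. h i \<in> carrier H) \<longrightarrow>
        p (\<Sum>i=1..n. \<Sum>j=1..n. gram H (k (act \<xi> (x i)) (act \<xi> (x j)) (h j)) (h i))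
        \<le> c * q (\<Sum>i=1..n. \<Sum>j=1..n. gram H (k (x i) (x j) (h j)) (h i))"
      using p by (intro bexI[of _ p] exI[of _ "c\<^sup>2"]) simp_all
  qed
qed

text \<open>The operator \<open>h \<mapsto> k\<^sub>x h\<close> is adjointable by the reproducing property; its adjoint is the
  evaluation at \<open>x\<close>.\<close>

theorem reproducing_kernel_module_linearises:
  assumes H: "hilbert_module H" and k: "adjointable_kernel H k"
    and R: "reproducing_kernel_module H k R" and \<rho>: "star_representation R \<rho>"
    and \<rho>_k: "\<And>\<xi> x h. h \<in> carrier H \<Longrightarrow> \<rho> \<xi> (kernel_section k x h) = kernel_section k (act \<xi> x) h"
  shows "invariant_linearisation act H k R \<rho> (\<lambda>x. \<lambda>h\<in>carrier H. kernel_section k x h)"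
proof -
  let ?V = "\<lambda>x. \<lambda>h\<in>carrier H. kernel_section k x h"
  have HR: "hilbert_module R" and sub: "function_submodule H R"
    and section_closed: "\<And>x h. h \<in> carrier H \<Longrightarrow> kernel_section k x h \<in> carrier R"
    and repr: "\<And>f x h. f \<in> carrier R \<Longrightarrow> h \<in> carrier H \<Longrightarrow> gram H (f x) h = gram R f (kernel_section k x h)"
    using R by (auto simp: reproducing_kernel_module_def)
  interpret H: hilbert_module H by (rule H)
  interpret R: hilbert_module R by (rule HR)
  have k_lin: "k x y \<in> linear_ops H H" for x y
    using k by (simp add: adjointable_kernel_def adjointable_ops_def)
  have val: "f x \<in> carrier H" if "f \<in> carrier R" for f x
    using sub that by (auto simp: function_submodule_def)
  have pointwise: "(f \<oplus>\<^bsub>R\<^esub> g) x = f x \<oplus>\<^bsub>H\<^esub> g x" "(c \<odot>\<^bsub>R\<^esub> f) x = c \<odot>\<^bsub>H\<^esub> f x"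
    if "f \<in> carrier R" "g \<in> carrier R" for f g c x
    using sub that by (simp_all add: function_submodule_def)
  have V_lin: "?V x \<in> linear_ops H R" for x
    using sub section_closed unfolding linear_ops_def function_submodule_def
    by (auto simp: kernel_section_def linear_ops_add[OF k_lin] linear_ops_smult[OF k_lin])
  have adj: "is_adjoint H R (?V x) (\<lambda>f\<in>carrier R. f x)" for x
    unfolding is_adjoint_def
  proof (intro conjI ballI)
    show "(\<lambda>f\<in>carrier R. f x) \<in> linear_ops R H"
      unfolding linear_ops_def using val by (auto simp: pointwise)
    fix h f assume h: "h \<in> carrier H" and f: "f \<in> carrier R"
    then show "gram R (?V x h) f = gram H h ((\<lambda>f\<in>carrier R. f x) f)"
      using repr[OF f h] R.gram_star[OF section_closed[OF h] f] H.gram_star[OF h val[OF f]] by simp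
  qed
  have "linearisation H k R ?V"
    unfolding linearisation_def
  proof (intro conjI allI HR)
    show "?V x \<in> \<L>\<^sub>* H R" for x using V_lin adj by (auto simp: adjointable_ops_def)
    show "k x y = compose (carrier H) (adjoint H R (?V x)) (?V y)" for x y
    proof
      fix h
      show "k x y h = compose (carrier H) (adjoint H R (?V x)) (?V y) h"
        unfolding adjoint_eq[OF H adj] using section_closed[of h y] k_lin[of x y]
        by (auto simp: compose_def kernel_section_def linear_ops_def PiE_def extensional_def)
    qed
  qed
  moreover have "?V (act \<xi> x) = compose (carrier H) (\<rho> \<xi>) (?V x)" for \<xi> x
    by (auto simp: compose_def \<rho>_k)
  ultimately show ?thesis using \<rho> by (simp add: invariant_linearisation_def)
qed

section \<open>Finite sums of kernel sections\<close>

locale psd_kernel_module = hilbert_module H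
  for H :: "('h, 'a::locally_cstar_algebra) hilbert_mod" (structure) +
  fixes k :: "'x \<Rightarrow> 'x \<Rightarrow> 'h \<Rightarrow> 'h"
  assumes adjointable_kernel: "adjointable_kernel H k"
    and psd_kernel: "psd_kernel H k"
begin

text \<open>A list of pairs \<open>(x, h)\<close> stands for the formal sum of the symbols \<open>k\<^sub>x h\<close>. Formal sums are kept apart
  from the functions they define, since different formal sums may define the same function.\<close>

definition combs :: "('x \<times> 'h) list set" where
  "combs = {us. \<forall>(x, h)\<in>set us. h \<in> carrier H}"

text \<open>The gramian of \<open>f\<close> with a formal sum that the reproducing property dictates; it makes sense for
  every function \<open>f\<close>.\<close>

definition pairing :: "('x \<Rightarrow> 'h) \<Rightarrow> ('x \<times> 'h) list \<Rightarrow> 'a" where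
  "pairing f us = (\<Sum>(x, h)\<leftarrow>us. gram H (f x) h)"

definition comb_sections :: "('x \<times> 'h) list \<Rightarrow> 'x \<Rightarrow> 'h" where
  "comb_sections us y = foldr (\<lambda>(x, h) s. k y x h \<oplus> s) us \<zero>"

definition scale_comb :: "complex \<Rightarrow> ('x \<times> 'h) list \<Rightarrow> ('x \<times> 'h) list" where
  "scale_comb c us = map (\<lambda>(x, h). (x, c \<odot>\<^bsub>H\<^esub> h)) us"

definition ract_comb :: "'a \<Rightarrow> ('x \<times> 'h) list \<Rightarrow> ('x \<times> 'h) list" where
  "ract_comb a us = map (\<lambda>(x, h). (x, h \<cdot> a)) us"

abbreviation diff_comb :: "('x \<times> 'h) list \<Rightarrow> ('x \<times> 'h) list \<Rightarrow> ('x \<times> 'h) list" where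
  "diff_comb us vs \<equiv> us @ scale_comb (-1) vs"

lemma kernel_linear: "k x y \<in> linear_ops H H"
  using adjointable_kernel by (simp add: adjointable_kernel_def adjointable_ops_def)

lemma kernel_closed [simp]: "h \<in> carrier H \<Longrightarrow> k x y h \<in> carrier H"
  by (rule linear_ops_closed[OF kernel_linear])

lemma kernel_ract: "h \<in> carrier H \<Longrightarrow> k x y (h \<cdot> a) = k x y h \<cdot> a"
  using adjointable_kernel hilbert_module_axioms
  by (intro adjointable_ract) (simp_all add: adjointable_kernel_def)

lemma combs_simps [simp]:
  "[] \<in> combs" "(x, h) # us \<in> combs \<longleftrightarrow> h \<in> carrier H \<and> us \<in> combs"
  "us @ vs \<in> combs \<longleftrightarrow> us \<in> combs \<and> vs \<in> combs"
  by (auto simp: combs_def)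

lemma scale_comb_closed [simp]: "us \<in> combs \<Longrightarrow> scale_comb c us \<in> combs"
  and ract_comb_closed [simp]: "us \<in> combs \<Longrightarrow> ract_comb a us \<in> combs"
  by (force simp: combs_def scale_comb_def ract_comb_def)+

lemma pairing_simps [simp]:
  "pairing f [] = 0" "pairing f ((x, h) # us) = gram H (f x) h + pairing f us"
  "pairing f (us @ vs) = pairing f us + pairing f vs"
  by (simp_all add: pairing_def)

lemma comb_sections_simps [simp]:
  "comb_sections [] y = \<zero>" "comb_sections ((x, h) # us) y = k y x h \<oplus> comb_sections us y"
  by (simp_all add: comb_sections_def)

lemma combs_induct [consumes 1, case_names Nil Cons]:
  assumes "us \<in> combs" "P []" "\<And>x h us. h \<in> carrier H \<Longrightarrow> us \<in> combs \<Longrightarrow> P us \<Longrightarrow> P ((x, h) # us)"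
  shows "P us"
  using assms(1) by (induction us) (auto intro: assms)

lemma comb_sections_closed [simp]: "us \<in> combs \<Longrightarrow> comb_sections us y \<in> carrier H"
  by (induction rule: combs_induct) simp_all

lemma comb_sections_append:
  "us \<in> combs \<Longrightarrow> vs \<in> combs \<Longrightarrow> comb_sections (us @ vs) y = comb_sections us y \<oplus> comb_sections vs y"
  by (induction rule: combs_induct) (simp_all add: M.a_assoc)

lemma comb_sections_scale: "us \<in> combs \<Longrightarrow> comb_sections (scale_comb c us) y = c \<odot>\<^bsub>H\<^esub> comb_sections us y"
proof (induction rule: combs_induct)
  case Nil
  then show ?case using smult_r_null[of c] by (simp add: scale_comb_def complex_ring_simps)
next
  case (Cons x h us)
  then show ?case using smult_r_distr[of c "k y x h" "comb_sections us y"]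
    by (simp add: scale_comb_def complex_ring_simps linear_ops_smult[OF kernel_linear])
qed

lemma zero_ract: "\<zero> \<cdot> a = \<zero>"
  using ract_add_left[of \<zero> \<zero> a] by (metis M.add.r_cancel_one' M.l_zero M.zero_closed ract_closed)

lemma comb_sections_ract: "us \<in> combs \<Longrightarrow> comb_sections (ract_comb a us) y = comb_sections us y \<cdot> a"
  by (induction rule: combs_induct)
     (simp_all add: ract_comb_def zero_ract kernel_ract ract_add_left)

lemma pairing_scale:
  "us \<in> combs \<Longrightarrow> (\<And>x. f x \<in> carrier H) \<Longrightarrow> pairing f (scale_comb c us) = c *\<^sub>C pairing f us"
  by (induction rule: combs_induct)
     (simp_all add: scale_comb_def gram_smult_right scaleC_add_right)

lemma pairing_ract:
  "us \<in> combs \<Longrightarrow> (\<And>x. f x \<in> carrier H) \<Longrightarrow> pairing f (ract_comb a us) = pairing f us * a"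
  by (induction rule: combs_induct)
     (simp_all add: ract_comb_def gram_ract distrib_right)

lemma pairing_add_fun:
  "us \<in> combs \<Longrightarrow> (\<And>x. f x \<in> carrier H) \<Longrightarrow> (\<And>x. g x \<in> carrier H) \<Longrightarrow>
    pairing (\<lambda>x. f x \<oplus> g x) us = pairing f us + pairing g us"
  by (induction rule: combs_induct) (simp_all add: gram_add_left algebra_simps)

lemma pairing_diff_fun:
  "us \<in> combs \<Longrightarrow> (\<And>x. f x \<in> carrier H) \<Longrightarrow> (\<And>x. g x \<in> carrier H) \<Longrightarrow>
    pairing (\<lambda>x. f x \<ominus> g x) us = pairing f us - pairing g us"
  by (induction rule: combs_induct) (simp_all add: gram_diff_left algebra_simps)

lemma pairing_scale_fun:
  "us \<in> combs \<Longrightarrow> (\<And>x. f x \<in> carrier H) \<Longrightarrow> pairing (\<lambda>x. c \<odot>\<^bsub>H\<^esub> f x) us = cnj c *\<^sub>C pairing f us"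
  by (induction rule: combs_induct) (simp_all add: gram_smult_left scaleC_add_right)

lemma pairing_ract_fun:
  "us \<in> combs \<Longrightarrow> (\<And>x. f x \<in> carrier H) \<Longrightarrow> pairing (\<lambda>x. f x \<cdot> a) us = star a * pairing f us"
  by (induction rule: combs_induct) (simp_all add: gram_ract_left distrib_left)

lemma pairing_zero_fun: "us \<in> combs \<Longrightarrow> pairing (\<lambda>x. \<zero>) us = 0"
  by (induction rule: combs_induct) (simp_all add: gram_zero_left)

lemma pairing_sections_append_left:
  assumes "us \<in> combs" "vs \<in> combs" "ws \<in> combs"
  shows "pairing (comb_sections (us @ vs)) ws = pairing (comb_sections us) ws + pairing (comb_sections vs) ws"
proof -
  have "comb_sections (us @ vs) = (\<lambda>y. comb_sections us y \<oplus> comb_sections vs y)"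
    using assms by (intro ext comb_sections_append)
  then show ?thesis using assms by (simp add: pairing_add_fun)
qed

lemma pairing_sections_scale_left:
  assumes "us \<in> combs" "ws \<in> combs"
  shows "pairing (comb_sections (scale_comb c us)) ws = cnj c *\<^sub>C pairing (comb_sections us) ws"
proof -
  have "comb_sections (scale_comb c us) = (\<lambda>y. c \<odot>\<^bsub>H\<^esub> comb_sections us y)"
    using assms by (intro ext comb_sections_scale)
  then show ?thesis using assms by (simp add: pairing_scale_fun)
qed

lemma pairing_sections_ract_left:
  assumes "us \<in> combs" "ws \<in> combs"
  shows "pairing (comb_sections (ract_comb a us)) ws = star a * pairing (comb_sections us) ws"
proof -
  have "comb_sections (ract_comb a us) = (\<lambda>y. comb_sections us y \<cdot> a)"
    using assms by (intro ext comb_sections_ract)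
  then show ?thesis using assms by (simp add: pairing_ract_fun)
qed

lemma gram_comb_sections:
  "us \<in> combs \<Longrightarrow> h \<in> carrier H \<Longrightarrow> gram H (comb_sections us y) h = (\<Sum>(x, g)\<leftarrow>us. gram H (k y x g) h)"
  by (induction rule: combs_induct) (simp_all add: gram_zero_left gram_add_left)

lemma pairing_sections_double_sum:
  assumes us: "us \<in> combs"
  shows "pairing (comb_sections us) us = (\<Sum>i=1..length us. \<Sum>j=1..length us.
    gram H (k (fst (us ! (i - 1))) (fst (us ! (j - 1))) (snd (us ! (j - 1)))) (snd (us ! (i - 1))))"
proof -
  have sum: "sum_list (map F us) = (\<Sum>i=1..length us. F (us ! (i - 1)))" for F :: "'x \<times> 'h \<Rightarrow> 'a"
    by (simp add: sum_list_sum_nth sum.atLeast1_atMost_eq atLeast0LessThan)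
  have "pairing (comb_sections us) us
      = (\<Sum>i=1..length us. gram H (comb_sections us (fst (us ! (i - 1)))) (snd (us ! (i - 1))))"
    unfolding pairing_def case_prod_unfold by (rule sum)
  also have "\<dots> = (\<Sum>i=1..length us. \<Sum>j=1..length us.
    gram H (k (fst (us ! (i - 1))) (fst (us ! (j - 1))) (snd (us ! (j - 1)))) (snd (us ! (i - 1))))"
  proof (rule sum.cong[OF refl])
    fix i assume "i \<in> {1..length us}"
    then have "us ! (i - 1) \<in> set us" by auto
    then have h: "snd (us ! (i - 1)) \<in> carrier H" using us by (auto simp: combs_def)
    show "gram H (comb_sections us (fst (us ! (i - 1)))) (snd (us ! (i - 1))) = (\<Sum>j=1..length us.
        gram H (k (fst (us ! (i - 1))) (fst (us ! (j - 1))) (snd (us ! (j - 1)))) (snd (us ! (i - 1))))"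
      unfolding gram_comb_sections[OF us h] case_prod_unfold by (rule sum)
  qed
  finally show ?thesis .
qed

lemma comb_nth_closed: "us \<in> combs \<Longrightarrow> \<forall>i\<in>{1..length us}. snd (us ! (i - 1)) \<in> carrier H"
proof
  fix i assume us: "us \<in> combs" and "i \<in> {1..length us}"
  then have "us ! (i - 1) \<in> set us" by auto
  then show "snd (us ! (i - 1)) \<in> carrier H" using us by (auto simp: combs_def)
qed

lemma pairing_sections_nonneg: "us \<in> combs \<Longrightarrow> nonneg (pairing (comb_sections us) us)"
  unfolding pairing_sections_double_sum
  by (rule psd_kernel[unfolded psd_kernel_def, rule_format]) (use comb_nth_closed in blast)

text \<open>Positive elements are self-adjoint, so the claim follows by polarisation with \<open>us + vs\<close> and
  \<open>us + \<i> vs\<close>.\<close>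

lemma pairing_sections_hermitian:
  assumes us: "us \<in> combs" and vs: "vs \<in> combs"
  shows "pairing (comb_sections us) vs = star (pairing (comb_sections vs) us)"
proof -
  define A B where "A = pairing (comb_sections us) vs" and "B = pairing (comb_sections vs) us"
  have sa: "self_adjoint (pairing (comb_sections ws) ws)" if "ws \<in> combs" for ws
    by (rule nonneg_self_adjoint[OF pairing_sections_nonneg[OF that]])
  note left = pairing_sections_append_left pairing_sections_scale_left
  have "star (pairing (comb_sections (us @ vs)) (us @ vs)) = pairing (comb_sections (us @ vs)) (us @ vs)"
    using us vs by (intro sa) simp
  then have 1: "star A + star B = A + B"
    using sa[OF us] sa[OF vs] us vs by (simp add: left star_add A_def B_def algebra_simps)
  have "star (pairing (comb_sections (us @ scale_comb \<i> vs)) (us @ scale_comb \<i> vs))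
      = pairing (comb_sections (us @ scale_comb \<i> vs)) (us @ scale_comb \<i> vs)"
    using us vs by (intro sa) simp
  then have "\<i> *\<^sub>C star B - \<i> *\<^sub>C star A = \<i> *\<^sub>C A - \<i> *\<^sub>C B"
    using sa[OF us] sa[OF vs] us vs
    by (simp add: left pairing_scale star_simps scaleC_simps A_def[symmetric] B_def[symmetric] algebra_simps scaleC_one)
  then have "\<i> *\<^sub>C (star B - star A) = \<i> *\<^sub>C (A - B)" by (simp add: scaleC_simps)
  then have "star B - star A = A - B" by simp
  with 1 have "(star A + star B) + (star B - star A) = (A + B) + (A - B)" by simp
  then have "star B + star B = A + A" by (simp add: algebra_simps)
  then have "2 *\<^sub>C star B = 2 *\<^sub>C A" by (simp only: scaleC_collect(8))
  then show ?thesis by (simp add: A_def B_def)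
qed

definition comb_norm :: "('a \<Rightarrow> real) \<Rightarrow> ('x \<times> 'h) list \<Rightarrow> real" where
  "comb_norm p us = sqrt (p (pairing (comb_sections us) us))"

lemma comb_norm_square: "p \<in> S\<^sub>* \<Longrightarrow> (comb_norm p us)\<^sup>2 = p (pairing (comb_sections us) us)"
  using cstar_seminormed.nonneg[OF cstar_seminormed_of_cont] by (simp add: comb_norm_def)

lemma comb_norm_nonneg [simp]: "p \<in> S\<^sub>* \<Longrightarrow> 0 \<le> comb_norm p us"
  using cstar_seminormed.nonneg[OF cstar_seminormed_of_cont] by (simp add: comb_norm_def)

lemma comb_norm_mono: "(\<And>x. q x \<le> p x) \<Longrightarrow> comb_norm q us \<le> comb_norm p us"
  by (simp add: comb_norm_def)

lemma comb_cauchy_schwarz: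
  assumes p: "p \<in> S\<^sub>*" and us: "us \<in> combs" and vs: "vs \<in> combs"
  shows "p (pairing (comb_sections us) vs) \<le> comb_norm p us * comb_norm p vs"
proof -
  define v where "v = pairing (comb_sections us) vs"
  have sv: "pairing (comb_sections vs) us = star v"
    unfolding v_def by (rule pairing_sections_hermitian[OF vs us])
  have "(p v)\<^sup>2 \<le> p (pairing (comb_sections us) us) * p (pairing (comb_sections vs) vs)"
  proof (rule cauchy_schwarz_criterion[OF p pairing_sections_nonneg[OF us] pairing_sections_nonneg[OF vs]])
    fix t :: real
    define a where "a = t *\<^sub>r star v"
    let ?w = "diff_comb us (ract_comb a vs)"
    have "pairing (comb_sections ?w) ?w =
       pairing (comb_sections us) us - t *\<^sub>r (v * star v) - t *\<^sub>r (v * star v)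
         + (t * t) *\<^sub>r (v * pairing (comb_sections vs) vs * star v)"
      using us vs
      by (simp add: pairing_sections_append_left pairing_sections_scale_left pairing_sections_ract_left
          pairing_scale pairing_ract sv v_def[symmetric] scaleC_one)
         (simp add: a_def star_simps scaleC_simps algebra_simps)
    moreover have "nonneg (pairing (comb_sections ?w) ?w)" using us vs by (intro pairing_sections_nonneg) simp
    ultimately show "nonneg (pairing (comb_sections us) us - t *\<^sub>r (v * star v) - t *\<^sub>r (v * star v)
         + (t * t) *\<^sub>r (v * pairing (comb_sections vs) vs * star v))" by simp
  qed
  also have "\<dots> = (comb_norm p us * comb_norm p vs)\<^sup>2"
    using p by (simp add: power_mult_distrib comb_norm_square)
  finally show ?thesis unfolding v_def by (rule power2_le_imp_le) (use p in simp)
qed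

lemma comb_norm_le:
  assumes p: "p \<in> S\<^sub>*" and C: "0 \<le> C" and "p (pairing (comb_sections us) us) \<le> C * comb_norm p us"
  shows "comb_norm p us \<le> C"
proof (cases "comb_norm p us = 0")
  case False
  then have "0 < comb_norm p us" using comb_norm_nonneg[OF p, of us] by linarith
  moreover have "comb_norm p us * comb_norm p us \<le> C * comb_norm p us"
    using assms(3) comb_norm_square[OF p, of us] by (simp add: power2_eq_square)
  ultimately show ?thesis by simp
qed (use C in simp)

end

section \<open>The reproducing kernel module of a positive semidefinite kernel\<close>

context psd_kernel_module
begin

text \<open>The least such \<open>N\<close> will be the seminorm of \<open>f\<close> in the module (\<open>rk_seminorm\<close>), but it is available
  before a gramian is.\<close>

definition dual_bound :: "('a \<Rightarrow> real) \<Rightarrow> real \<Rightarrow> ('x \<Rightarrow> 'h) \<Rightarrow> bool" where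
  "dual_bound p N f \<longleftrightarrow> (\<forall>w\<in>combs. p (pairing f w) \<le> N * comb_norm p w)"

text \<open>Closeness of \<open>f\<close> to a finite sum of sections in the dual norm. The quantification over all smaller
  seminorms \<open>q\<close> ensures that closeness for \<open>p\<close> implies closeness for \<open>q\<close>; the estimate for \<open>p\<close> alone
  would not give this directly, because the right-hand side also decreases with the seminorm.\<close>

definition approximates :: "('a \<Rightarrow> real) \<Rightarrow> real \<Rightarrow> ('x \<times> 'h) list \<Rightarrow> ('x \<Rightarrow> 'h) \<Rightarrow> bool" where
  "approximates p d us f \<longleftrightarrow> us \<in> combs \<and> (\<forall>q\<in>S\<^sub>*. (\<forall>x. q x \<le> p x) \<longrightarrow>
     (\<forall>w\<in>combs. q (pairing f w - pairing (comb_sections us) w) \<le> d * comb_norm q w))"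

definition rk_carrier :: "('x \<Rightarrow> 'h) set" where
  "rk_carrier = {f. (\<forall>x. f x \<in> carrier H) \<and> (\<forall>p\<in>S\<^sub>*. \<forall>d>0. \<exists>us. approximates p d us f)}"

lemma rk_carrier_closed [simp]: "f \<in> rk_carrier \<Longrightarrow> f x \<in> carrier H"
  by (simp add: rk_carrier_def)

lemma rk_carrier_approx: "f \<in> rk_carrier \<Longrightarrow> p \<in> S\<^sub>* \<Longrightarrow> 0 < d \<Longrightarrow> \<exists>us. approximates p d us f"
  unfolding rk_carrier_def by blast

lemma approximates_combs: "approximates p d us f \<Longrightarrow> us \<in> combs"
  by (simp add: approximates_def)

lemma approximatesD:
  "approximates p d us f \<Longrightarrow> p \<in> S\<^sub>* \<Longrightarrow> w \<in> combs \<Longrightarrow>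
    p (pairing f w - pairing (comb_sections us) w) \<le> d * comb_norm p w"
  by (simp add: approximates_def)

lemma approximates_mono:
  assumes "approximates p d us f" "\<And>x. q x \<le> p x" "d \<le> d'"
  shows "approximates q d' us f"
  unfolding approximates_def
proof (intro conjI ballI impI)
  fix r :: "'a \<Rightarrow> real" and w assume r: "r \<in> S\<^sub>*" "\<forall>x. r x \<le> q x" and w: "w \<in> combs"
  have "\<forall>x. r x \<le> p x" using r(2) assms(2) order_trans by blast
  then have "r (pairing f w - pairing (comb_sections us) w) \<le> d * comb_norm r w"
    using assms(1) r(1) w by (simp add: approximates_def)
  also have "\<dots> \<le> d' * comb_norm r w" using assms(3) r(1) by (intro mult_right_mono) simp_all
  finally show "r (pairing f w - pairing (comb_sections us) w) \<le> d' * comb_norm r w" .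
qed (rule approximates_combs[OF assms(1)])

lemma rk_carrierI:
  assumes "\<And>x. f x \<in> carrier H"
    and "\<And>p. p \<in> S\<^sub>* \<Longrightarrow> \<exists>C. \<forall>d>0. \<exists>us. approximates p (C * d) us f"
  shows "f \<in> rk_carrier"
  unfolding rk_carrier_def
proof (intro CollectI conjI allI ballI impI assms(1))
  fix p :: "'a \<Rightarrow> real" and e :: real assume "p \<in> S\<^sub>*" and e: "0 < e"
  then obtain C where C: "\<And>d. 0 < d \<Longrightarrow> \<exists>us. approximates p (C * d) us f" using assms(2) by blast
  define d where "d = e / (\<bar>C\<bar> + 1)"
  have d: "0 < d" using e by (simp add: d_def add_nonneg_pos)
  have "C * d \<le> (\<bar>C\<bar> + 1) * d" using d by (intro mult_right_mono) simp_all
  also have "\<dots> = e" by (simp add: d_def)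
  finally have "C * d \<le> e" .
  then show "\<exists>us. approximates p e us f" using C[OF d] approximates_mono[OF _ order_refl] by blast
qed

lemma comb_sections_approximates:
  assumes us: "us \<in> combs" and d: "0 \<le> d"
  shows "approximates p d us (comb_sections us)"
  unfolding approximates_def
proof (intro conjI ballI impI us)
  fix q :: "'a \<Rightarrow> real" and w assume q: "q \<in> S\<^sub>*"
  interpret cstar_seminormed q by (rule cstar_seminormed_of_cont[OF q])
  show "q (pairing (comb_sections us) w - pairing (comb_sections us) w) \<le> d * comb_norm q w"
    using d q by simp
qed

lemma comb_sections_rk_carrier: "us \<in> combs \<Longrightarrow> comb_sections us \<in> rk_carrier"
proof (rule rk_carrierI)
  fix p :: "'a \<Rightarrow> real"
  assume "us \<in> combs"
  then have "\<exists>vs. approximates p (1 * d) vs (comb_sections us)" if "0 < d" for d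
    using comb_sections_approximates[of us "1 * d" p] that by (intro exI[of _ us]) simp
  then show "\<exists>C. \<forall>d>0. \<exists>vs. approximates p (C * d) vs (comb_sections us)" by blast
qed simp

text \<open>Approximation transfers dual bounds between \<open>f\<close> and the approximating sum; for the latter the norm
  is recovered by pairing it with itself.\<close>

lemma dual_bound_of_approximation:
  assumes p: "p \<in> S\<^sub>*" and "dual_bound p M f" and "approximates p d us f"
  shows "dual_bound p (comb_norm p us + d) f" and "0 \<le> M \<Longrightarrow> 0 \<le> d \<Longrightarrow> comb_norm p us \<le> M + d"
proof -
  interpret cstar_seminormed p by (rule cstar_seminormed_of_cont[OF p])
  note us = approximates_combs[OF assms(3)]
  show "dual_bound p (comb_norm p us + d) f"
    unfolding dual_bound_def
  proof
    fix w assume w: "w \<in> combs"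
    show "p (pairing f w) \<le> (comb_norm p us + d) * comb_norm p w"
      using triangle_minus[of "pairing f w" "pairing (comb_sections us) w"]
        approximatesD[OF assms(3) p w] comb_cauchy_schwarz[OF p us w] by (simp add: distrib_right)
  qed
  assume 0: "0 \<le> M" "0 \<le> d"
  show "comb_norm p us \<le> M + d"
  proof (rule comb_norm_le[OF p])
    have "p (pairing (comb_sections us) us - pairing f us) \<le> d * comb_norm p us"
      unfolding diff_commute[of "pairing (comb_sections us) us"] by (rule approximatesD[OF assms(3) p us])
    moreover have "p (pairing f us) \<le> M * comb_norm p us"
      using assms(2) us by (simp add: dual_bound_def)
    ultimately show "p (pairing (comb_sections us) us) \<le> (M + d) * comb_norm p us"
      using triangle_minus[of "pairing (comb_sections us) us" "pairing f us"] by (simp add: distrib_right)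
  qed (use 0 in simp)
qed

lemma dual_bound_exists:
  assumes "f \<in> rk_carrier" and p: "p \<in> S\<^sub>*"
  obtains N where "0 \<le> N" "dual_bound p N f"
proof -
  interpret cstar_seminormed p by (rule cstar_seminormed_of_cont[OF p])
  obtain us where us: "approximates p 1 us f" using rk_carrier_approx[OF assms, of 1] by auto
  have "dual_bound p (comb_norm p us + 1) f"
    unfolding dual_bound_def
  proof
    fix w assume w: "w \<in> combs"
    show "p (pairing f w) \<le> (comb_norm p us + 1) * comb_norm p w"
      using triangle_minus[of "pairing f w" "pairing (comb_sections us) w"]
        approximatesD[OF us p w] comb_cauchy_schwarz[OF p approximates_combs[OF us] w] by (simp add: distrib_right)
  qed
  then show ?thesis using that[of "comb_norm p us + 1"] p by simp
qed

lemma comb_norm_diff_le: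
  assumes p: "p \<in> S\<^sub>*" and us: "approximates p d us f" and vs: "approximates p d' vs f"
    and d: "0 \<le> d" "0 \<le> d'"
  shows "comb_norm p (diff_comb us vs) \<le> d + d'"
proof (rule comb_norm_le[OF p])
  interpret cstar_seminormed p by (rule cstar_seminormed_of_cont[OF p])
  define w where "w = diff_comb us vs"
  note c = approximates_combs[OF us] approximates_combs[OF vs]
  have w: "w \<in> combs" using c by (simp add: w_def)
  have "pairing (comb_sections w) w = pairing (comb_sections us) w - pairing (comb_sections vs) w"
    using c w by (simp add: w_def pairing_sections_append_left pairing_sections_scale_left scaleC_one del: pairing_simps)
  also have "\<dots> = (pairing f w - pairing (comb_sections vs) w) - (pairing f w - pairing (comb_sections us) w)"
    by simp
  also have "p \<dots> \<le> d' * comb_norm p w + d * comb_norm p w"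
    by (intro order_trans[OF triangle_diff add_mono] approximatesD us vs p w)
  finally show "p (pairing (comb_sections w) w) \<le> (d + d') * comb_norm p w" by (simp add: algebra_simps)
qed (use d in simp)

lemma pairing_diff_comb:
  "us \<in> combs \<Longrightarrow> vs \<in> combs \<Longrightarrow> (\<And>x. f x \<in> carrier H) \<Longrightarrow>
    pairing f (diff_comb us vs) = pairing f us - pairing f vs"
  by (simp add: pairing_scale scaleC_one)

lemma pairing_close:
  assumes p: "p \<in> S\<^sub>*" and f: "\<And>x. f x \<in> carrier H" "dual_bound p N f" "0 \<le> N"
    and us: "approximates p d us g" and vs: "approximates p d' vs g" and d: "0 \<le> d" "0 \<le> d'"
  shows "p (pairing f us - pairing f vs) \<le> N * (d + d')"
proof -
  note c = approximates_combs[OF us] approximates_combs[OF vs]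
  have "p (pairing f us - pairing f vs) = p (pairing f (diff_comb us vs))"
    using c f(1) by (simp only: pairing_diff_comb)
  also have "\<dots> \<le> N * comb_norm p (diff_comb us vs)" using f(2) c by (simp add: dual_bound_def del: pairing_simps)
  also have "\<dots> \<le> N * (d + d')" by (rule mult_left_mono[OF comb_norm_diff_le[OF p us vs d] f(3)])
  finally show ?thesis .
qed

definition rk_gram :: "('x \<Rightarrow> 'h) \<Rightarrow> ('x \<Rightarrow> 'h) \<Rightarrow> 'a" where
  "rk_gram f g = (SOME a. \<forall>p\<in>S\<^sub>*. \<forall>e>0. \<forall>d>0. \<exists>us. approximates p d us g \<and> p (pairing f us - a) < e)"

lemma rk_gram_limit:
  assumes f: "f \<in> rk_carrier" and g: "g \<in> rk_carrier"
  shows "\<forall>p\<in>S\<^sub>*. \<forall>e>0. \<forall>d>0. \<exists>us. approximates p d us g \<and> p (pairing f us - rk_gram f g) < e"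
proof -
  have "\<exists>a. \<forall>p\<in>S\<^sub>*. \<forall>e>0. \<forall>d>0. \<exists>y\<in>{pairing f us | us. approximates p d us g}. p (y - a) < e"
  proof (rule limit_of_approximations)
    show "{pairing f us | us. approximates p d us g} \<noteq> {}" if "p \<in> S\<^sub>*" "0 < d" for p and d :: real
      using rk_carrier_approx[OF g that] by blast
    show "{pairing f us | us. approximates q d us g} \<subseteq> {pairing f us | us. approximates p d' us g}"
      if "\<And>x. p x \<le> q x" "d \<le> d'" for p q :: "'a \<Rightarrow> real" and d d' :: real
      using approximates_mono[of q d _ g p d', OF _ that] by blast
    fix p :: "'a \<Rightarrow> real" and e :: real assume p: "p \<in> S\<^sub>*" and e: "0 < e"
    obtain N where N: "0 \<le> N" "dual_bound p N f" by (rule dual_bound_exists[OF f p])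
    define d where "d = e / (N + 1) / 2"
    have d: "0 < d" using e N by (simp add: d_def)
    have "N * (d + d) < (N + 1) * (d + d)" using d by simp
    also have "(N + 1) * (d + d) = (N + 1) * (e / (N + 1))" by (simp only: d_def field_sum_of_halves)
    also have "\<dots> = e" using N by simp
    finally have "N * (d + d) < e" .
    then have "p (y - y') < e"
      if "y \<in> {pairing f us | us. approximates p d us g}" "y' \<in> {pairing f us | us. approximates p d us g}" for y y'
      using that pairing_close[OF p _ N(2,1), of d _ g d] f d by fastforce
    then show "\<exists>d>0. \<forall>y\<in>{pairing f us | us. approximates p d us g}.
        \<forall>y'\<in>{pairing f us | us. approximates p d us g}. p (y - y') < e"
      using d by blast
  qed
  then have "\<exists>a. \<forall>p\<in>S\<^sub>*. \<forall>e>0. \<forall>d>0. \<exists>us. approximates p d us g \<and> p (pairing f us - a) < e"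
    by (elim ex_forward) blast
  then show ?thesis unfolding rk_gram_def by (rule someI_ex)
qed

lemma rk_gram_approx:
  assumes f: "f \<in> rk_carrier" and g: "g \<in> rk_carrier" and p: "p \<in> S\<^sub>*"
    and N: "dual_bound p N f" "0 \<le> N" and us: "approximates p d us g" and d: "0 \<le> d"
  shows "p (rk_gram f g - pairing f us) \<le> N * d"
proof (rule le_of_le_add_mult[where c = "N + 1"])
  interpret cstar_seminormed p by (rule cstar_seminormed_of_cont[OF p])
  fix e :: real assume e: "0 < e"
  obtain vs where vs: "approximates p e vs g" "p (pairing f vs - rk_gram f g) < e"
    using rk_gram_limit[OF f g] p e by blast
  have "p (rk_gram f g - pairing f us) \<le> p (pairing f vs - rk_gram f g) + p (pairing f vs - pairing f us)"
    using triangle_diff[of "pairing f vs - pairing f us" "pairing f vs - rk_gram f g"] by simp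
  also have "\<dots> \<le> e + N * (e + d)"
    using vs(2) e d by (intro add_mono pairing_close[OF p _ N vs(1) us]) (simp_all add: f)
  finally show "p (rk_gram f g - pairing f us) \<le> N * d + (N + 1) * e" by (simp add: algebra_simps)
qed (use N in simp)

lemma rk_gram_eqI:
  assumes f: "f \<in> rk_carrier" and g: "g \<in> rk_carrier"
    and approx: "\<And>p. p \<in> S\<^sub>* \<Longrightarrow> \<exists>C. \<forall>d. 0 < d \<longrightarrow> d \<le> 1 \<longrightarrow> (\<exists>us. approximates p d us g \<and> p (a - pairing f us) \<le> C * d)"
  shows "rk_gram f g = a"
proof -
  have "rk_gram f g - a = 0"
  proof (rule zero_if_small)
    fix p :: "'a \<Rightarrow> real" and e :: real assume p: "p \<in> S\<^sub>*" and e: "0 < e"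
    interpret cstar_seminormed p by (rule cstar_seminormed_of_cont[OF p])
    obtain N where N: "0 \<le> N" "dual_bound p N f" by (rule dual_bound_exists[OF f p])
    obtain C where C: "\<And>d. 0 < d \<Longrightarrow> d \<le> 1 \<Longrightarrow> \<exists>us. approximates p d us g \<and> p (a - pairing f us) \<le> C * d"
      using approx[OF p] by blast
    define D where "D = N + \<bar>C\<bar> + 1"
    have D: "0 < D" using N by (simp add: D_def)
    define d where "d = min 1 (e / D)"
    have d: "0 < d" "d \<le> 1" "D * d \<le> e" using D e by (auto simp: d_def min_def field_simps)
    obtain us where us: "approximates p d us g" "p (a - pairing f us) \<le> C * d" using C[OF d(1,2)] by blast
    have "p (rk_gram f g - a) \<le> p (rk_gram f g - pairing f us) + p (a - pairing f us)"
      using triangle_diff[of "rk_gram f g - pairing f us" "a - pairing f us"] by simp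
    also have "\<dots> \<le> N * d + C * d"
      using d by (intro add_mono rk_gram_approx[OF f g p N(2,1) us(1)] us(2)) simp
    also have "\<dots> \<le> D * d"
      unfolding distrib_right[symmetric] using d by (intro mult_right_mono) (simp_all add: D_def)
    finally show "p (rk_gram f g - a) \<le> e" using d(3) by simp
  qed
  then show ?thesis by simp
qed

lemma rk_gram_comb_sections:
  assumes f: "f \<in> rk_carrier" and us: "us \<in> combs"
  shows "rk_gram f (comb_sections us) = pairing f us"
proof (rule rk_gram_eqI[OF f comb_sections_rk_carrier[OF us]])
  fix p :: "'a \<Rightarrow> real" assume p: "p \<in> S\<^sub>*"
  interpret cstar_seminormed p by (rule cstar_seminormed_of_cont[OF p])
  show "\<exists>C. \<forall>d. 0 < d \<longrightarrow> d \<le> 1 \<longrightarrow>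
      (\<exists>vs. approximates p d vs (comb_sections us) \<and> p (pairing f us - pairing f vs) \<le> C * d)"
    using comb_sections_approximates[OF us] by (intro exI[of _ 0]) (auto intro!: exI[of _ us])
qed

lemma rk_gram_star:
  assumes f: "f \<in> rk_carrier" and g: "g \<in> rk_carrier"
  shows "rk_gram f g = star (rk_gram g f)"
proof (rule rk_gram_eqI[OF f g])
  fix p :: "'a \<Rightarrow> real" assume p: "p \<in> S\<^sub>*"
  interpret cstar_seminormed p by (rule cstar_seminormed_of_cont[OF p])
  obtain M where M: "0 \<le> M" "dual_bound p M f" by (rule dual_bound_exists[OF f p])
  obtain N where N: "0 \<le> N" "dual_bound p N g" by (rule dual_bound_exists[OF g p])
  have "\<exists>us. approximates p d us g \<and> p (star (rk_gram g f) - pairing f us) \<le> (N + (M + 1) + (N + 1)) * d"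
    if d: "0 < d" "d \<le> 1" for d
  proof -
    obtain us where us: "approximates p d us g" using rk_carrier_approx[OF g p d(1)] by blast
    obtain vs where vs: "approximates p d vs f" using rk_carrier_approx[OF f p d(1)] by blast
    note c = approximates_combs[OF us] approximates_combs[OF vs]
    have nus: "comb_norm p us \<le> N + 1" and nvs: "comb_norm p vs \<le> M + 1"
      using dual_bound_of_approximation(2)[OF p N(2) us] dual_bound_of_approximation(2)[OF p M(2) vs] N M d by simp_all
    have split: "star (rk_gram g f) - pairing f us
        = star (rk_gram g f - pairing g vs) + star (pairing g vs - pairing (comb_sections us) vs)
          - (pairing f us - pairing (comb_sections vs) us)"
      using pairing_sections_hermitian[OF c(2,1)] by (simp add: star_diff)
    have "p (star (rk_gram g f) - pairing f us) \<le> N * d + d * comb_norm p vs + d * comb_norm p us"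
    proof -
      have three: "p (star A + star B - C) \<le> p A + p B + p C" for A B C
        using triangle_diff[of "star A + star B" C] triangle[of "star A" "star B"] by simp
      show ?thesis
        unfolding split using d
        by (intro order_trans[OF three add_mono] add_mono rk_gram_approx[OF g f p N(2,1) vs]
            approximatesD[OF us p c(2)] approximatesD[OF vs p c(1)]) simp
    qed
    also have "\<dots> \<le> N * d + d * (M + 1) + d * (N + 1)"
      using d nus nvs N by (intro add_mono mult_left_mono) simp_all
    finally show ?thesis using us by (auto simp: algebra_simps)
  qed
  then show "\<exists>C. \<forall>d. 0 < d \<longrightarrow> d \<le> 1 \<longrightarrow>
      (\<exists>us. approximates p d us g \<and> p (star (rk_gram g f) - pairing f us) \<le> C * d)" by blast
qed

lemma rk_gram_nonneg:
  assumes f: "f \<in> rk_carrier"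
  shows "nonneg (rk_gram f f)"
proof (rule nonneg_limit)
  fix p :: "'a \<Rightarrow> real" and e :: real assume p: "p \<in> S\<^sub>*" and e: "0 < e"
  interpret cstar_seminormed p by (rule cstar_seminormed_of_cont[OF p])
  obtain N where N: "0 \<le> N" "dual_bound p N f" by (rule dual_bound_exists[OF f p])
  define d where "d = min 1 (e / (2 * N + 2))"
  have pos: "0 < 2 * N + 2" using N by simp
  then have d: "0 < d" "d \<le> 1" using e by (simp_all add: d_def)
  have "(2 * N + 1) * d < (2 * N + 2) * d" using d by simp
  also have "(2 * N + 2) * d \<le> (2 * N + 2) * (e / (2 * N + 2))"
    using pos by (intro mult_left_mono) (simp_all add: d_def)
  also have "\<dots> = e" using pos by simp
  finally have de: "(2 * N + 1) * d < e" .
  obtain us where us: "approximates p d us f" using rk_carrier_approx[OF f p d(1)] by blast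
  note c = approximates_combs[OF us]
  have n: "comb_norm p us \<le> N + 1" using dual_bound_of_approximation(2)[OF p N(2) us] N d by simp
  have "pairing (comb_sections us) us - rk_gram f f
      = - ((pairing f us - pairing (comb_sections us) us) + (rk_gram f f - pairing f us))" by simp
  then have "p (pairing (comb_sections us) us - rk_gram f f) \<le> d * comb_norm p us + N * d"
    using triangle[of "pairing f us - pairing (comb_sections us) us" "rk_gram f f - pairing f us"]
      approximatesD[OF us p c] rk_gram_approx[OF f f p N(2,1) us] d by (simp only: minus) simp
  also have "\<dots> \<le> d * (N + 1) + N * d" using n d by simp
  also have "\<dots> < e" using de by (simp add: algebra_simps)
  finally show "\<exists>y. nonneg y \<and> p (y - rk_gram f f) < e"
    using pairing_sections_nonneg[OF c] by blast
qed

lemma rk_gram_le_bound: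
  assumes f: "f \<in> rk_carrier" and p: "p \<in> S\<^sub>*" and N: "dual_bound p N f" "0 \<le> N"
  shows "p (rk_gram f f) \<le> N\<^sup>2"
proof (rule le_of_le_add_mult[where c = "2 * N"])
  interpret cstar_seminormed p by (rule cstar_seminormed_of_cont[OF p])
  fix d :: real assume d: "0 < d"
  obtain us where us: "approximates p d us f" using rk_carrier_approx[OF f p d] by blast
  note c = approximates_combs[OF us]
  have n: "comb_norm p us \<le> N + d" using dual_bound_of_approximation(2)[OF p N(1) us] N d by simp
  have "p (rk_gram f f) \<le> p (rk_gram f f - pairing f us) + p (pairing f us)" by (rule triangle_minus)
  also have "\<dots> \<le> N * d + N * comb_norm p us"
    using rk_gram_approx[OF f f p N us] N c d by (intro add_mono) (simp_all add: dual_bound_def)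
  also have "\<dots> \<le> N * d + N * (N + d)" by (intro add_left_mono mult_left_mono n N)
  finally show "p (rk_gram f f) \<le> N\<^sup>2 + 2 * N * d" by (simp add: power2_eq_square algebra_simps)
qed (use N in simp)

text \<open>The Cauchy-Schwarz inequality for \<open>f\<close> and finite sums of sections. It follows by approximating
  \<open>f\<close> with tolerance \<open>d\<close> and letting \<open>d\<close> tend to zero.\<close>

lemma dual_bound_rk_gram:
  assumes f: "f \<in> rk_carrier" and p: "p \<in> S\<^sub>*"
  shows "dual_bound p (sqrt (p (rk_gram f f))) f"
  unfolding dual_bound_def
proof
  interpret cstar_seminormed p by (rule cstar_seminormed_of_cont[OF p])
  fix w assume w: "w \<in> combs"
  obtain N where N: "0 \<le> N" "dual_bound p N f" by (rule dual_bound_exists[OF f p])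
  let ?M = "p (rk_gram f f)"
  have le: "p (pairing f w) \<le> (sqrt (?M + (2 * N + 1) * d) + d) * comb_norm p w" if d: "0 < d" "d < 1" for d
  proof -
    obtain us where us: "approximates p d us f" using rk_carrier_approx[OF f p d(1)] by blast
    note c = approximates_combs[OF us]
    have n: "comb_norm p us \<le> N + 1" using dual_bound_of_approximation(2)[OF p N(2) us] N d by simp
    have split: "pairing (comb_sections us) us
        = rk_gram f f - (rk_gram f f - pairing f us) - (pairing f us - pairing (comb_sections us) us)" by simp
    have "(comb_norm p us)\<^sup>2 = p (pairing (comb_sections us) us)" by (rule comb_norm_square[OF p])
    also have "\<dots> \<le> ?M + N * d + d * comb_norm p us"
      by (subst split, intro order_trans[OF triangle_diff add_mono] order_refl rk_gram_approx[OF f f p N(2,1) us]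
          approximatesD[OF us p c]) (use d in simp)
    also have "\<dots> \<le> ?M + N * d + d * (N + 1)" using n d by simp
    also have "\<dots> = ?M + (2 * N + 1) * d" by (simp add: algebra_simps)
    finally have "comb_norm p us \<le> sqrt (?M + (2 * N + 1) * d)" by (rule real_le_rsqrt)
    then have "(comb_norm p us + d) * comb_norm p w \<le> (sqrt (?M + (2 * N + 1) * d) + d) * comb_norm p w"
      using p by (intro mult_right_mono) simp_all
    moreover have "p (pairing f w) \<le> (comb_norm p us + d) * comb_norm p w"
      using dual_bound_of_approximation(1)[OF p N(2) us] w by (simp add: dual_bound_def)
    ultimately show ?thesis by linarith
  qed
  have "((\<lambda>d. (sqrt (?M + (2 * N + 1) * d) + d) * comb_norm p w) \<longlongrightarrow>
      (sqrt (?M + (2 * N + 1) * 0) + 0) * comb_norm p w) (at_right 0)"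
    by (intro tendsto_intros)
  moreover have "eventually (\<lambda>d. p (pairing f w) \<le> (sqrt (?M + (2 * N + 1) * d) + d) * comb_norm p w) (at_right 0)"
    using le by (auto simp: eventually_at_right_field intro!: exI[of _ 1])
  ultimately have "p (pairing f w) \<le> (sqrt (?M + (2 * N + 1) * 0) + 0) * comb_norm p w"
    by (intro tendsto_lowerbound[where F = "at_right (0::real)"]) simp_all
  then show "p (pairing f w) \<le> sqrt ?M * comb_norm p w" by simp
qed

end

context psd_kernel_module
begin

definition rk_module :: "('x \<Rightarrow> 'h, 'a) hilbert_mod" where
  "rk_module = \<lparr>carrier = rk_carrier, monoid.mult = undefined, one = undefined,
     ring.zero = (\<lambda>x. \<zero>), add = (\<lambda>f g x. f x \<oplus> g x), module.smult = (\<lambda>c f x. c \<odot>\<^bsub>H\<^esub> f x),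
     ract = (\<lambda>f a x. f x \<cdot> a), gram = rk_gram\<rparr>"

lemma rk_module_simps [simp]:
  "carrier rk_module = rk_carrier" "\<zero>\<^bsub>rk_module\<^esub> = (\<lambda>x. \<zero>)"
  "f \<oplus>\<^bsub>rk_module\<^esub> g = (\<lambda>x. f x \<oplus> g x)" "c \<odot>\<^bsub>rk_module\<^esub> f = (\<lambda>x. c \<odot>\<^bsub>H\<^esub> f x)"
  "f \<cdot>\<^bsub>rk_module\<^esub> a = (\<lambda>x. f x \<cdot> a)" "gram rk_module = rk_gram"
  by (simp_all add: rk_module_def)

lemma approximates_add:
  assumes us: "approximates p d us f" and vs: "approximates p d' vs g"
    and f: "\<And>x. f x \<in> carrier H" and g: "\<And>x. g x \<in> carrier H"
  shows "approximates p (d + d') (us @ vs) (\<lambda>x. f x \<oplus> g x)"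
  unfolding approximates_def
proof (intro conjI ballI impI)
  note c = approximates_combs[OF us] approximates_combs[OF vs]
  show "us @ vs \<in> combs" using c by simp
  fix q :: "'a \<Rightarrow> real" and w assume q: "q \<in> S\<^sub>*" "\<forall>x. q x \<le> p x" and w: "w \<in> combs"
  interpret cstar_seminormed q by (rule cstar_seminormed_of_cont[OF q(1)])
  have "pairing (\<lambda>x. f x \<oplus> g x) w - pairing (comb_sections (us @ vs)) w
      = (pairing f w - pairing (comb_sections us) w) + (pairing g w - pairing (comb_sections vs) w)"
    using c w by (simp add: pairing_add_fun f g pairing_sections_append_left)
  then show "q (pairing (\<lambda>x. f x \<oplus> g x) w - pairing (comb_sections (us @ vs)) w) \<le> (d + d') * comb_norm q w"
    using triangle[of "pairing f w - pairing (comb_sections us) w" "pairing g w - pairing (comb_sections vs) w"]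
      approximatesD[OF approximates_mono[OF us _ order_refl] q(1) w]
      approximatesD[OF approximates_mono[OF vs _ order_refl] q(1) w] q(2)
    by (simp add: distrib_right)
qed

lemma approximates_scale:
  assumes us: "approximates p d us f" and f: "\<And>x. f x \<in> carrier H"
  shows "approximates p (cmod c * d) (scale_comb c us) (\<lambda>x. c \<odot>\<^bsub>H\<^esub> f x)"
  unfolding approximates_def
proof (intro conjI ballI impI)
  note us' = approximates_combs[OF us]
  show "scale_comb c us \<in> combs" using us' by simp
  fix q :: "'a \<Rightarrow> real" and w assume q: "q \<in> S\<^sub>*" "\<forall>x. q x \<le> p x" and w: "w \<in> combs"
  interpret cstar_seminormed q by (rule cstar_seminormed_of_cont[OF q(1)])
  have "pairing (\<lambda>x. c \<odot>\<^bsub>H\<^esub> f x) w - pairing (comb_sections (scale_comb c us)) w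
      = cnj c *\<^sub>C (pairing f w - pairing (comb_sections us) w)"
    using us' w by (simp add: pairing_scale_fun f pairing_sections_scale_left scaleC_simps)
  then have "q (pairing (\<lambda>x. c \<odot>\<^bsub>H\<^esub> f x) w - pairing (comb_sections (scale_comb c us)) w)
      = cmod c * q (pairing f w - pairing (comb_sections us) w)" by (simp add: scale)
  also have "\<dots> \<le> cmod c * (d * comb_norm q w)"
    using approximatesD[OF approximates_mono[OF us _ order_refl] q(1) w] q(2) by (intro mult_left_mono) simp_all
  finally show "q (pairing (\<lambda>x. c \<odot>\<^bsub>H\<^esub> f x) w - pairing (comb_sections (scale_comb c us)) w)
      \<le> cmod c * d * comb_norm q w" by (simp add: mult.assoc)
qed

lemma approximates_ract:
  assumes us: "approximates p d us f" and f: "\<And>x. f x \<in> carrier H" and d: "0 \<le> d"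
  shows "approximates p (p a * d) (ract_comb a us) (\<lambda>x. f x \<cdot> a)"
  unfolding approximates_def
proof (intro conjI ballI impI)
  note us' = approximates_combs[OF us]
  show "ract_comb a us \<in> combs" using us' by simp
  fix q :: "'a \<Rightarrow> real" and w assume q: "q \<in> S\<^sub>*" "\<forall>x. q x \<le> p x" and w: "w \<in> combs"
  interpret cstar_seminormed q by (rule cstar_seminormed_of_cont[OF q(1)])
  have "pairing (\<lambda>x. f x \<cdot> a) w - pairing (comb_sections (ract_comb a us)) w
      = star a * (pairing f w - pairing (comb_sections us) w)"
    using us' w by (simp add: pairing_ract_fun f pairing_sections_ract_left algebra_simps)
  then have "q (pairing (\<lambda>x. f x \<cdot> a) w - pairing (comb_sections (ract_comb a us)) w)
      \<le> q a * q (pairing f w - pairing (comb_sections us) w)"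
    using submultiplicative[of "star a"] by simp
  also have "\<dots> \<le> p a * (d * comb_norm q w)"
    using approximatesD[OF approximates_mono[OF us _ order_refl] q(1) w] q(2) d
    by (intro mult_mono) (auto intro: order_trans[OF nonneg])
  finally show "q (pairing (\<lambda>x. f x \<cdot> a) w - pairing (comb_sections (ract_comb a us)) w)
      \<le> p a * d * comb_norm q w" by (simp add: mult.assoc)
qed

lemma rk_carrier_zero: "(\<lambda>x. \<zero>) \<in> rk_carrier"
proof -
  have "comb_sections [] = (\<lambda>x. \<zero>)" by (rule ext) simp
  then show ?thesis using comb_sections_rk_carrier[of "[]"] by simp
qed

lemma rk_carrier_add: "f \<in> rk_carrier \<Longrightarrow> g \<in> rk_carrier \<Longrightarrow> (\<lambda>x. f x \<oplus> g x) \<in> rk_carrier"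
proof (rule rk_carrierI)
  fix p :: "'a \<Rightarrow> real" assume f: "f \<in> rk_carrier" and g: "g \<in> rk_carrier" and p: "p \<in> S\<^sub>*"
  have "\<exists>us. approximates p (2 * d) us (\<lambda>x. f x \<oplus> g x)" if d: "0 < d" for d
  proof -
    obtain us vs where "approximates p d us f" "approximates p d vs g"
      using rk_carrier_approx[OF f p d] rk_carrier_approx[OF g p d] by blast
    from approximates_add[OF this] f g show ?thesis by auto
  qed
  then show "\<exists>C. \<forall>d>0. \<exists>us. approximates p (C * d) us (\<lambda>x. f x \<oplus> g x)" by blast
qed simp

lemma rk_carrier_scale: "f \<in> rk_carrier \<Longrightarrow> (\<lambda>x. c \<odot>\<^bsub>H\<^esub> f x) \<in> rk_carrier"
proof (rule rk_carrierI)
  fix p :: "'a \<Rightarrow> real" assume f: "f \<in> rk_carrier" and p: "p \<in> S\<^sub>*"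
  have "\<exists>us. approximates p (cmod c * d) us (\<lambda>x. c \<odot>\<^bsub>H\<^esub> f x)" if d: "0 < d" for d
    using rk_carrier_approx[OF f p d] approximates_scale[of p d _ f] f by auto
  then show "\<exists>C. \<forall>d>0. \<exists>us. approximates p (C * d) us (\<lambda>x. c \<odot>\<^bsub>H\<^esub> f x)" by blast
qed simp

lemma rk_carrier_ract: "f \<in> rk_carrier \<Longrightarrow> (\<lambda>x. f x \<cdot> a) \<in> rk_carrier"
proof (rule rk_carrierI)
  fix p :: "'a \<Rightarrow> real" assume f: "f \<in> rk_carrier" and p: "p \<in> S\<^sub>*"
  have "\<exists>us. approximates p (p a * d) us (\<lambda>x. f x \<cdot> a)" if d: "0 < d" for d
    using rk_carrier_approx[OF f p d] approximates_ract[of p d _ f] f d by fastforce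
  then show "\<exists>C. \<forall>d>0. \<exists>us. approximates p (C * d) us (\<lambda>x. f x \<cdot> a)" by blast
qed simp

lemma rk_abelian_group: "abelian_group rk_module"
proof (rule abelian_groupI)
  fix f g h assume f: "f \<in> carrier rk_module" and g: "g \<in> carrier rk_module"
  show "f \<oplus>\<^bsub>rk_module\<^esub> g \<in> carrier rk_module" using f g by (simp add: rk_carrier_add)
  show "f \<oplus>\<^bsub>rk_module\<^esub> g = g \<oplus>\<^bsub>rk_module\<^esub> f" using f g by (simp add: M.a_comm)
  assume h: "h \<in> carrier rk_module"
  show "f \<oplus>\<^bsub>rk_module\<^esub> g \<oplus>\<^bsub>rk_module\<^esub> h = f \<oplus>\<^bsub>rk_module\<^esub> (g \<oplus>\<^bsub>rk_module\<^esub> h)"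
    using f g h by (simp add: M.a_assoc)
next
  fix f assume f: "f \<in> carrier rk_module"
  show "\<zero>\<^bsub>rk_module\<^esub> \<oplus>\<^bsub>rk_module\<^esub> f = f" using f by simp
  show "\<exists>g\<in>carrier rk_module. g \<oplus>\<^bsub>rk_module\<^esub> f = \<zero>\<^bsub>rk_module\<^esub>"
  proof (rule bexI)
    have "(-1) \<odot>\<^bsub>H\<^esub> f x \<oplus> f x = \<zero>" for x using f by (simp add: scale_minus_one M.l_neg)
    then show "(\<lambda>x. (-1) \<odot>\<^bsub>H\<^esub> f x) \<oplus>\<^bsub>rk_module\<^esub> f = \<zero>\<^bsub>rk_module\<^esub>" by simp
    show "(\<lambda>x. (-1) \<odot>\<^bsub>H\<^esub> f x) \<in> carrier rk_module" using f by (simp add: rk_carrier_scale del: scale_minus_one)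
  qed
qed (simp add: rk_carrier_zero)

lemma rk_is_module: "Module.module (ring_of_type_algebra :: complex ring) rk_module"
proof (rule moduleI)
  show "cring (ring_of_type_algebra :: complex ring)" by (rule R.cring_axioms)
  show "abelian_group rk_module" by (rule rk_abelian_group)
qed (auto simp: complex_ring_simps rk_carrier_scale scale_scale
    smult_l_distr[simplified complex_ring_simps] smult_r_distr[simplified complex_ring_simps])

lemma rk_diff:
  assumes f: "f \<in> rk_carrier" and g: "g \<in> rk_carrier"
  shows "f \<ominus>\<^bsub>rk_module\<^esub> g = (\<lambda>x. f x \<ominus> g x)" and "(\<lambda>x. f x \<ominus> g x) \<in> rk_carrier"
proof -
  interpret RK: abelian_group rk_module by (rule rk_abelian_group)
  have "\<ominus>\<^bsub>rk_module\<^esub> g = (\<lambda>x. (-1) \<odot>\<^bsub>H\<^esub> g x)"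
  proof (rule RK.minus_equality)
    show "(\<lambda>x. (-1) \<odot>\<^bsub>H\<^esub> g x) \<oplus>\<^bsub>rk_module\<^esub> g = \<zero>\<^bsub>rk_module\<^esub>"
      using g by (simp add: scale_minus_one M.l_neg)
  qed (use g in \<open>simp_all add: rk_carrier_scale\<close>)
  then show eq: "f \<ominus>\<^bsub>rk_module\<^esub> g = (\<lambda>x. f x \<ominus> g x)"
    using g by (simp add: a_minus_def scale_minus_one)
  show "(\<lambda>x. f x \<ominus> g x) \<in> rk_carrier"
    using RK.minus_closed[of f g] f g unfolding eq by simp
qed

lemma rk_gram_add_right:
  assumes f: "f \<in> rk_carrier" and g: "g \<in> rk_carrier" and h: "h \<in> rk_carrier"
  shows "rk_gram f (\<lambda>x. g x \<oplus> h x) = rk_gram f g + rk_gram f h"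
proof (rule rk_gram_eqI[OF f rk_carrier_add[OF g h]])
  fix p :: "'a \<Rightarrow> real" assume p: "p \<in> S\<^sub>*"
  interpret cstar_seminormed p by (rule cstar_seminormed_of_cont[OF p])
  obtain N where N: "0 \<le> N" "dual_bound p N f" by (rule dual_bound_exists[OF f p])
  have "\<exists>us. approximates p d us (\<lambda>x. g x \<oplus> h x) \<and> p (rk_gram f g + rk_gram f h - pairing f us) \<le> N * d"
    if d: "0 < d" for d
  proof -
    obtain us vs where us: "approximates p (d / 2) us g" and vs: "approximates p (d / 2) vs h"
      using rk_carrier_approx[OF g p, of "d / 2"] rk_carrier_approx[OF h p, of "d / 2"] d by auto
    have "approximates p d (us @ vs) (\<lambda>x. g x \<oplus> h x)"
      using approximates_add[OF us vs] g h by simp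
    moreover have "p (rk_gram f g + rk_gram f h - pairing f (us @ vs)) \<le> N * (d / 2) + N * (d / 2)"
    proof -
      have split: "rk_gram f g + rk_gram f h - pairing f (us @ vs)
          = (rk_gram f g - pairing f us) + (rk_gram f h - pairing f vs)" by simp
      show ?thesis unfolding split using d
        by (intro order_trans[OF triangle add_mono] rk_gram_approx[OF f g p N(2,1) us]
            rk_gram_approx[OF f h p N(2,1) vs]) simp_all
    qed
    ultimately show ?thesis by (intro exI[of _ "us @ vs"]) simp
  qed
  then show "\<exists>C. \<forall>d. 0 < d \<longrightarrow> d \<le> 1 \<longrightarrow> (\<exists>us. approximates p d us (\<lambda>x. g x \<oplus> h x) \<and>
      p (rk_gram f g + rk_gram f h - pairing f us) \<le> C * d)" by blast
qed

text \<open>A transformation \<open>g \<mapsto> g'\<close> that respects approximation and is intertwined by the pairing with a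
  Lipschitz map \<open>L\<close> is intertwined with \<open>L\<close> by the gramian as well. It is used for scalar multiples, for
  the action of the algebra and for translations. Only for the last of these do the seminorms \<open>p\<close> and \<open>q\<close> differ.\<close>

lemma rk_gram_transform:
  assumes f: "f \<in> rk_carrier" and g: "g \<in> rk_carrier" and g': "g' \<in> rk_carrier" and f': "f' \<in> rk_carrier"
    and approx: "\<And>p. p \<in> S\<^sub>* \<Longrightarrow> \<exists>q\<in>S\<^sub>*. \<exists>K\<ge>0. \<forall>d us. 0 < d \<longrightarrow> approximates q d us g \<longrightarrow> approximates p (K * d) (T us) g'"
    and pairing: "\<And>us. us \<in> combs \<Longrightarrow> pairing f' (T us) = L (pairing f us)"
    and L: "\<And>p. p \<in> S\<^sub>* \<Longrightarrow> \<exists>K\<ge>0. \<forall>a b. p (L a - L b) \<le> K * p (a - b)"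
  shows "rk_gram f' g' = L (rk_gram f g)"
proof (rule rk_gram_eqI[OF f' g'])
  fix p :: "'a \<Rightarrow> real" assume p: "p \<in> S\<^sub>*"
  interpret cstar_seminormed p by (rule cstar_seminormed_of_cont[OF p])
  obtain N where N: "0 \<le> N" "dual_bound p N f" by (rule dual_bound_exists[OF f p])
  obtain q K where q: "q \<in> S\<^sub>*" and K: "0 \<le> K"
      "\<And>d us. 0 < d \<Longrightarrow> approximates q d us g \<Longrightarrow> approximates p (K * d) (T us) g'"
    using approx[OF p] by blast
  obtain M where M: "0 \<le> M" "\<And>a b. p (L a - L b) \<le> M * p (a - b)" using L[OF p] by blast
  have "\<exists>vs. approximates p d vs g' \<and> p (L (rk_gram f g) - pairing f' vs) \<le> (M * N) * d"
    if d: "0 < d" for d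
  proof -
    define d' where "d' = min d (d / (K + 1))"
    have d': "0 < d'" "d' \<le> d" "K * d' \<le> d"
    proof -
      show "0 < d'" "d' \<le> d" using d K by (simp_all add: d'_def)
      have "K * d' \<le> K * (d / (K + 1))" using K by (intro mult_left_mono) (simp_all add: d'_def)
      also have "\<dots> \<le> (K + 1) * (d / (K + 1))" using K d by (intro mult_right_mono) simp_all
      also have "\<dots> = d" using K by simp
      finally show "K * d' \<le> d" .
    qed
    let ?r = "\<lambda>x. max (p x) (q x)"
    obtain us where us: "approximates ?r d' us g"
      using rk_carrier_approx[OF g max_cont_seminorm[OF p q] d'(1)] by blast
    have us_q: "approximates q d' us g" and us_p: "approximates p d us g"
      using approximates_mono[OF us, of q] approximates_mono[OF us, of p] d' by simp_all
    have "approximates p d (T us) g'"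
      using approximates_mono[OF K(2)[OF d'(1) us_q], of p] d' by simp
    moreover have "p (L (rk_gram f g) - pairing f' (T us)) \<le> M * (N * d)"
      unfolding pairing[OF approximates_combs[OF us]]
      using d by (intro order_trans[OF M(2) mult_left_mono[OF _ M(1)]] rk_gram_approx[OF f g p N(2,1) us_p]) simp
    ultimately show ?thesis by (auto simp: mult.assoc)
  qed
  then show "\<exists>C. \<forall>d. 0 < d \<longrightarrow> d \<le> 1 \<longrightarrow> (\<exists>us. approximates p d us g' \<and>
      p (L (rk_gram f g) - pairing f' us) \<le> C * d)" by blast
qed

lemma rk_gram_scale_right:
  assumes f: "f \<in> rk_carrier" and g: "g \<in> rk_carrier"
  shows "rk_gram f (\<lambda>x. c \<odot>\<^bsub>H\<^esub> g x) = c *\<^sub>C rk_gram f g"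
proof (rule rk_gram_transform[OF f g rk_carrier_scale[OF g] f, where L = "\<lambda>a. c *\<^sub>C a" and T = "scale_comb c"])
  fix p :: "'a \<Rightarrow> real" assume p: "p \<in> S\<^sub>*"
  interpret cstar_seminormed p by (rule cstar_seminormed_of_cont[OF p])
  show "\<exists>q\<in>S\<^sub>*. \<exists>K\<ge>0. \<forall>d us. 0 < d \<longrightarrow> approximates q d us g \<longrightarrow>
      approximates p (K * d) (scale_comb c us) (\<lambda>x. c \<odot>\<^bsub>H\<^esub> g x)"
    using approximates_scale g p by (intro bexI[of _ p] exI[of _ "cmod c"]) auto
  show "\<exists>K\<ge>0. \<forall>a b. p (c *\<^sub>C a - c *\<^sub>C b) \<le> K * p (a - b)"
    by (intro exI[of _ "cmod c"]) (simp add: scale flip: scaleC_module.scale_right_diff_distrib)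
qed (use f in \<open>simp add: pairing_scale\<close>)

lemma rk_gram_ract_right:
  assumes f: "f \<in> rk_carrier" and g: "g \<in> rk_carrier"
  shows "rk_gram f (\<lambda>x. g x \<cdot> b) = rk_gram f g * b"
proof (rule rk_gram_transform[OF f g rk_carrier_ract[OF g] f, where L = "\<lambda>a. a * b" and T = "ract_comb b"])
  fix p :: "'a \<Rightarrow> real" assume p: "p \<in> S\<^sub>*"
  interpret cstar_seminormed p by (rule cstar_seminormed_of_cont[OF p])
  show "\<exists>q\<in>S\<^sub>*. \<exists>K\<ge>0. \<forall>d us. 0 < d \<longrightarrow> approximates q d us g \<longrightarrow>
      approximates p (K * d) (ract_comb b us) (\<lambda>x. g x \<cdot> b)"
    using approximates_ract g p by (intro bexI[of _ p] exI[of _ "p b"]) auto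
  show "\<exists>K\<ge>0. \<forall>a a'. p (a * b - a' * b) \<le> K * p (a - a')"
    by (intro exI[of _ "p b"])
       (auto simp: mult.commute[of "p b"] left_diff_distrib[symmetric] intro: submultiplicative)
qed (use f in \<open>simp add: pairing_ract\<close>)

lemma rk_gram_zero_iff:
  assumes f: "f \<in> rk_carrier"
  shows "rk_gram f f = 0 \<longleftrightarrow> f = (\<lambda>x. \<zero>)"
proof
  assume "f = (\<lambda>x. \<zero>)"
  moreover have "p (rk_gram (\<lambda>x. \<zero>) (\<lambda>x. \<zero>)) = 0" if p: "p \<in> S\<^sub>*" for p
  proof -
    interpret cstar_seminormed p by (rule cstar_seminormed_of_cont[OF p])
    have "p (rk_gram (\<lambda>x. \<zero>) (\<lambda>x. \<zero>)) \<le> 0\<^sup>2"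
      by (rule rk_gram_le_bound[OF rk_carrier_zero p]) (simp_all add: dual_bound_def pairing_zero_fun)
    then show ?thesis using nonneg[of "rk_gram (\<lambda>x. \<zero>) (\<lambda>x. \<zero>)"] by simp
  qed
  ultimately show "rk_gram f f = 0" using cont_seminorms_separate by blast
next
  assume 0: "rk_gram f f = 0"
  show "f = (\<lambda>x. \<zero>)"
  proof
    fix x
    have "gram H (f x) (f x) = 0"
    proof (rule cont_seminorms_separate)
      fix p :: "'a \<Rightarrow> real" assume p: "p \<in> S\<^sub>*"
      interpret cstar_seminormed p by (rule cstar_seminormed_of_cont[OF p])
      have "p (pairing f [(x, f x)]) \<le> 0"
        using dual_bound_rk_gram[OF f p] f unfolding dual_bound_def 0 by (auto simp del: pairing_simps)
      then show "p (gram H (f x) (f x)) = 0" using nonneg[of "gram H (f x) (f x)"] by simp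
    qed
    then show "f x = \<zero>" using gram_eq_zero_iff f by simp
  qed
qed

text \<open>\<open>[f(x), f(x)]\<close> is the pairing of \<open>f\<close> with the section of \<open>h = f(x)\<close> at \<open>x\<close>, and the norm of this
  section is controlled by that of \<open>h\<close> since \<open>k(x, x)\<close> is a bounded operator.\<close>

lemma evaluation_bounded:
  assumes p: "p \<in> S\<^sub>*"
  obtains C where "0 \<le> C"
    "\<And>f N. (\<And>y. f y \<in> carrier H) \<Longrightarrow> 0 \<le> N \<Longrightarrow> dual_bound p N f \<Longrightarrow> norm_by p (f x) \<le> C * N"
proof -
  interpret cstar_seminormed p by (rule cstar_seminormed_of_cont[OF p])
  obtain c where c: "0 \<le> c" "\<And>h. h \<in> carrier H \<Longrightarrow> norm_by p (k x x h) \<le> c * norm_by p h"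
    using adjointable_bounded[OF hilbert_module_axioms hilbert_module_axioms _ p, of "k x x"] adjointable_kernel
    by (auto simp: adjointable_kernel_def)
  have "norm_by p (f x) \<le> sqrt c * N"
    if f: "\<And>y. f y \<in> carrier H" and N: "0 \<le> N" "dual_bound p N f" for f N
  proof -
    let ?h = "f x"
    have "(comb_norm p [(x, ?h)])\<^sup>2 = p (gram H (k x x ?h) ?h)"
      using f by (simp add: comb_norm_square[OF p])
    also have "\<dots> \<le> norm_by p (k x x ?h) * norm_by p ?h" by (rule cauchy_schwarz[OF p]) (simp_all add: f)
    also have "\<dots> \<le> (c * norm_by p ?h) * norm_by p ?h" by (intro mult_right_mono c f) (simp add: p)
    also have "\<dots> = (sqrt c * norm_by p ?h)\<^sup>2" using c(1) by (simp add: power_mult_distrib power2_eq_square)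
    finally have n: "comb_norm p [(x, ?h)] \<le> sqrt c * norm_by p ?h"
      by (rule power2_le_imp_le) (simp add: p c)
    have "p (pairing f [(x, ?h)]) \<le> N * comb_norm p [(x, ?h)]"
      using N(2) f unfolding dual_bound_def by (auto simp del: pairing_simps)
    then have "norm_by p ?h * norm_by p ?h \<le> N * comb_norm p [(x, ?h)]"
      using gram_seminorm_square[OF p, of ?h] by (simp add: power2_eq_square)
    also have "\<dots> \<le> N * (sqrt c * norm_by p ?h)" by (rule mult_left_mono[OF n N(1)])
    finally have le: "norm_by p ?h * norm_by p ?h \<le> (sqrt c * N) * norm_by p ?h" by (simp add: mult_ac)
    show ?thesis
    proof (cases "norm_by p ?h = 0")
      case False
      then have "0 < norm_by p ?h" using gram_seminorm_nonneg[OF p, of ?h] by linarith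
      then show ?thesis using le by simp
    qed (use c N in simp)
  qed
  then show ?thesis using that[of "sqrt c"] c(1) by simp
qed

lemma rk_seminorm:
  assumes f: "f \<in> rk_carrier" and p: "p \<in> S\<^sub>*"
  shows "0 \<le> gram_seminorm rk_module p f" "dual_bound p (gram_seminorm rk_module p f) f"
    and "dual_bound p N f \<Longrightarrow> 0 \<le> N \<Longrightarrow> gram_seminorm rk_module p f \<le> N"
proof -
  interpret cstar_seminormed p by (rule cstar_seminormed_of_cont[OF p])
  show "0 \<le> gram_seminorm rk_module p f" by (simp add: gram_seminorm_def)
  show "dual_bound p (gram_seminorm rk_module p f) f"
    using dual_bound_rk_gram[OF f p] by (simp add: gram_seminorm_def)
  show "gram_seminorm rk_module p f \<le> N" if "dual_bound p N f" "0 \<le> N"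
    using rk_gram_le_bound[OF f p that] that by (simp add: gram_seminorm_def real_le_lsqrt)
qed

end

context psd_kernel_module
begin

text \<open>A Cauchy filter converges pointwise, by boundedness of evaluation. The estimates in the dual norm only
  involve pairings with fixed finite sums, hence finitely many points, so they pass to the
  pointwise limit \<open>l\<close>: it is close to the members of the filter and therefore again approximable.\<close>

lemma rk_complete: "gram_complete rk_module"
  unfolding gram_complete_def
proof (intro allI impI)
  fix F :: "('x \<Rightarrow> 'h) filter"
  assume F_carrier: "F \<le> principal (carrier rk_module)" and "F \<noteq> bot"
    and F_cauchy: "F \<times>\<^sub>F F \<le> gram_uniformity rk_module"
  have in_carrier: "eventually (\<lambda>f. f \<in> rk_carrier) F" using F_carrier by (simp add: le_principal)
  have cauchy: thesis
    if p: "p \<in> S\<^sub>*" and e: "0 < e"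
      and that: "\<And>Q. eventually Q F \<Longrightarrow> (\<And>f. Q f \<Longrightarrow> f \<in> rk_carrier) \<Longrightarrow>
        (\<And>f g. Q f \<Longrightarrow> Q g \<Longrightarrow> gram_seminorm rk_module p (\<lambda>x. f x \<ominus> g x) < e) \<Longrightarrow> thesis"
    for p e thesis
  proof -
    have "F \<times>\<^sub>F F \<le> principal {(f, g). gram_seminorm rk_module p (f \<ominus>\<^bsub>rk_module\<^esub> g) < e}"
      by (rule order_trans[OF F_cauchy], unfold gram_uniformity_def)
         (rule INF_lower2[OF p], rule INF_lower, use e in simp)
    then obtain Q where "eventually Q F"
      "\<And>f g. Q f \<Longrightarrow> Q g \<Longrightarrow> gram_seminorm rk_module p (f \<ominus>\<^bsub>rk_module\<^esub> g) < e"
      by (auto simp: le_principal eventually_prod_same)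
    then show ?thesis
      using in_carrier
      by (intro that[of "\<lambda>f. Q f \<and> f \<in> rk_carrier"]) (auto simp: eventually_conj simp flip: rk_diff(1))
  qed
  have "\<exists>l\<in>carrier H. \<forall>p\<in>S\<^sub>*. ((\<lambda>f. norm_by p (f x \<ominus> l)) \<longlongrightarrow> 0) F" for x
  proof -
    let ?Fx = "filtermap (\<lambda>f. f x) F"
    have "?Fx \<noteq> bot" using \<open>F \<noteq> bot\<close> by (simp add: filtermap_bot_iff)
    moreover have "?Fx \<le> principal (carrier H)"
      using in_carrier by (auto simp: le_principal eventually_filtermap elim: eventually_mono)
    moreover have "?Fx \<times>\<^sub>F ?Fx \<le> gram_uniformity H"
      unfolding gram_uniformity_def
    proof (intro INF_greatest, simp only: le_principal)
      fix p :: "'a \<Rightarrow> real" and e :: real assume p: "p \<in> S\<^sub>*" and "e \<in> {0<..}"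
      then have e: "0 < e" by simp
      obtain C where C: "0 \<le> C"
        "\<And>f N. (\<And>y. f y \<in> carrier H) \<Longrightarrow> 0 \<le> N \<Longrightarrow> dual_bound p N f \<Longrightarrow> norm_by p (f x) \<le> C * N"
        using evaluation_bounded[OF p] by blast
      have e': "0 < e / (C + 1)" using e C by simp
      obtain Q where Q: "eventually Q F" "\<And>f. Q f \<Longrightarrow> f \<in> rk_carrier"
        "\<And>f g. Q f \<Longrightarrow> Q g \<Longrightarrow> gram_seminorm rk_module p (\<lambda>x. f x \<ominus> g x) < e / (C + 1)"
        by (rule cauchy[OF p e']) (rule that, assumption, blast+)
      have "norm_by p (f x \<ominus> g x) < e" if "Q f" "Q g" for f g
      proof -
        let ?n = "gram_seminorm rk_module p (\<lambda>x. f x \<ominus> g x)"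
        note d = rk_diff(2)[OF Q(2)[OF that(1)] Q(2)[OF that(2)]]
        have "norm_by p (f x \<ominus> g x) \<le> C * ?n"
          by (rule C(2)[of "\<lambda>x. f x \<ominus> g x" ?n, OF rk_carrier_closed[OF d] rk_seminorm(1,2)[OF d p]])
        also have "\<dots> \<le> (C + 1) * ?n" using rk_seminorm(1)[OF d p] by (intro mult_right_mono) simp_all
        also have "\<dots> < e" using Q(3)[OF that] C(1) by (simp add: pos_less_divide_eq mult.commute)
        finally show ?thesis .
      qed
      then have "\<forall>\<^sub>F (f, g) in F \<times>\<^sub>F F. norm_by p (f x \<ominus> g x) < e"
        using Q(1) unfolding eventually_prod_same by blast
      then show "\<forall>\<^sub>F y in ?Fx \<times>\<^sub>F ?Fx. y \<in> {(x, y). norm_by p (x \<ominus> y) < e}"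
        unfolding prod_filtermap1 prod_filtermap2 by (simp add: eventually_filtermap case_prod_unfold)
    qed
    ultimately obtain l where "l \<in> carrier H" "\<And>p. p \<in> S\<^sub>* \<Longrightarrow> ((\<lambda>y. norm_by p (y \<ominus> l)) \<longlongrightarrow> 0) ?Fx"
      using complete unfolding gram_complete_def by blast
    then show ?thesis by (auto simp: filterlim_filtermap)
  qed
  then obtain l where l: "\<And>x. l x \<in> carrier H"
      "\<And>x p. p \<in> S\<^sub>* \<Longrightarrow> ((\<lambda>f. norm_by p (f x \<ominus> l x)) \<longlongrightarrow> 0) F"
    by metis
  have pairing_lim: "((\<lambda>f. p (pairing f w - pairing l w)) \<longlongrightarrow> 0) F" if p: "p \<in> S\<^sub>*" and w: "w \<in> combs" for p w
    using w
  proof (induction rule: combs_induct)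
    case Nil
    interpret cstar_seminormed p by (rule cstar_seminormed_of_cont[OF p])
    show ?case by simp
  next
    case (Cons x h w)
    interpret cstar_seminormed p by (rule cstar_seminormed_of_cont[OF p])
    have "((\<lambda>f. norm_by p (f x \<ominus> l x) * norm_by p h + p (pairing f w - pairing l w)) \<longlongrightarrow> 0 * norm_by p h + 0) F"
      by (intro tendsto_intros l(2)[OF p] Cons.IH)
    then have lim: "((\<lambda>f. norm_by p (f x \<ominus> l x) * norm_by p h + p (pairing f w - pairing l w)) \<longlongrightarrow> 0) F" by simp
    have "eventually (\<lambda>f. p (pairing f ((x, h) # w) - pairing l ((x, h) # w))
        \<le> norm_by p (f x \<ominus> l x) * norm_by p h + p (pairing f w - pairing l w)) F"
      using in_carrier
    proof (rule eventually_mono)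
      fix f assume f: "f \<in> rk_carrier"
      have split: "pairing f ((x, h) # w) - pairing l ((x, h) # w)
          = gram H (f x \<ominus> l x) h + (pairing f w - pairing l w)"
        using f l(1) Cons(1) by (simp add: gram_diff_left)
      show "p (pairing f ((x, h) # w) - pairing l ((x, h) # w))
          \<le> norm_by p (f x \<ominus> l x) * norm_by p h + p (pairing f w - pairing l w)"
        unfolding split using f l(1) Cons(1)
        by (intro order_trans[OF triangle add_mono] cauchy_schwarz[OF p] order_refl) simp_all
    qed
    then show ?case
      by (intro tendsto_sandwich[OF _ _ tendsto_const lim]) (simp_all add: always_eventually)
  qed
  have close: thesis
    if p: "p \<in> S\<^sub>*" and e: "0 < e"
      and that: "\<And>Q. eventually Q F \<Longrightarrow> (\<And>f. Q f \<Longrightarrow> f \<in> rk_carrier) \<Longrightarrow>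
        (\<And>f q w. Q f \<Longrightarrow> q \<in> S\<^sub>* \<Longrightarrow> \<forall>x. q x \<le> p x \<Longrightarrow> w \<in> combs \<Longrightarrow>
           q (pairing l w - pairing f w) \<le> e * comb_norm q w) \<Longrightarrow> thesis"
    for p e thesis
  proof -
    obtain Q where Q: "eventually Q F" "\<And>f. Q f \<Longrightarrow> f \<in> rk_carrier"
      "\<And>f g. Q f \<Longrightarrow> Q g \<Longrightarrow> gram_seminorm rk_module p (\<lambda>x. f x \<ominus> g x) < e"
      by (rule cauchy[OF p e]) (rule that, assumption, blast+)
    have bound: "q (pairing l w - pairing f w) \<le> e * comb_norm q w"
      if f: "Q f" and q: "q \<in> S\<^sub>*" "\<forall>x. q x \<le> p x" and w: "w \<in> combs" for f q w
    proof -
      interpret cstar_seminormed q by (rule cstar_seminormed_of_cont[OF q(1)])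
      have "eventually (\<lambda>g. q (pairing l w - pairing f w) \<le> q (pairing g w - pairing l w) + e * comb_norm q w) F"
        using Q(1)
      proof (rule eventually_mono)
        fix g assume g: "Q g"
        note d = rk_diff(2)[OF Q(2)[OF g] Q(2)[OF f]]
        have "gram_seminorm rk_module q (\<lambda>x. g x \<ominus> f x) \<le> gram_seminorm rk_module p (\<lambda>x. g x \<ominus> f x)"
          using q(2) by (simp add: gram_seminorm_def)
        then have small: "gram_seminorm rk_module q (\<lambda>x. g x \<ominus> f x) \<le> e" using Q(3)[OF g f] by linarith
        have "q (pairing g w - pairing f w) = q (pairing (\<lambda>x. g x \<ominus> f x) w)"
          using Q(2)[OF f] Q(2)[OF g] w by (simp add: pairing_diff_fun)
        also have "\<dots> \<le> gram_seminorm rk_module q (\<lambda>x. g x \<ominus> f x) * comb_norm q w"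
          using rk_seminorm(2)[OF d q(1)] w by (simp add: dual_bound_def)
        also have "\<dots> \<le> e * comb_norm q w" using small q(1) by (intro mult_right_mono) simp_all
        finally show "q (pairing l w - pairing f w) \<le> q (pairing g w - pairing l w) + e * comb_norm q w"
          using triangle_diff[of "pairing g w - pairing f w" "pairing g w - pairing l w"] by simp
      qed
      moreover have "((\<lambda>g. q (pairing g w - pairing l w) + e * comb_norm q w) \<longlongrightarrow> 0 + e * comb_norm q w) F"
        by (intro tendsto_intros pairing_lim q(1) w)
      ultimately have "q (pairing l w - pairing f w) \<le> 0 + e * comb_norm q w"
        using tendsto_lowerbound \<open>F \<noteq> bot\<close> by blast
      then show ?thesis by simp
    qed
    show ?thesis by (rule that[of Q, OF Q(1) Q(2) bound])
  qed
  have l_carrier: "l \<in> rk_carrier"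
  proof (rule rk_carrierI[OF l(1)])
    fix p :: "'a \<Rightarrow> real" assume p: "p \<in> S\<^sub>*"
    have "\<exists>us. approximates p (2 * d) us l" if d: "0 < d" for d
    proof -
      obtain Q where Q: "eventually Q F" "\<And>f. Q f \<Longrightarrow> f \<in> rk_carrier"
        "\<And>f q w. Q f \<Longrightarrow> q \<in> S\<^sub>* \<Longrightarrow> \<forall>x. q x \<le> p x \<Longrightarrow> w \<in> combs \<Longrightarrow> q (pairing l w - pairing f w) \<le> d * comb_norm q w"
        by (rule close[OF p d]) (rule that, assumption, blast+)
      obtain f where f: "Q f" using eventually_happens'[OF \<open>F \<noteq> bot\<close> Q(1)] by blast
      obtain us where us: "approximates p d us f" using rk_carrier_approx[OF Q(2)[OF f] p d] by blast
      have "approximates p (2 * d) us l"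
        unfolding approximates_def
      proof (intro conjI ballI impI)
        show "us \<in> combs" by (rule approximates_combs[OF us])
        fix q :: "'a \<Rightarrow> real" and w assume q: "q \<in> S\<^sub>*" "\<forall>x. q x \<le> p x" and w: "w \<in> combs"
        interpret cstar_seminormed q by (rule cstar_seminormed_of_cont[OF q(1)])
        have "q (pairing f w - pairing (comb_sections us) w) \<le> d * comb_norm q w"
          using us q w by (simp add: approximates_def)
        then show "q (pairing l w - pairing (comb_sections us) w) \<le> 2 * d * comb_norm q w"
          using Q(3)[OF f q w] triangle[of "pairing l w - pairing f w" "pairing f w - pairing (comb_sections us) w"]
          by simp
      qed
      then show ?thesis by blast
    qed
    then show "\<exists>C. \<forall>d>0. \<exists>us. approximates p (C * d) us l" by blast
  qed
  show "\<exists>f\<in>carrier rk_module. \<forall>p\<in>S\<^sub>*. ((\<lambda>g. gram_seminorm rk_module p (g \<ominus>\<^bsub>rk_module\<^esub> f)) \<longlongrightarrow> 0) F"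
  proof (intro bexI[of _ l] ballI tendstoI)
    fix p :: "'a \<Rightarrow> real" and e :: real assume p: "p \<in> S\<^sub>*" and e: "0 < e"
    interpret cstar_seminormed p by (rule cstar_seminormed_of_cont[OF p])
    obtain Q where Q: "eventually Q F" "\<And>f. Q f \<Longrightarrow> f \<in> rk_carrier"
        "\<And>f q w. Q f \<Longrightarrow> q \<in> S\<^sub>* \<Longrightarrow> \<forall>x. q x \<le> p x \<Longrightarrow> w \<in> combs \<Longrightarrow> q (pairing l w - pairing f w) \<le> (e / 2) * comb_norm q w"
      by (rule close[OF p, of "e / 2"]) (use e in simp, rule that, assumption, blast+)
    show "eventually (\<lambda>g. dist (gram_seminorm rk_module p (g \<ominus>\<^bsub>rk_module\<^esub> l)) 0 < e) F"
      using Q(1)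
    proof (rule eventually_mono)
      fix g assume g: "Q g"
      note d = rk_diff[OF Q(2)[OF g] l_carrier]
      have "dual_bound p (e / 2) (\<lambda>x. g x \<ominus> l x)"
        unfolding dual_bound_def
      proof
        fix w assume w: "w \<in> combs"
        have "p (pairing (\<lambda>x. g x \<ominus> l x) w) = p (pairing l w - pairing g w)"
          using Q(2)[OF g] l(1) w by (simp add: pairing_diff_fun diff_commute)
        also have "\<dots> \<le> (e / 2) * comb_norm p w" by (rule Q(3)[OF g p _ w]) simp
        finally show "p (pairing (\<lambda>x. g x \<ominus> l x) w) \<le> (e / 2) * comb_norm p w" .
      qed
      then have "gram_seminorm rk_module p (\<lambda>x. g x \<ominus> l x) \<le> e / 2"
        using e by (intro rk_seminorm(3)[OF d(2) p]) simp_all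
      then show "dist (gram_seminorm rk_module p (g \<ominus>\<^bsub>rk_module\<^esub> l)) 0 < e"
        using rk_seminorm(1)[OF d(2) p] e unfolding d(1) by (simp add: dist_real_def)
    qed
  qed (simp add: l_carrier)
qed

theorem rk_hilbert_module: "hilbert_module rk_module"
proof (rule hilbert_module.intro[OF rk_is_module], unfold_locales)
  show "gram_complete rk_module" by (rule rk_complete)
qed (auto simp: rk_carrier_ract ract_add_left ract_add_right ract_mult ract_smult_left ract_smult_right
    rk_gram_star[symmetric] rk_gram_nonneg rk_gram_zero_iff rk_gram_add_right rk_gram_scale_right
    rk_gram_ract_right)

lemma kernel_section_eq: "h \<in> carrier H \<Longrightarrow> kernel_section k x h = comb_sections [(x, h)]"
  by (rule ext) (simp add: kernel_section_def)

lemma kernel_is_adjoint: "is_adjoint H H (k y x) (k x y)"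
  unfolding is_adjoint_def
proof (intro conjI ballI kernel_linear)
  fix h g assume h: "h \<in> carrier H" and g: "g \<in> carrier H"
  have "gram H (k y x h) g = star (gram H (k x y g) h)"
    using pairing_sections_hermitian[of "[(x, h)]" "[(y, g)]"] h g by simp
  then show "gram H (k y x h) g = gram H h (k x y g)" using gram_star[of h "k x y g"] h g by simp
qed

theorem rk_reproducing: "reproducing_kernel_module H k rk_module"
  unfolding reproducing_kernel_module_def
proof (intro conjI allI ballI)
  show "hermitian_kernel H k"
    by (simp add: hermitian_kernel_def adjoint_eq[OF hilbert_module_axioms kernel_is_adjoint])
  show "hilbert_module rk_module" by (rule rk_hilbert_module)
  show "function_submodule H rk_module" by (auto simp: function_submodule_def)
  show "kernel_section k x h \<in> carrier rk_module" if "h \<in> carrier H" for x h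
    using that by (simp add: kernel_section_eq comb_sections_rk_carrier)
  show "gram H (f x) h = gram rk_module f (kernel_section k x h)"
    if "f \<in> carrier rk_module" "h \<in> carrier H" for f x h
    using that by (simp add: kernel_section_eq rk_gram_comb_sections)
qed

end

section \<open>The translation representation\<close>

locale invariant_psd_kernel = psd_kernel_module H k
  for H :: "('h, 'a::locally_cstar_algebra) hilbert_mod" (structure) and k :: "'x \<Rightarrow> 'x \<Rightarrow> 'h \<Rightarrow> 'h" +
  fixes act :: "'g::star_semigroup \<Rightarrow> 'x \<Rightarrow> 'x"
  assumes action: "semigroup_action act"
    and invariant: "invariant_kernel act k"
    and bounded: "bounded_translations act H k"
begin

definition translate :: "'g \<Rightarrow> ('x \<times> 'h) list \<Rightarrow> ('x \<times> 'h) list" where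
  "translate \<xi> us = map (\<lambda>(x, h). (act \<xi> x, h)) us"

lemma translate_simps [simp]:
  "translate \<xi> [] = []" "translate \<xi> ((x, h) # us) = (act \<xi> x, h) # translate \<xi> us"
  "translate \<xi> (us @ vs) = translate \<xi> us @ translate \<xi> vs"
  by (simp_all add: translate_def)

lemma translate_closed [simp]: "us \<in> combs \<Longrightarrow> translate \<xi> us \<in> combs"
  by (force simp: combs_def translate_def)

lemma comb_sections_translate: "comb_sections (translate \<xi> us) y = comb_sections us (act (star \<xi>) y)"
  using invariant by (induction us) (auto simp: invariant_kernel_def)

lemma pairing_translate: "pairing f (translate \<xi> us) = pairing (\<lambda>x. f (act \<xi> x)) us"
  by (induction us) auto

lemma comb_norm_translate:
  assumes p: "p \<in> S\<^sub>*"
  obtains q C where "q \<in> S\<^sub>*" "0 \<le> C" "\<And>us. us \<in> combs \<Longrightarrow> comb_norm p (translate \<xi> us) \<le> C * comb_norm q us"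
proof -
  obtain q c where q: "q \<in> S\<^sub>*" and c: "0 \<le> c"
    "\<And>(n::nat) h x. \<forall>i\<in>{1..n}. h i \<in> carrier H \<Longrightarrow>
        p (\<Sum>i=1..n. \<Sum>j=1..n. gram H (k (act \<xi> (x i)) (act \<xi> (x j)) (h j)) (h i))
        \<le> c * q (\<Sum>i=1..n. \<Sum>j=1..n. gram H (k (x i) (x j) (h j)) (h i))"
    using bounded p unfolding bounded_translations_def by meson
  have "comb_norm p (translate \<xi> us) \<le> sqrt c * comb_norm q us" if us: "us \<in> combs" for us
  proof -
    have len: "length (translate \<xi> us) = length us" by (simp add: translate_def)
    have nth: "fst (translate \<xi> us ! (i - 1)) = act \<xi> (fst (us ! (i - 1)))"
        "snd (translate \<xi> us ! (i - 1)) = snd (us ! (i - 1))" if "i \<in> {1..length us}" for i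
      using that by (auto simp: translate_def case_prod_unfold)
    have "p (pairing (comb_sections (translate \<xi> us)) (translate \<xi> us))
        \<le> c * q (pairing (comb_sections us) us)"
    proof -
      let ?x = "\<lambda>i. fst (us ! (i - 1))" and ?h = "\<lambda>i. snd (us ! (i - 1))"
      have "pairing (comb_sections (translate \<xi> us)) (translate \<xi> us)
          = (\<Sum>i=1..length us. \<Sum>j=1..length us. gram H (k (act \<xi> (?x i)) (act \<xi> (?x j)) (?h j)) (?h i))"
        unfolding pairing_sections_double_sum[OF translate_closed[OF us]] len
        by (intro sum.cong refl) (simp only: nth)
      then show ?thesis
        using c(2)[OF comb_nth_closed[OF us], of ?x] unfolding pairing_sections_double_sum[OF us] by simp
    qed
    then show ?thesis unfolding comb_norm_def real_sqrt_mult[symmetric] by simp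
  qed
  then show ?thesis using that[OF q, of "sqrt c"] c(1) by simp
qed

text \<open>Pairing \<open>f \<circ> \<xi>\<^sup>*\<close> with \<open>w\<close> is pairing \<open>f\<close> with the translate \<open>w'\<close> of \<open>w\<close>, whose norm is only
  controlled by another seminorm. So the distance of \<open>f\<close> from \<open>us\<close> cannot be used directly. Instead a
  much better approximation \<open>vs\<close> of \<open>f\<close> is inserted: the distance of \<open>vs\<close> from \<open>us\<close> is that of finite
  sums, to which the bound on translations applies, and the distance of \<open>f\<close> from \<open>vs\<close> tends to zero
  for fixed \<open>w'\<close>.\<close>

lemma approximates_translate:
  assumes f: "f \<in> rk_carrier" and p: "p \<in> S\<^sub>*"
  shows "\<exists>q\<in>S\<^sub>*. \<exists>K\<ge>0. \<forall>d us. 0 < d \<longrightarrow> approximates q d us f \<longrightarrow>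
    approximates p (K * d) (translate \<xi> us) (\<lambda>x. f (act (star \<xi>) x))"
proof -
  obtain q0 C where q0: "q0 \<in> S\<^sub>*" and C: "0 \<le> C"
    "\<And>us. us \<in> combs \<Longrightarrow> comb_norm p (translate \<xi> us) \<le> C * comb_norm q0 us"
    using comb_norm_translate[OF p, of \<xi>] by blast
  let ?q = "\<lambda>x. max (p x) (q0 x)"
  have q: "?q \<in> S\<^sub>*" by (rule max_cont_seminorm[OF p q0])
  have "approximates p (C * d) (translate \<xi> us) (\<lambda>x. f (act (star \<xi>) x))"
    if d: "0 < d" and us: "approximates ?q d us f" for d us
    unfolding approximates_def
  proof (intro conjI ballI impI)
    note us' = approximates_combs[OF us]
    show "translate \<xi> us \<in> combs" using us' by simp
    fix r :: "'a \<Rightarrow> real" and w assume r: "r \<in> S\<^sub>*" "\<forall>x. r x \<le> p x" and w: "w \<in> combs"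
    interpret cstar_seminormed r by (rule cstar_seminormed_of_cont[OF r(1)])
    have rq: "r x \<le> max (p x) (q0 x)" for x using r(2) by (simp add: le_max_iff_disj)
    define w' where "w' = translate (star \<xi>) w"
    have w': "w' \<in> combs" using w by (simp add: w'_def)
    have sections: "pairing (comb_sections vs) w' = pairing (comb_sections (translate \<xi> vs)) w" for vs
      unfolding w'_def pairing_translate by (simp add: comb_sections_translate[abs_def])
    show "r (pairing (\<lambda>x. f (act (star \<xi>) x)) w - pairing (comb_sections (translate \<xi> us)) w) \<le> C * d * comb_norm r w"
    proof (rule le_of_le_add_mult[where c = "comb_norm r w' + C * comb_norm r w"])
      fix e :: real assume e: "0 < e"
      obtain vs where vs: "approximates ?q e vs f" using rk_carrier_approx[OF f q e] by blast
      note vs' = approximates_combs[OF vs]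
      have "pairing (\<lambda>x. f (act (star \<xi>) x)) w - pairing (comb_sections (translate \<xi> us)) w
          = (pairing f w' - pairing (comb_sections vs) w') + pairing (comb_sections (diff_comb vs us)) w'"
        using us' vs' w' unfolding w'_def[symmetric] pairing_translate[symmetric] sections[symmetric]
        by (simp add: pairing_sections_append_left pairing_sections_scale_left scaleC_one)
      then have "r (pairing (\<lambda>x. f (act (star \<xi>) x)) w - pairing (comb_sections (translate \<xi> us)) w)
          \<le> r (pairing f w' - pairing (comb_sections vs) w') + r (pairing (comb_sections (diff_comb vs us)) w')"
        by (simp only: triangle)
      also have "r (pairing f w' - pairing (comb_sections vs) w') \<le> e * comb_norm r w'"
        by (rule approximatesD[OF approximates_mono[OF vs rq order_refl] r(1) w'])
      also have "r (pairing (comb_sections (diff_comb vs us)) w')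
          \<le> comb_norm r (translate \<xi> (diff_comb vs us)) * comb_norm r w"
        unfolding sections using us' vs' w by (intro comb_cauchy_schwarz[OF r(1)]) simp_all
      also have "comb_norm r (translate \<xi> (diff_comb vs us)) \<le> comb_norm p (translate \<xi> (diff_comb vs us))"
        using r(2) by (intro comb_norm_mono) simp
      also have "\<dots> \<le> C * comb_norm q0 (diff_comb vs us)" using us' vs' by (intro C(2)) simp
      also have "comb_norm q0 (diff_comb vs us) \<le> e + d"
        using e d approximates_mono[OF vs, of q0 e] approximates_mono[OF us, of q0 d]
        by (intro comb_norm_diff_le[OF q0, where f = f]) simp_all
      finally show "r (pairing (\<lambda>x. f (act (star \<xi>) x)) w - pairing (comb_sections (translate \<xi> us)) w)
          \<le> C * d * comb_norm r w + (comb_norm r w' + C * comb_norm r w) * e"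
        using C(1) r(1) by (simp add: algebra_simps mult_left_mono mult_right_mono)
    qed (use C(1) r(1) in simp)
  qed
  then show ?thesis using q C(1) by blast
qed

lemma rk_carrier_translate: "f \<in> rk_carrier \<Longrightarrow> (\<lambda>x. f (act \<xi> x)) \<in> rk_carrier"
proof (rule rk_carrierI)
  fix p :: "'a \<Rightarrow> real" assume f: "f \<in> rk_carrier" and p: "p \<in> S\<^sub>*"
  obtain q K where q: "q \<in> S\<^sub>*" and K: "\<And>d us. 0 < d \<Longrightarrow> approximates q d us f \<Longrightarrow>
      approximates p (K * d) (translate (star \<xi>) us) (\<lambda>x. f (act \<xi> x))"
    using approximates_translate[OF f p, of "star \<xi>"] by (auto simp: star_star)
  then show "\<exists>C. \<forall>d>0. \<exists>us. approximates p (C * d) us (\<lambda>x. f (act \<xi> x))"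
    using rk_carrier_approx[OF f q] by meson
qed simp

lemma rk_gram_translate:
  assumes f: "f \<in> rk_carrier" and g: "g \<in> rk_carrier"
  shows "rk_gram (\<lambda>x. f (act (star \<xi>) x)) g = rk_gram f (\<lambda>x. g (act \<xi> x))"
proof (rule sym, rule rk_gram_transform[where L = "\<lambda>a. a" and T = "translate (star \<xi>)"])
  show "\<exists>q\<in>S\<^sub>*. \<exists>K\<ge>0. \<forall>d us. 0 < d \<longrightarrow> approximates q d us g \<longrightarrow>
      approximates p (K * d) (translate (star \<xi>) us) (\<lambda>x. g (act \<xi> x))" if "p \<in> S\<^sub>*" for p
    using approximates_translate[OF g that, of "star \<xi>"] by (simp add: star_star)
  show "\<exists>K\<ge>0. \<forall>a b. p (a - b) \<le> K * p (a - b)" for p :: "'a \<Rightarrow> real" by (intro exI[of _ 1]) simp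
qed (simp_all add: f g rk_carrier_translate pairing_translate)

definition translation_rep :: "'g \<Rightarrow> ('x \<Rightarrow> 'h) \<Rightarrow> ('x \<Rightarrow> 'h)" where
  "translation_rep \<xi> = (\<lambda>f\<in>rk_carrier. \<lambda>x. f (act (star \<xi>) x))"

lemma translation_rep_linear: "translation_rep \<xi> \<in> linear_ops rk_module rk_module"
  by (auto simp: linear_ops_def translation_rep_def rk_carrier_translate rk_carrier_add rk_carrier_scale)

lemma translation_rep_adjoint: "is_adjoint rk_module rk_module (translation_rep \<xi>) (translation_rep (star \<xi>))"
  unfolding is_adjoint_def
proof (intro conjI ballI translation_rep_linear)
  fix f g assume "f \<in> carrier rk_module" "g \<in> carrier rk_module"
  then show "gram rk_module (translation_rep \<xi> f) g = gram rk_module f (translation_rep (star \<xi>) g)"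
    by (simp add: translation_rep_def rk_gram_translate star_star)
qed

theorem translation_rep_star_representation: "star_representation rk_module translation_rep"
  unfolding star_representation_def
proof (intro conjI allI)
  show "translation_rep \<xi> \<in> \<L>\<^sub>* rk_module rk_module" for \<xi>
    using translation_rep_linear translation_rep_adjoint by (auto simp: adjointable_ops_def)
  show "translation_rep (star \<xi>) = adjoint rk_module rk_module (translation_rep \<xi>)" for \<xi>
    using adjoint_eq[OF rk_hilbert_module translation_rep_adjoint] by simp
  show "translation_rep (\<xi> * \<eta>) = compose (carrier rk_module) (translation_rep \<xi>) (translation_rep \<eta>)" for \<xi> \<eta>
    using action
    by (auto simp: translation_rep_def compose_def rk_carrier_translate star_mult semigroup_action_def
        intro!: ext)
qed

lemma translation_rep_kernel_section:
  "h \<in> carrier H \<Longrightarrow> translation_rep \<xi> (kernel_section k x h) = kernel_section k (act \<xi> x) h"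
  using invariant comb_sections_rk_carrier[of "[(x, h)]"]
  by (auto simp: translation_rep_def kernel_section_def invariant_kernel_def simp flip: kernel_section_eq
      split: if_splits)

end

section \<open>The equivalence\<close>

theorem theorem3p2:
  fixes act :: "'g::star_semigroup \<Rightarrow> 'x \<Rightarrow> 'x"
    and H :: "('h, 'a::locally_cstar_algebra) hilbert_mod"
    and k :: "'x \<Rightarrow> 'x \<Rightarrow> 'h \<Rightarrow> 'h"
  assumes "semigroup_action act"
    and "hilbert_module H"
    and "adjointable_kernel H k"
  shows
    "((psd_kernel H k \<and> invariant_kernel act k \<and> bounded_translations act H k) \<longleftrightarrow>
        (\<exists>(K :: ('x \<Rightarrow> 'h, 'a) hilbert_mod) \<pi> V. invariant_linearisation act H k K \<pi> V)) \<and>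
     ((\<exists>(K :: ('k, 'a) hilbert_mod) \<pi> V. invariant_linearisation act H k K \<pi> V) \<longrightarrow>
        (psd_kernel H k \<and> invariant_kernel act k \<and> bounded_translations act H k)) \<and>
     ((psd_kernel H k \<and> invariant_kernel act k \<and> bounded_translations act H k) \<longleftrightarrow>
        (\<exists>(R :: ('x \<Rightarrow> 'h, 'a) hilbert_mod) \<rho>.
           reproducing_kernel_module H k R \<and> star_representation R \<rho> \<and>
           (\<forall>\<xi> x. \<forall>h\<in>carrier H.
              \<rho> \<xi> (kernel_section k x h) = kernel_section k (act \<xi> x) h)))"
proof -
  let ?one = "psd_kernel H k \<and> invariant_kernel act k \<and> bounded_translations act H k"
  let ?three = "\<exists>(R :: ('x \<Rightarrow> 'h, 'a) hilbert_mod) \<rho>.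
    reproducing_kernel_module H k R \<and> star_representation R \<rho> \<and>
    (\<forall>\<xi> x. \<forall>h\<in>carrier H. \<rho> \<xi> (kernel_section k x h) = kernel_section k (act \<xi> x) h)"
  have two_one: ?one if "invariant_linearisation act H k K \<pi> V" for K :: "('j, 'a) hilbert_mod" and \<pi> V
    using invariant_linearisation_necessary[OF assms(2) that] by blast
  have one_three: ?three if ?one
  proof -
    interpret invariant_psd_kernel H k act
      using assms that
      by (intro invariant_psd_kernel.intro psd_kernel_module.intro psd_kernel_module_axioms.intro
          invariant_psd_kernel_axioms.intro) simp_all
    show ?thesis
      using rk_reproducing translation_rep_star_representation translation_rep_kernel_section by blast
  qed
  have three_two: "\<exists>(K :: ('x \<Rightarrow> 'h, 'a) hilbert_mod) \<pi> V. invariant_linearisation act H k K \<pi> V" if ?three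
    using that reproducing_kernel_module_linearises[OF assms(2,3)] by meson
  have two_one': ?one if "invariant_linearisation act H k K \<pi> V" for K :: "('k, 'a) hilbert_mod" and \<pi> V
    using invariant_linearisation_necessary[OF assms(2) that] by blast
  show ?thesis using two_one two_one' one_three three_two by blast
qed

end
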